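(* Let $X$ be a space with subspaces $Y_1$ and $Y_2$, let $\iota_1\colon Y_1\hookrightarrow X$ and $\iota_2\colon Y_2\hookrightarrow X$ be the inclusions, and let $\mathbf{k}$ be a field. Suppose there are classes $$\alpha_1,\dots,\alpha_j\in\ker\bigl(\cup\colon H^*(X;\mathbf{k})\otimes H^*(X;\mathbf{k})\to H^*(X;\mathbf{k})\bigr)$$ such that $(\iota_1^*\otimes\iota_2^* )(\alpha_1\cdots\alpha_j)\neq 0$ in $H^*(Y_1;\mathbf{k})\otimes H^*(Y_2;\mathbf{k})$. Then $\mathrm{TC}_X(Y_1\times Y_2)>j$.
   Context: $I=[0,1]$. For a space $X$, $P(X)$ is the space of all continuous maps $\sigma\colon I\to X$ with the compact-open topology. For $A\subseteq X\times X$, $P_X(A)\subseteq P(X)$ is the subspace of paths $\sigma$ with $(\sigma(0),\sigma(1))\in A$, and $\mathrm{TC}_X(A)$ is the smallest integer $k$ such that $A$ has a cover by sets $U_1,\dots,U_k$ open in $A$ for which there are continuous maps $s_i\colon U_i\to P_X(A)$ with $s_i(x,y)(0)=x$ and $s_i(x,y)(1)=y$ for all $(x,y)\in U_i$; if no such $k$ exists, $\mathrm{TC}_X(A)=\infty$. Tensor products are over $\mathbf{k}$; $\cup$ is the map induced by cup product, $a\otimes b\mapsto a\cup b$. The product $\alpha_1\cdots\alpha_j$ is taken in the graded tensor product algebra $H^*(X;\mathbf{k})\otimes H^*(X;\mathbf{k})$, with multiplication $(a\otimes b)(c\otimes d)=(-1)^{|b||c|}(a\cup c)\otimes(b\cup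 d)$. *)

theory Defs
  imports "HOL-Homology.Homology" "HOL-Algebra.AbelCoset" "HOL-Algebra.Module"
    "HOL-Library.Poly_Mapping" "HOL-Library.Extended_Nat"
begin

section \<open>Path spaces and topological complexity\<close>

text \<open>Maps are made extensional, so that a continuous map on \<open>topspace Y\<close> is a single point of the
  mapping space. (With \<open>K = {}\<close> the subbasis contains the whole carrier.)\<close>

definition compact_open_topology :: "'b topology \<Rightarrow> 'a topology \<Rightarrow> ('b \<Rightarrow> 'a) topology" where
  "compact_open_topology Y X =
     topology_generated_by
       {{f. continuous_map Y X f \<and> f \<in> extensional (topspace Y) \<and> f ` K \<subseteq> U} | K U.
          compactin Y K \<and> openin X U}"

definition path_space :: "'a topology \<Rightarrow> (real \<Rightarrow> 'a) topology" where
  "path_space X = compact_open_topology (top_of_set {0..1}) X"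

definition path_space_on :: "'a topology \<Rightarrow> ('a \<times> 'a) set \<Rightarrow> (real \<Rightarrow> 'a) topology" where
  "path_space_on X A = subtopology (path_space X) {\<sigma>. (\<sigma> 0, \<sigma> 1) \<in> A}"

definition TC :: "'a topology \<Rightarrow> ('a \<times> 'a) set \<Rightarrow> enat" where
  "TC X A = Inf {enat k | k. \<exists>U :: nat \<Rightarrow> ('a \<times> 'a) set.
     (\<Union>i\<in>{1..k}. U i) = A \<and>
     (\<forall>i\<in>{1..k}. openin (subtopology (prod_topology X X) A) (U i) \<and>
        (\<exists>s. continuous_map (subtopology (prod_topology X X) (U i)) (path_space_on X A) s \<and>
             (\<forall>(x, y)\<in>U i. s (x, y) 0 = x \<and> s (x, y) 1 = y)))}"

section \<open>Quotients, direct sums and tensor products of vector spaces\<close>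

text \<open>Vector spaces over the field given by the type \<open>'k\<close> are \<open>module\<close> records. Where a vector
  space is not an algebra, its \<open>mult\<close> and \<open>one\<close> fields are irrelevant.\<close>

definition quotient_module :: "('k, 'v) module \<Rightarrow> 'v set \<Rightarrow> ('k, 'v set) module" where
  "quotient_module M N =
     \<lparr>carrier = a_rcosets\<^bsub>M\<^esub> N, mult = undefined, one = undefined,
      zero = N, add = set_add M,
      smult = (\<lambda>c A. \<Union>a\<in>A. N +>\<^bsub>M\<^esub> (c \<odot>\<^bsub>M\<^esub> a))\<rparr>"

definition direct_sum :: "(nat \<Rightarrow> ('k, 'v) module) \<Rightarrow> ('k, nat \<Rightarrow> 'v) module" where
  "direct_sum M =
     \<lparr>carrier = {x. (\<forall>n. x n \<in> carrier (M n)) \<and> finite {n. x n \<noteq> \<zero>\<^bsub>M n\<^esub>}},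
      mult = undefined, one = undefined,
      zero = (\<lambda>n. \<zero>\<^bsub>M n\<^esub>),
      add = (\<lambda>x y n. x n \<oplus>\<^bsub>M n\<^esub> y n),
      smult = (\<lambda>c x n. c \<odot>\<^bsub>M n\<^esub> x n)\<rparr>"

text \<open>The vector space with basis \<open>S\<close>; the basis vector of \<open>s\<close> is \<open>Poly_Mapping.single s 1\<close>.\<close>

definition free_module :: "'s set \<Rightarrow> ('k::field, 's \<Rightarrow>\<^sub>0 'k) module" where
  "free_module S =
     \<lparr>carrier = {u. Poly_Mapping.keys u \<subseteq> S}, mult = undefined, one = undefined,
      zero = 0, add = (+), smult = (\<lambda>c. Poly_Mapping.map ((*) c))\<rparr>"

definition tensor_relations ::
    "('k::field, 'v) module \<Rightarrow> ('k, 'w) module \<Rightarrow> ('v \<times> 'w \<Rightarrow>\<^sub>0 'k) set" where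
  "tensor_relations M N =
     {Poly_Mapping.single (a \<oplus>\<^bsub>M\<^esub> a', b) 1
        - Poly_Mapping.single (a, b) 1 - Poly_Mapping.single (a', b) 1 | a a' b.
        a \<in> carrier M \<and> a' \<in> carrier M \<and> b \<in> carrier N} \<union>
     {Poly_Mapping.single (a, b \<oplus>\<^bsub>N\<^esub> b') 1
        - Poly_Mapping.single (a, b) 1 - Poly_Mapping.single (a, b') 1 | a b b'.
        a \<in> carrier M \<and> b \<in> carrier N \<and> b' \<in> carrier N} \<union>
     {Poly_Mapping.single (c \<odot>\<^bsub>M\<^esub> a, b) 1 - Poly_Mapping.single (a, b) c | c a b.
        a \<in> carrier M \<and> b \<in> carrier N} \<union>
     {Poly_Mapping.single (a, c \<odot>\<^bsub>N\<^esub> b) 1 - Poly_Mapping.single (a, b) c | c a b.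
        a \<in> carrier M \<and> b \<in> carrier N}"

definition tensor_null :: "('k::field, 'v) module \<Rightarrow> ('k, 'w) module \<Rightarrow> ('v \<times> 'w \<Rightarrow>\<^sub>0 'k) set" where
  "tensor_null M N = Modules.module.span (\<lambda>c. Poly_Mapping.map ((*) c)) (tensor_relations M N)"

definition tensor_product ::
    "('k::field, 'v) module \<Rightarrow> ('k, 'w) module \<Rightarrow> ('k, ('v \<times> 'w \<Rightarrow>\<^sub>0 'k) set) module" where
  "tensor_product M N =
     quotient_module (free_module (carrier M \<times> carrier N)) (tensor_null M N)"

definition pure_tensor ::
    "('k::field, 'v) module \<Rightarrow> ('k, 'w) module \<Rightarrow> 'v \<Rightarrow> 'w \<Rightarrow> ('v \<times> 'w \<Rightarrow>\<^sub>0 'k) set" where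
  "pure_tensor M N a b =
     tensor_null M N +>\<^bsub>free_module (carrier M \<times> carrier N)\<^esub> Poly_Mapping.single (a, b) 1"

text \<open>\<open>tensor_lift L f\<close> is the linear map to \<open>L\<close> on a tensor product sending \<open>a \<otimes> b\<close> to \<open>f (a, b)\<close>,
  for bilinear \<open>f\<close>: the linear extension of \<open>f\<close> is then constant on each coset.\<close>

definition linear_extension :: "('k::field, 'l) module \<Rightarrow> ('s \<Rightarrow> 'l) \<Rightarrow> ('s \<Rightarrow>\<^sub>0 'k) \<Rightarrow> 'l" where
  "linear_extension L f u =
     (\<Oplus>\<^bsub>L\<^esub>s\<in>Poly_Mapping.keys u. Poly_Mapping.lookup u s \<odot>\<^bsub>L\<^esub> f s)"

definition tensor_lift ::
    "('k::field, 'l) module \<Rightarrow> ('v \<times> 'w \<Rightarrow> 'l) \<Rightarrow> ('v \<times> 'w \<Rightarrow>\<^sub>0 'k) set \<Rightarrow> 'l" where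
  "tensor_lift L f A = the_elem (linear_extension L f ` A)"

definition tensor_map ::
    "('k::field, 'v) module \<Rightarrow> ('k, 'w) module \<Rightarrow> ('v1 \<Rightarrow> 'v) \<Rightarrow> ('w1 \<Rightarrow> 'w) \<Rightarrow>
     ('v1 \<times> 'w1 \<Rightarrow>\<^sub>0 'k) set \<Rightarrow> ('v \<times> 'w \<Rightarrow>\<^sub>0 'k) set" where
  "tensor_map M N f g =
     tensor_lift (tensor_product M N) (\<lambda>(a, b). pure_tensor M N (f a) (g b))"

text \<open>The graded tensor product of two graded algebras, whose elements are families indexed by the
  degree. Writing \<open>b\<close> and \<open>c\<close> as sums of their homogeneous parts, the sign rule for homogeneous
  elements becomes \<open>(a \<otimes> b)(c \<otimes> d) = (\<Sum>q r. (-1)^(q * r) (a c\<^sub>r) \<otimes> (b\<^sub>q d))\<close>.\<close>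

definition homogeneous_part :: "('k, nat \<Rightarrow> 'v) module \<Rightarrow> nat \<Rightarrow> (nat \<Rightarrow> 'v) \<Rightarrow> nat \<Rightarrow> 'v" where
  "homogeneous_part M n x = (\<zero>\<^bsub>M\<^esub>)(n := x n)"

definition graded_tensor_product ::
    "('k::field, nat \<Rightarrow> 'v) module \<Rightarrow> ('k, nat \<Rightarrow> 'w) module \<Rightarrow>
     ('k, ((nat \<Rightarrow> 'v) \<times> (nat \<Rightarrow> 'w) \<Rightarrow>\<^sub>0 'k) set) module" where
  "graded_tensor_product M N =
     (let T = tensor_product M N in
      T\<lparr>mult := (\<lambda>A B.
           tensor_lift T (\<lambda>(a, b). tensor_lift T (\<lambda>(c, d).
             \<Oplus>\<^bsub>T\<^esub>q\<in>{q. b q \<noteq> \<zero>\<^bsub>N\<^esub> q}. \<Oplus>\<^bsub>T\<^esub>r\<in>{r. c r \<noteq> \<zero>\<^bsub>M\<^esub> r}.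
               (-1) ^ (q * r) \<odot>\<^bsub>T\<^esub>
                 pure_tensor M N (a \<otimes>\<^bsub>M\<^esub> homogeneous_part M r c) (homogeneous_part N q b \<otimes>\<^bsub>N\<^esub> d))
             B) A),
        one := pure_tensor M N \<one>\<^bsub>M\<^esub> \<one>\<^bsub>N\<^esub>\<rparr>)"

section \<open>Singular cohomology with coefficients in a field\<close>

text \<open>An \<open>n\<close>-cochain of \<open>X\<close> is a function on the singular \<open>n\<close>-simplices of \<open>X\<close>, set to \<open>0\<close> at all other
  arguments.\<close>

type_synonym ('a, 'k) cochain = "((nat \<Rightarrow> real) \<Rightarrow> 'a) \<Rightarrow> 'k"

type_synonym ('a, 'k) cohom = "nat \<Rightarrow> ('a, 'k) cochain set"

type_synonym ('a, 'k) cohom_tensor = "(('a, 'k) cohom \<times> ('a, 'k) cohom \<Rightarrow>\<^sub>0 'k) set"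

definition cochains :: "nat \<Rightarrow> 'a topology \<Rightarrow> ('a, 'k::field) cochain set" where
  "cochains n X = {\<phi>. \<forall>\<sigma>. \<not> singular_simplex n X \<sigma> \<longrightarrow> \<phi> \<sigma> = 0}"

definition coboundary ::
    "nat \<Rightarrow> 'a topology \<Rightarrow> ('a, 'k::field) cochain \<Rightarrow> ('a, 'k) cochain" where
  "coboundary n X \<phi> = (\<lambda>\<sigma>. if singular_simplex (Suc n) X \<sigma>
     then \<Sum>i\<le>Suc n. (-1) ^ i * \<phi> (singular_face (Suc n) i \<sigma>) else 0)"

definition cocycles :: "nat \<Rightarrow> 'a topology \<Rightarrow> ('a, 'k::field) cochain set" where
  "cocycles n X = {\<phi> \<in> cochains n X. coboundary n X \<phi> = (\<lambda>\<sigma>. 0)}"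

definition coboundaries :: "nat \<Rightarrow> 'a topology \<Rightarrow> ('a, 'k::field) cochain set" where
  "coboundaries n X =
     (case n of 0 \<Rightarrow> {\<lambda>\<sigma>. 0} | Suc m \<Rightarrow> coboundary m X ` cochains m X)"

definition cocycle_module :: "nat \<Rightarrow> 'a topology \<Rightarrow> ('k::field, ('a, 'k) cochain) module" where
  "cocycle_module n X =
     \<lparr>carrier = cocycles n X, mult = undefined, one = undefined,
      zero = (\<lambda>\<sigma>. 0), add = (\<lambda>\<phi> \<psi> \<sigma>. \<phi> \<sigma> + \<psi> \<sigma>), smult = (\<lambda>c \<phi> \<sigma>. c * \<phi> \<sigma>)\<rparr>"

definition singular_cohomology ::
    "nat \<Rightarrow> 'a topology \<Rightarrow> ('k::field, ('a, 'k) cochain set) module" where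
  "singular_cohomology n X = quotient_module (cocycle_module n X) (coboundaries n X)"

definition cohom_class ::
    "nat \<Rightarrow> 'a topology \<Rightarrow> ('a, 'k::field) cochain \<Rightarrow> ('a, 'k) cochain set" where
  "cohom_class n X \<phi> = coboundaries n X +>\<^bsub>cocycle_module n X\<^esub> \<phi>"

text \<open>The cup product evaluates the two cochains on the front \<open>p\<close>-face and on the back \<open>q\<close>-face
  of a \<open>(p + q)\<close>-simplex. The front face needs no reindexing, because \<open>standard_simplex p\<close> is
  contained in \<open>standard_simplex (p + q)\<close>.\<close>

definition front_face :: "nat \<Rightarrow> ((nat \<Rightarrow> real) \<Rightarrow> 'a) \<Rightarrow> (nat \<Rightarrow> real) \<Rightarrow> 'a" where
  "front_face p \<sigma> = restrict \<sigma> (standard_simplex p)"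

definition back_face :: "nat \<Rightarrow> nat \<Rightarrow> ((nat \<Rightarrow> real) \<Rightarrow> 'a) \<Rightarrow> (nat \<Rightarrow> real) \<Rightarrow> 'a" where
  "back_face p q \<sigma> =
     restrict (\<lambda>x. \<sigma> (\<lambda>i. if i < p then 0 else x (i - p))) (standard_simplex q)"

definition cup_cochain ::
    "nat \<Rightarrow> nat \<Rightarrow> 'a topology \<Rightarrow> ('a, 'k::field) cochain \<Rightarrow> ('a, 'k) cochain \<Rightarrow> ('a, 'k) cochain" where
  "cup_cochain p q X \<phi> \<psi> = (\<lambda>\<sigma>. if singular_simplex (p + q) X \<sigma>
     then \<phi> (front_face p \<sigma>) * \<psi> (back_face p q \<sigma>) else 0)"

definition cup_class ::
    "nat \<Rightarrow> nat \<Rightarrow> 'a topology \<Rightarrow>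
     ('a, 'k::field) cochain set \<Rightarrow> ('a, 'k) cochain set \<Rightarrow> ('a, 'k) cochain set" where
  "cup_class p q X A B = (\<Union>\<phi>\<in>A. \<Union>\<psi>\<in>B. cohom_class (p + q) X (cup_cochain p q X \<phi> \<psi>))"

definition cohomology_algebra :: "'a topology \<Rightarrow> ('k::field, ('a, 'k) cohom) module" where
  "cohomology_algebra X =
     (direct_sum (\<lambda>n. singular_cohomology n X))
       \<lparr>mult := (\<lambda>x y n. \<Oplus>\<^bsub>singular_cohomology n X\<^esub>p\<in>{..n}. cup_class p (n - p) X (x p) (y (n - p))),
        one := (\<lambda>n. if n = 0
                    then cohom_class 0 X (\<lambda>\<sigma>. if singular_simplex 0 X \<sigma> then 1 else 0)
                    else \<zero>\<^bsub>singular_cohomology n X\<^esub>)\<rparr>"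

definition cochain_pullback ::
    "nat \<Rightarrow> 'b topology \<Rightarrow> ('b \<Rightarrow> 'a) \<Rightarrow> ('a, 'k::field) cochain \<Rightarrow> ('b, 'k) cochain" where
  "cochain_pullback n Y f \<phi> =
     (\<lambda>\<sigma>. if singular_simplex n Y \<sigma> then \<phi> (simplex_map n f \<sigma>) else 0)"

definition cohom_pullback ::
    "'b topology \<Rightarrow> ('b \<Rightarrow> 'a) \<Rightarrow> ('a, 'k::field) cohom \<Rightarrow> ('b, 'k) cohom" where
  "cohom_pullback Y f x = (\<lambda>n. \<Union>\<phi>\<in>x n. cohom_class n Y (cochain_pullback n Y f \<phi>))"

definition cohom_tensor_algebra :: "'a topology \<Rightarrow> ('k::field, ('a, 'k) cohom_tensor) module" where
  "cohom_tensor_algebra X = graded_tensor_product (cohomology_algebra X) (cohomology_algebra X)"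

definition cup_map :: "'a topology \<Rightarrow> ('a, 'k::field) cohom_tensor \<Rightarrow> ('a, 'k) cohom" where
  "cup_map X = tensor_lift (cohomology_algebra X) (\<lambda>(a, b). a \<otimes>\<^bsub>cohomology_algebra X\<^esub> b)"

end

theory Submission
  imports Defs "HOL-Analysis.Abstract_Topological_Spaces"
begin

text \<open>An element of \<open>H\<^sup>*(X) \<otimes> H\<^sup>*(X)\<close> is represented by a \<^emph>\<open>bicochain\<close>, a function of pairs of singular
  simplices. With front and back faces in both variables and the sign \<open>(-1)\<^bsup>qr\<^esup>\<close>, bicochains form a
  differential graded algebra in which \<open>(a \<otimes> b)(c \<otimes> d) = \<plusminus> ac \<otimes> bd\<close> holds for cochains, so that neither graded
  commutativity of the cup product nor an Eilenberg--Zilber map is needed.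

  Suppose that \<open>Y\<^sub>1 \<times> Y\<^sub>2\<close> is covered by at most \<open>j\<close> open sets \<open>U\<^sub>i\<close> with sections \<open>s\<^sub>i\<close>. For simplices
  \<open>\<sigma>\<close>, \<open>\<tau>\<close> with \<open>\<sigma> \<times> \<tau>\<close> in \<open>U\<^sub>i\<close>, the paths of \<open>s\<^sub>i\<close> from points of \<open>\<sigma>\<close> to points of \<open>\<tau>\<close> form a simplex on
  the join of the two domains. Evaluating a cocycle \<open>b\<close> on these joins shows that \<open>1 \<otimes> b\<close> and \<open>b \<otimes> 1\<close> are
  cohomologous on such pairs; hence \<open>\<alpha>\<^sub>i\<close> has a representative vanishing on them, and the product of these
  representatives vanishes on all pairs lying in some \<open>U\<^sub>i\<close>. Subdividing two cycles \<open>z\<close> in \<open>Y\<^sub>1\<close> and \<open>w\<close> in \<open>Y\<^sub>2\<close>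
  does not change its value on \<open>z \<otimes> w\<close>, which is therefore \<open>0\<close>. Over a field a tensor that vanishes on all
  pairs of cycles is \<open>0\<close>.\<close>

section \<open>Vector spaces as records\<close>

text \<open>Classically each \<open>\<alpha> i\<close> restricts to zero on \<open>U i\<close>,
  lifts to a relative class, and relative classes are multiplied. Here a bicochain vanishing on the
  pairs inside \<open>U i\<close> plays the part of the relative class: such bicochains are
  preserved by multiplication, since front and back faces stay in the image of their simplex, and
  subdivision takes the place of excision. The paths given by the sections may leave
  \<open>Y1\<close> and \<open>Y2\<close>, so the joins are simplices of \<open>X\<close>; hence the
  zero divisors live over \<open>X\<close>, and restriction to \<open>Y1\<close> and
  \<open>Y2\<close> comes last. The corrections that make a representative vanish are total
  coboundaries of arbitrary bicochains, not sums of products of cocycles, so representatives are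
  controlled only up to \<open>bicobd\<close>; evaluation on pairs of cycles kills this ambiguity.
  Two obstacles shape the end. An open subset of a product is not a product of open sets, so the two
  numbers of subdivisions cannot be chosen independently. And cohomology may be
  infinite-dimensional, so the detection by cycles treats one finite sum of pure tensors at a
  time.\<close>

type_synonym 'a simplex = "(nat \<Rightarrow> real) \<Rightarrow> 'a"

abbreviation "H \<equiv> cohomology_algebra"
abbreviation "HH X1 X2 \<equiv> tensor_product (H X1) (H X2)"
abbreviation "HH_pure X1 X2 \<equiv> pure_tensor (H X1) (H X2)"
abbreviation "keys \<equiv> Poly_Mapping.keys"
abbreviation "lookup \<equiv> Poly_Mapping.lookup"
abbreviation "single \<equiv> Poly_Mapping.single"
abbreviation scale :: "'k::field \<Rightarrow> ('s \<Rightarrow>\<^sub>0 'k) \<Rightarrow> 's \<Rightarrow>\<^sub>0 'k"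
  where "scale \<equiv> \<lambda>c. Poly_Mapping.map ((*) c)"

text \<open>Scalars are the elements of the type \<open>'k\<close>, so no record for the field
  occurs. The fields \<open>mult\<close> and \<open>one\<close> stay free, so that the same locale
  covers bare vector spaces and the algebras built on them.\<close>

locale vspace = abelian_group M for M :: "('k::field, 'v) module" (structure) +
  assumes smult_closed [simp, intro]: "x \<in> carrier M \<Longrightarrow> c \<odot> x \<in> carrier M"
    and smult_add_left: "x \<in> carrier M \<Longrightarrow> (c + d) \<odot> x = c \<odot> x \<oplus> d \<odot> x"
    and smult_add_right: "x \<in> carrier M \<Longrightarrow> y \<in> carrier M \<Longrightarrow> c \<odot> (x \<oplus> y) = c \<odot> x \<oplus> c \<odot> y"
    and smult_smult: "x \<in> carrier M \<Longrightarrow> c \<odot> (d \<odot> x) = (c * d) \<odot> x"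
    and smult_one [simp]: "x \<in> carrier M \<Longrightarrow> 1 \<odot> x = x"
begin

lemma smult_zero_left [simp]:
  assumes "x \<in> carrier M"
  shows "0 \<odot> x = \<zero>"
proof -
  have "0 \<odot> x = 0 \<odot> x \<oplus> 0 \<odot> x" using smult_add_left[OF assms, of 0 0] by simp
  then show ?thesis using add.l_cancel_one'[of "0 \<odot> x" "0 \<odot> x"] assms by simp
qed

lemma smult_zero_right [simp]: "c \<odot> \<zero> = \<zero>"
proof -
  have "c \<odot> \<zero> = c \<odot> \<zero> \<oplus> c \<odot> \<zero>" using smult_add_right[of \<zero> \<zero> c] by simp
  then show ?thesis using add.l_cancel_one'[of "c \<odot> \<zero>" "c \<odot> \<zero>"] by simp
qed

lemma smult_minus_one: "x \<in> carrier M \<Longrightarrow> (- 1) \<odot> x = \<ominus> x"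
  using smult_add_left[of x "-1" 1] by (simp add: minus_equality)

lemma finsum_smult:
  "f \<in> A \<rightarrow> carrier M \<Longrightarrow> c \<odot> (\<Oplus>i\<in>A. f i) = (\<Oplus>i\<in>A. c \<odot> f i)"
proof (induction A rule: infinite_finite_induct)
  case (insert x A)
  then have "f \<in> A \<rightarrow> carrier M" "f x \<in> carrier M" by auto
  then show ?case using insert by (simp add: finsum_insert smult_add_right Pi_def)
qed (auto simp: finsum_infinite finsum_empty)

lemma finsum_superset:
  assumes "finite B" "A \<subseteq> B" "f \<in> B \<rightarrow> carrier M" "\<And>i. i \<in> B - A \<Longrightarrow> f i = \<zero>"
  shows "finsum M f A = finsum M f B"
  using assms by (intro add.finprod_mono_neutral_cong_left) auto

end

text \<open>Inverses are absent from the assumptions because \<open>(- 1) \<odot> x\<close> is one: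
  adding \<open>1 \<odot> x\<close> gives \<open>0 \<odot> x = \<zero>\<close>.\<close>

lemma vspaceI:
  fixes M :: "('k::field, 'v) module" (structure)
  assumes "\<zero> \<in> carrier M" "\<And>x y. x \<in> carrier M \<Longrightarrow> y \<in> carrier M \<Longrightarrow> x \<oplus> y \<in> carrier M"
    "\<And>x c. x \<in> carrier M \<Longrightarrow> c \<odot> x \<in> carrier M"
    "\<And>x y z. x \<in> carrier M \<Longrightarrow> y \<in> carrier M \<Longrightarrow> z \<in> carrier M \<Longrightarrow> (x \<oplus> y) \<oplus> z = x \<oplus> (y \<oplus> z)"
    "\<And>x y. x \<in> carrier M \<Longrightarrow> y \<in> carrier M \<Longrightarrow> x \<oplus> y = y \<oplus> x"
    "\<And>x. x \<in> carrier M \<Longrightarrow> \<zero> \<oplus> x = x"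
    "\<And>x. x \<in> carrier M \<Longrightarrow> 0 \<odot> x = \<zero>"
    "\<And>x. x \<in> carrier M \<Longrightarrow> 1 \<odot> x = x"
    "\<And>x c d. x \<in> carrier M \<Longrightarrow> (c + d) \<odot> x = c \<odot> x \<oplus> d \<odot> x"
    "\<And>x y c. x \<in> carrier M \<Longrightarrow> y \<in> carrier M \<Longrightarrow> c \<odot> (x \<oplus> y) = c \<odot> x \<oplus> c \<odot> y"
    "\<And>x c d. x \<in> carrier M \<Longrightarrow> c \<odot> (d \<odot> x) = (c * d) \<odot> x"
  shows "vspace M"
proof -
  have "\<exists>y\<in>carrier M. y \<oplus> x = \<zero>" if "x \<in> carrier M" for x
    using assms(9)[OF that, of "-1" 1] assms(3)[OF that, of "-1"] assms(7,8)[OF that] by auto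
  then have "abelian_group M"
    by (intro abelian_groupI) (use assms in auto)
  then show ?thesis
    by (intro vspace.intro vspace_axioms.intro) (use assms in auto)
qed

locale vsubspace = vspace M for M :: "('k::field, 'v) module" (structure) +
  fixes N
  assumes subset: "N \<subseteq> carrier M" and zero_mem: "\<zero> \<in> N"
    and add_mem: "x \<in> N \<Longrightarrow> y \<in> N \<Longrightarrow> x \<oplus> y \<in> N"
    and smult_mem: "x \<in> N \<Longrightarrow> c \<odot> x \<in> N"
begin

abbreviation "Q \<equiv> quotient_module M N"

sublocale coset: abelian_subgroup N M
proof (intro abelian_subgroupI3 additive_subgroupI)
  show "subgroup N (add_monoid M)"
  proof (rule add.subgroupI)
    show "\<ominus> a \<in> N" if "a \<in> N" for a
      using smult_mem[OF that, of "-1"] that subset smult_minus_one by auto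
  qed (use subset zero_mem add_mem in auto)
qed unfold_locales

lemma coset_eq_iff:
  assumes "x \<in> carrier M" "y \<in> carrier M"
  shows "N +> x = N +> y \<longleftrightarrow> x \<ominus> y \<in> N"
proof
  assume "N +> x = N +> y"
  then have "x \<in> N +> y" using coset.a_rcos_self[OF assms(1)] by simp
  then show "x \<ominus> y \<in> N" using coset.a_rcos_module[OF assms(2,1)] by (simp add: minus_eq)
next
  assume "x \<ominus> y \<in> N"
  then have "x \<in> N +> y" using coset.a_rcos_module[OF assms(2,1)] by (simp add: minus_eq)
  from a_repr_independence[OF this assms(2) coset.a_subgroup] show "N +> x = N +> y" by simp
qed

lemma quotient_carrier: "carrier Q = (\<lambda>x. N +> x) ` carrier M"
  by (auto simp: quotient_module_def A_RCOSETS_def')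

lemma quotient_zero: "\<zero>\<^bsub>Q\<^esub> = N +> \<zero>"
  using a_coset_add_zero[OF subset] by (simp add: quotient_module_def)

lemma quotient_add:
  "x \<in> carrier M \<Longrightarrow> y \<in> carrier M \<Longrightarrow>
    (N +> x) \<oplus>\<^bsub>Q\<^esub> (N +> y) = N +> (x \<oplus> y)"
  by (simp add: quotient_module_def coset.a_rcos_sum)

text \<open>\<open>quotient_module\<close> takes a union over all representatives. Two of them
  differ by some \<open>h \<in> N\<close>, their multiples by \<open>c \<odot> h \<in> N\<close>, so
  every member of the union is the same coset.\<close>

lemma quotient_smult:
  assumes x: "x \<in> carrier M"
  shows "c \<odot>\<^bsub>Q\<^esub> (N +> x) = N +> c \<odot> x"
proof -
  have "N +> (c \<odot> a) = N +> c \<odot> x" if a: "a \<in> N +> x" for a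
  proof -
    obtain h where h: "h \<in> N" "a = h \<oplus> x" using a by (auto simp: a_r_coset_def')
    then have [simp]: "h \<in> carrier M" using subset by auto
    have "c \<odot> a \<ominus> c \<odot> x = c \<odot> h"
      using x h by (simp add: smult_add_right minus_eq a_assoc r_neg)
    then show ?thesis using coset_eq_iff[of "c \<odot> a" "c \<odot> x"] smult_mem[OF h(1)] x h by simp
  qed
  then have "(\<Union>a\<in>N +> x. N +> c \<odot> a) = (\<Union>a\<in>N +> x. N +> c \<odot> x)"
    by (rule SUP_cong[OF refl])
  also have "\<dots> = N +> c \<odot> x"
    using coset.a_rcos_self[OF x] by (intro SUP_eq_const) auto
  finally show ?thesis by (simp add: quotient_module_def)
qed

lemma quotient_vspace: "vspace Q"
proof (rule vspaceI, unfold quotient_carrier quotient_zero)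
  fix x y z :: "'v set" and c d :: 'k
  assume "x \<in> (\<lambda>x. N +> x) ` carrier M"
  then obtain a where a: "a \<in> carrier M" "x = N +> a" by auto
  show "c \<odot>\<^bsub>Q\<^esub> x \<in> (\<lambda>x. N +> x) ` carrier M"
    "(N +> \<zero>) \<oplus>\<^bsub>Q\<^esub> x = x"
    "0 \<odot>\<^bsub>Q\<^esub> x = N +> \<zero>" "1 \<odot>\<^bsub>Q\<^esub> x = x"
    "(c + d) \<odot>\<^bsub>Q\<^esub> x
      = c \<odot>\<^bsub>Q\<^esub> x \<oplus>\<^bsub>Q\<^esub> d \<odot>\<^bsub>Q\<^esub> x"
    "c \<odot>\<^bsub>Q\<^esub> (d \<odot>\<^bsub>Q\<^esub> x) = (c * d) \<odot>\<^bsub>Q\<^esub> x"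
    using a(1) by (simp_all add: a(2) quotient_add quotient_smult smult_add_left smult_smult)
  assume "y \<in> (\<lambda>x. N +> x) ` carrier M"
  then obtain b where b: "b \<in> carrier M" "y = N +> b" by auto
  show "x \<oplus>\<^bsub>Q\<^esub> y \<in> (\<lambda>x. N +> x) ` carrier M"
    "c \<odot>\<^bsub>Q\<^esub> (x \<oplus>\<^bsub>Q\<^esub> y)
      = c \<odot>\<^bsub>Q\<^esub> x \<oplus>\<^bsub>Q\<^esub> c \<odot>\<^bsub>Q\<^esub> y"
    using a(1) b(1) by (simp_all add: a(2) b(2) quotient_add quotient_smult smult_add_right)
  show "x \<oplus>\<^bsub>Q\<^esub> y = y \<oplus>\<^bsub>Q\<^esub> x"
    using a(1) b(1) by (simp add: a(2) b(2) quotient_add a_comm)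
  assume "z \<in> (\<lambda>x. N +> x) ` carrier M"
  then obtain e where e: "e \<in> carrier M" "z = N +> e" by auto
  show "x \<oplus>\<^bsub>Q\<^esub> y \<oplus>\<^bsub>Q\<^esub> z
      = x \<oplus>\<^bsub>Q\<^esub> (y \<oplus>\<^bsub>Q\<^esub> z)"
    using a(1) b(1) e(1) by (simp add: a(2) b(2) e(2) quotient_add a_assoc)
qed (auto simp: quotient_add)

end

section \<open>Direct sums and free vector spaces\<close>

lemma direct_sum_simps:
  "carrier (direct_sum M) = {x. (\<forall>n. x n \<in> carrier (M n)) \<and> finite {n. x n \<noteq> \<zero>\<^bsub>M n\<^esub>}}"
  "\<zero>\<^bsub>direct_sum M\<^esub> = (\<lambda>n. \<zero>\<^bsub>M n\<^esub>)"
  "x \<oplus>\<^bsub>direct_sum M\<^esub> y = (\<lambda>n. x n \<oplus>\<^bsub>M n\<^esub> y n)"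
  "c \<odot>\<^bsub>direct_sum M\<^esub> x = (\<lambda>n. c \<odot>\<^bsub>M n\<^esub> x n)"
  by (auto simp: direct_sum_def)

lemma direct_sum_vspace:
  fixes M :: "nat \<Rightarrow> ('k::field, 'v) module"
  assumes "\<And>n. vspace (M n)"
  shows "vspace (direct_sum M)"
proof -
  interpret vspace "M n" for n by (rule assms)
  show ?thesis
  proof (rule vspaceI, unfold direct_sum_simps)
    fix x y :: "nat \<Rightarrow> 'v"
    assume x: "x \<in> {x. (\<forall>n. x n \<in> carrier (M n)) \<and> finite {n. x n \<noteq> \<zero>\<^bsub>M n\<^esub>}}"
      and y: "y \<in> {x. (\<forall>n. x n \<in> carrier (M n)) \<and> finite {n. x n \<noteq> \<zero>\<^bsub>M n\<^esub>}}"
    have "{n. x n \<oplus>\<^bsub>M n\<^esub> y n \<noteq> \<zero>\<^bsub>M n\<^esub>} \<subseteq> {n. x n \<noteq> \<zero>\<^bsub>M n\<^esub>} \<union> {n. y n \<noteq> \<zero>\<^bsub>M n\<^esub>}" by auto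
    with x y show "(\<lambda>n. x n \<oplus>\<^bsub>M n\<^esub> y n) \<in> {x. (\<forall>n. x n \<in> carrier (M n)) \<and> finite {n. x n \<noteq> \<zero>\<^bsub>M n\<^esub>}}"
      by (auto intro: finite_subset)
    show "(\<lambda>n. x n \<oplus>\<^bsub>M n\<^esub> y n) = (\<lambda>n. y n \<oplus>\<^bsub>M n\<^esub> x n)"
      using x y by (auto intro!: a_comm)
    fix c :: 'k
    have "{n. c \<odot>\<^bsub>M n\<^esub> x n \<noteq> \<zero>\<^bsub>M n\<^esub>} \<subseteq> {n. x n \<noteq> \<zero>\<^bsub>M n\<^esub>}" by auto
    with x show "(\<lambda>n. c \<odot>\<^bsub>M n\<^esub> x n) \<in> {x. (\<forall>n. x n \<in> carrier (M n)) \<and> finite {n. x n \<noteq> \<zero>\<^bsub>M n\<^esub>}}"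
      by (auto intro: finite_subset)
  qed (auto simp: a_assoc smult_add_left smult_add_right smult_smult)
qed

text \<open>Used for the cohomology algebra, which is a direct sum with \<open>mult\<close> and
  \<open>one\<close> overwritten.\<close>

lemma vspace_cong:
  fixes M M' :: "('k::field, 'v) module"
  assumes "carrier M' = carrier M" "zero M' = zero M" "add M' = add M" "smult M' = smult M" "vspace M"
  shows "vspace M'"
proof -
  interpret vspace M by fact
  show ?thesis
  proof (rule vspaceI, unfold assms(1-4))
    fix x y assume "x \<in> carrier M" "y \<in> carrier M"
    then show "x \<oplus>\<^bsub>M\<^esub> y = y \<oplus>\<^bsub>M\<^esub> x" by (rule a_comm)
  qed (simp_all add: a_assoc smult_add_left smult_add_right smult_smult)
qed

lemma lookup_map_times [simp]:
  "lookup (scale (c::'k::field) u) s = c * lookup u s"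
  by (simp add: Poly_Mapping.map.rep_eq when_def)

lemma map_times_single:
  "scale (c::'k::field) (single s d) = single s (c * d)"
  by (rule poly_mapping_eqI) (simp add: lookup_single when_def)

lemma poly_mapping_vector_space: "vector_space (scale :: 'k::field \<Rightarrow> _)"
  by unfold_locales (auto intro!: poly_mapping_eqI simp: lookup_add algebra_simps)

interpretation poly_mapping: vector_space "scale :: 'k::field \<Rightarrow> _"
  by (rule poly_mapping_vector_space)

lemma keys_map_times: "keys (scale (c::'k::field) u) \<subseteq> keys u"
  by (auto simp: in_keys_iff)

lemma free_module_simps:
  "carrier (free_module S) = {u. keys u \<subseteq> S}"
  "\<zero>\<^bsub>free_module S\<^esub> = 0" "u \<oplus>\<^bsub>free_module S\<^esub> v = u + v"
  "c \<odot>\<^bsub>free_module S\<^esub> u = scale c u"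
  by (auto simp: free_module_def)

lemma free_module_vspace: "vspace (free_module S :: ('k::field, 's \<Rightarrow>\<^sub>0 'k) module)"
proof (rule vspaceI, unfold free_module_simps)
  fix x y z :: "'s \<Rightarrow>\<^sub>0 'k" and c d :: 'k
  assume x: "x \<in> {u. keys u \<subseteq> S}"
  then show "scale c x \<in> {u. keys u \<subseteq> S}"
    using keys_map_times[of c x] by auto
  show "scale 0 x = 0" "scale 1 x = x"
    "scale c (scale d x) = scale (c * d) x"
    by (rule poly_mapping.scale_zero_left poly_mapping.scale_one poly_mapping.scale_scale)+
  show "scale (c + d) x = scale c x + scale d x"
    by (rule poly_mapping.scale_left_distrib)
  assume y: "y \<in> {u. keys u \<subseteq> S}"
  show "x + y \<in> {u. keys u \<subseteq> S}"
    using keys_add[of x y] x y by auto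
  show "scale c (x + y) = scale c x + scale c y"
    by (rule poly_mapping.scale_right_distrib)
qed (auto simp: algebra_simps)

section \<open>The universal property of the tensor product\<close>

context vspace
begin

text \<open>Cancellation can shrink the support of \<open>u + v\<close>, so sums over supports
  become comparable only on a common finite superset.\<close>

lemma linear_extension_superset:
  assumes "finite K" "keys u \<subseteq> K" "f \<in> K \<rightarrow> carrier M"
  shows "linear_extension M f u = (\<Oplus>s\<in>K. lookup u s \<odot> f s)"
  unfolding linear_extension_def
  by (rule finsum_superset) (use assms in \<open>auto simp: in_keys_iff Pi_iff\<close>)

lemma linear_extension_closed:
  "f \<in> keys u \<rightarrow> carrier M \<Longrightarrow> linear_extension M f u \<in> carrier M"
  unfolding linear_extension_def by (intro finsum_closed) auto

lemma linear_extension_zero [simp]: "linear_extension M f 0 = \<zero>"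
  by (simp add: linear_extension_def finsum_empty)

lemma linear_extension_add:
  assumes f: "f \<in> S \<rightarrow> carrier M" and u: "keys u \<subseteq> S" and v: "keys v \<subseteq> S"
  shows "linear_extension M f (u + v) = linear_extension M f u \<oplus> linear_extension M f v"
proof -
  let ?K = "keys u \<union> keys v"
  have fK: "f \<in> ?K \<rightarrow> carrier M" using assms by auto
  have 1: "linear_extension M f (u + v) = (\<Oplus>s\<in>?K. lookup (u + v) s \<odot> f s)"
    using keys_add[of u v] by (intro linear_extension_superset fK) auto
  have 2: "linear_extension M f u = (\<Oplus>s\<in>?K. lookup u s \<odot> f s)"
    by (intro linear_extension_superset fK) auto
  have 3: "linear_extension M f v = (\<Oplus>s\<in>?K. lookup v s \<odot> f s)"
    by (intro linear_extension_superset fK) auto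
  have "linear_extension M f (u + v)
      = (\<Oplus>s\<in>?K. lookup u s \<odot> f s \<oplus> lookup v s \<odot> f s)"
    unfolding 1 by (rule finsum_cong') (use fK in \<open>auto simp: lookup_add smult_add_left Pi_iff\<close>)
  also have "\<dots> = linear_extension M f u \<oplus> linear_extension M f v"
    unfolding 2 3 by (rule finsum_addf) (use fK in auto)
  finally show ?thesis .
qed

lemma linear_extension_smult:
  assumes f: "f \<in> S \<rightarrow> carrier M" and u: "keys u \<subseteq> S"
  shows "linear_extension M f (scale c u) = c \<odot> linear_extension M f u"
proof -
  let ?K = "keys u"
  have fK: "f \<in> ?K \<rightarrow> carrier M" using assms by auto
  have "linear_extension M f (scale c u)
      = (\<Oplus>s\<in>?K. lookup (scale c u) s \<odot> f s)"
    by (intro linear_extension_superset fK keys_map_times) auto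
  also have "\<dots> = (\<Oplus>s\<in>?K. c \<odot> (lookup u s \<odot> f s))"
    by (rule finsum_cong') (use fK in \<open>auto simp: smult_smult Pi_iff\<close>)
  also have "\<dots> = c \<odot> linear_extension M f u"
    unfolding linear_extension_def by (rule finsum_smult[symmetric]) (use fK in auto)
  finally show ?thesis .
qed

lemma linear_extension_single:
  assumes "f s \<in> carrier M"
  shows "linear_extension M f (single s c) = c \<odot> f s"
proof -
  have "linear_extension M f (single s c)
      = (\<Oplus>t\<in>{s}. lookup (single s c) t \<odot> f t)"
    by (intro linear_extension_superset) (use assms in auto)
  then show ?thesis using assms by (simp add: finsum_insert finsum_empty)
qed

lemma linear_extension_diff:
  assumes f: "f \<in> S \<rightarrow> carrier M" and u: "keys u \<subseteq> S" and v: "keys v \<subseteq> S"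
  shows "linear_extension M f (u - v) = linear_extension M f u \<ominus> linear_extension M f v"
proof -
  have eq: "u - v = u + scale (-1) v"
    by (rule poly_mapping_eqI) (simp add: lookup_add lookup_minus)
  have c: "linear_extension M f v \<in> carrier M" using f v by (intro linear_extension_closed) auto
  have "keys (scale (-1) v) \<subseteq> S"
    using keys_map_times[of "-1" v] v by blast
  from linear_extension_add[OF f u this] show ?thesis
    unfolding eq linear_extension_smult[OF f v] smult_minus_one[OF c] minus_eq .
qed

end

lemma keys_tensor_relations:
  fixes M :: "('k::field, 'v) module" and N :: "('k, 'w) module"
  assumes "vspace M" "vspace N" "u \<in> tensor_relations M N"
  shows "keys u \<subseteq> carrier M \<times> carrier N"
proof -
  interpret M: vspace M by fact
  interpret N: vspace N by fact
  show ?thesis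
    using assms(3) unfolding tensor_relations_def
    by (auto simp: in_keys_iff lookup_minus lookup_single when_def split: if_splits)
qed

text \<open>The span is formed among all finitely supported functions on the product type. It stays
  inside the free module on the carriers because the generating relations do.\<close>

lemma tensor_null_subspace:
  fixes M :: "('k::field, 'v) module" and N :: "('k, 'w) module"
  assumes "vspace M" "vspace N"
  shows "vsubspace (free_module (carrier M \<times> carrier N)) (tensor_null M N)"
proof -
  interpret vspace "free_module (carrier M \<times> carrier N)" by (rule free_module_vspace)
  have "poly_mapping.subspace {u :: 'v \<times> 'w \<Rightarrow>\<^sub>0 'k. keys u \<subseteq> carrier M \<times> carrier N}"
  proof (rule poly_mapping.subspaceI)
    fix x y :: "'v \<times> 'w \<Rightarrow>\<^sub>0 'k" and c
    assume x: "x \<in> {u. keys u \<subseteq> carrier M \<times> carrier N}"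
    show "scale c x \<in> {u. keys u \<subseteq> carrier M \<times> carrier N}"
      using x keys_map_times[of c x] by auto
    assume "y \<in> {u. keys u \<subseteq> carrier M \<times> carrier N}"
    then show "x + y \<in> {u. keys u \<subseteq> carrier M \<times> carrier N}"
      using x keys_add[of x y] by auto
  qed auto
  then have "tensor_null M N \<subseteq> {u. keys u \<subseteq> carrier M \<times> carrier N}"
    unfolding tensor_null_def using keys_tensor_relations[OF assms]
    by (intro poly_mapping.span_minimal) auto
  then show ?thesis
    by unfold_locales (auto simp: free_module_simps tensor_null_def
        intro: poly_mapping.span_zero poly_mapping.span_add poly_mapping.span_scale)
qed

definition bilinear_map where
  "bilinear_map M N L f \<longleftrightarrow>
     (\<forall>a\<in>carrier M. \<forall>b\<in>carrier N. f (a, b) \<in> carrier L) \<and>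
     (\<forall>a\<in>carrier M. \<forall>a'\<in>carrier M. \<forall>b\<in>carrier N. f (a \<oplus>\<^bsub>M\<^esub> a', b) = f (a, b) \<oplus>\<^bsub>L\<^esub> f (a', b)) \<and>
     (\<forall>a\<in>carrier M. \<forall>b\<in>carrier N. \<forall>b'\<in>carrier N. f (a, b \<oplus>\<^bsub>N\<^esub> b') = f (a, b) \<oplus>\<^bsub>L\<^esub> f (a, b')) \<and>
     (\<forall>c. \<forall>a\<in>carrier M. \<forall>b\<in>carrier N. f (c \<odot>\<^bsub>M\<^esub> a, b) = c \<odot>\<^bsub>L\<^esub> f (a, b)) \<and>
     (\<forall>c. \<forall>a\<in>carrier M. \<forall>b\<in>carrier N. f (a, c \<odot>\<^bsub>N\<^esub> b) = c \<odot>\<^bsub>L\<^esub> f (a, b))"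

lemma bilinear_mapD:
  assumes "bilinear_map M N L f" "a \<in> carrier M" "b \<in> carrier N"
  shows "f (a, b) \<in> carrier L"
    "a' \<in> carrier M \<Longrightarrow> f (a \<oplus>\<^bsub>M\<^esub> a', b) = f (a, b) \<oplus>\<^bsub>L\<^esub> f (a', b)"
    "b' \<in> carrier N \<Longrightarrow> f (a, b \<oplus>\<^bsub>N\<^esub> b') = f (a, b) \<oplus>\<^bsub>L\<^esub> f (a, b')"
    "f (c \<odot>\<^bsub>M\<^esub> a, b) = c \<odot>\<^bsub>L\<^esub> f (a, b)" "f (a, c \<odot>\<^bsub>N\<^esub> b) = c \<odot>\<^bsub>L\<^esub> f (a, b)"
  using assms unfolding bilinear_map_def by blast+

lemma sum_single_lookup:
  "(\<Sum>s\<in>keys u. single s (lookup u s)) = u"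
  by (rule poly_mapping_eqI) (simp add: lookup_sum lookup_single when_def sum.delta in_keys_iff)

locale tensor = M: vspace M + N: vspace N
  for M :: "('k::field, 'v) module" and N :: "('k, 'w) module"
begin

abbreviation "T \<equiv> tensor_product M N"
abbreviation "pure \<equiv> pure_tensor M N"
abbreviation "F \<equiv> free_module (carrier M \<times> carrier N) :: ('k, 'v \<times> 'w \<Rightarrow>\<^sub>0 'k) module"

sublocale null: vsubspace F "tensor_null M N"
  by (rule tensor_null_subspace) unfold_locales

sublocale T: vspace T
  unfolding tensor_product_def by (rule null.quotient_vspace)

lemma single_in_F: "a \<in> carrier M \<Longrightarrow> b \<in> carrier N \<Longrightarrow> single (a, b) c \<in> carrier F"
  by (auto simp: free_module_simps)

lemma coset_smult_single:
  assumes "a \<in> carrier M" "b \<in> carrier N"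
  shows "tensor_null M N +>\<^bsub>F\<^esub> single (a, b) c = c \<odot>\<^bsub>T\<^esub> pure a b"
  using null.quotient_smult[OF single_in_F[OF assms], of c 1]
  by (simp add: tensor_product_def pure_tensor_def free_module_simps map_times_single)

lemma pure_closed [simp]: "a \<in> carrier M \<Longrightarrow> b \<in> carrier N \<Longrightarrow> pure a b \<in> carrier T"
  by (auto simp: tensor_product_def pure_tensor_def null.quotient_carrier single_in_F)

lemma relation_eq:
  assumes "u \<in> carrier F" "v \<in> carrier F" "u - v \<in> tensor_relations M N"
  shows "tensor_null M N +>\<^bsub>F\<^esub> u = tensor_null M N +>\<^bsub>F\<^esub> v"
proof -
  have "v \<oplus>\<^bsub>F\<^esub> (u - v) = u" "u - v \<in> carrier F"
    using assms(3) keys_tensor_relations[OF M.vspace_axioms N.vspace_axioms]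
    by (auto simp: free_module_simps)
  then have "u \<ominus>\<^bsub>F\<^esub> v = u - v"
    using assms(1,2) by (metis null.a_comm null.add.inv_solve_right' null.minus_eq)
  then show ?thesis
    using assms null.coset_eq_iff by (auto simp: tensor_null_def intro: poly_mapping.span_base)
qed

lemma pure_add_left:
  assumes "a \<in> carrier M" "a' \<in> carrier M" "b \<in> carrier N"
  shows "pure (a \<oplus>\<^bsub>M\<^esub> a') b = pure a b \<oplus>\<^bsub>T\<^esub> pure a' b"
proof -
  have "pure (a \<oplus>\<^bsub>M\<^esub> a') b
      = tensor_null M N +>\<^bsub>F\<^esub> (single (a, b) 1 \<oplus>\<^bsub>F\<^esub> single (a', b) 1)"
    unfolding pure_tensor_def
  proof (rule relation_eq)
    show "single (a \<oplus>\<^bsub>M\<^esub> a', b) 1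
        - (single (a, b) 1 \<oplus>\<^bsub>F\<^esub> single (a', b) 1) \<in> tensor_relations M N"
      using assms unfolding tensor_relations_def free_module_simps(3) diff_diff_eq[symmetric] by blast
  qed (use assms in \<open>auto simp: single_in_F\<close>)
  then show ?thesis
    using assms by (simp add: null.quotient_add single_in_F tensor_product_def pure_tensor_def)
qed

lemma pure_add_right:
  assumes "a \<in> carrier M" "b \<in> carrier N" "b' \<in> carrier N"
  shows "pure a (b \<oplus>\<^bsub>N\<^esub> b') = pure a b \<oplus>\<^bsub>T\<^esub> pure a b'"
proof -
  have "pure a (b \<oplus>\<^bsub>N\<^esub> b')
      = tensor_null M N +>\<^bsub>F\<^esub> (single (a, b) 1 \<oplus>\<^bsub>F\<^esub> single (a, b') 1)"
    unfolding pure_tensor_def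
  proof (rule relation_eq)
    show "single (a, b \<oplus>\<^bsub>N\<^esub> b') 1
        - (single (a, b) 1 \<oplus>\<^bsub>F\<^esub> single (a, b') 1) \<in> tensor_relations M N"
      using assms unfolding tensor_relations_def free_module_simps(3) diff_diff_eq[symmetric] by blast
  qed (use assms in \<open>auto simp: single_in_F\<close>)
  then show ?thesis
    using assms by (simp add: null.quotient_add single_in_F tensor_product_def pure_tensor_def)
qed

lemma pure_smult_left:
  assumes "a \<in> carrier M" "b \<in> carrier N"
  shows "pure (c \<odot>\<^bsub>M\<^esub> a) b = c \<odot>\<^bsub>T\<^esub> pure a b"
proof -
  have "tensor_null M N +>\<^bsub>F\<^esub> single (c \<odot>\<^bsub>M\<^esub> a, b) 1 = tensor_null M N +>\<^bsub>F\<^esub> single (a, b) c"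
  proof (rule relation_eq)
    show "single (c \<odot>\<^bsub>M\<^esub> a, b) 1 - single (a, b) c \<in> tensor_relations M N"
      using assms unfolding tensor_relations_def by blast
  qed (use assms in \<open>auto simp: single_in_F\<close>)
  then show ?thesis unfolding coset_smult_single[OF assms, symmetric] by (simp only: pure_tensor_def)
qed

lemma pure_smult_right:
  assumes "a \<in> carrier M" "b \<in> carrier N"
  shows "pure a (c \<odot>\<^bsub>N\<^esub> b) = c \<odot>\<^bsub>T\<^esub> pure a b"
proof -
  have "tensor_null M N +>\<^bsub>F\<^esub> single (a, c \<odot>\<^bsub>N\<^esub> b) 1 = tensor_null M N +>\<^bsub>F\<^esub> single (a, b) c"
  proof (rule relation_eq)
    show "single (a, c \<odot>\<^bsub>N\<^esub> b) 1 - single (a, b) c \<in> tensor_relations M N"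
      using assms unfolding tensor_relations_def by blast
  qed (use assms in \<open>auto simp: single_in_F\<close>)
  then show ?thesis unfolding coset_smult_single[OF assms, symmetric] by (simp only: pure_tensor_def)
qed

lemma pure_zero_left [simp]: "b \<in> carrier N \<Longrightarrow> pure \<zero>\<^bsub>M\<^esub> b = \<zero>\<^bsub>T\<^esub>"
  using pure_smult_left[of "\<zero>\<^bsub>M\<^esub>" b 0] by simp

lemma pure_zero_right [simp]: "a \<in> carrier M \<Longrightarrow> pure a \<zero>\<^bsub>N\<^esub> = \<zero>\<^bsub>T\<^esub>"
  using pure_smult_right[of a "\<zero>\<^bsub>N\<^esub>" 0] by simp

lemma tensor_cosetE:
  assumes "t \<in> carrier T"
  obtains u where "keys u \<subseteq> carrier M \<times> carrier N" "t = tensor_null M N +>\<^bsub>F\<^esub> u"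
  using assms by (auto simp: tensor_product_def null.quotient_carrier free_module_simps(1))

text \<open>The coefficient of a basis vector \<open>(a, b)\<close> is absorbed into the left
  factor, so the induction step adds a pure tensor without a scalar.\<close>

lemma tensor_induct [consumes 1, case_names zero add]:
  assumes t: "t \<in> carrier T"
    and zero: "P \<zero>\<^bsub>T\<^esub>"
    and add: "\<And>t a b. t \<in> carrier T \<Longrightarrow> P t \<Longrightarrow> a \<in> carrier M \<Longrightarrow> b \<in> carrier N \<Longrightarrow> P (t \<oplus>\<^bsub>T\<^esub> pure a b)"
  shows "P t"
proof -
  obtain u where u: "keys u \<subseteq> carrier M \<times> carrier N" "t = tensor_null M N +>\<^bsub>F\<^esub> u"
    using t by (rule tensor_cosetE)
  have "P (tensor_null M N +>\<^bsub>F\<^esub> (\<Sum>s\<in>K. single s (lookup u s))) \<and>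
      (\<Sum>s\<in>K. single s (lookup u s)) \<in> carrier F"
    if "finite K" "K \<subseteq> carrier M \<times> carrier N" for K
    using that
  proof (induction K rule: finite_induct)
    case empty
    then show ?case
      using zero null.quotient_zero null.zero_closed by (simp add: tensor_product_def free_module_simps)
  next
    case (insert s K)
    obtain a b where s: "s = (a, b)" "a \<in> carrier M" "b \<in> carrier N" using insert.prems by auto
    define v where "v = (\<Sum>s\<in>K. single s (lookup u s))"
    let ?c = "lookup u s"
    have v: "v \<in> carrier F" "P (tensor_null M N +>\<^bsub>F\<^esub> v)" using insert by (auto simp: v_def)
    have vT: "tensor_null M N +>\<^bsub>F\<^esub> v \<in> carrier T"
      using v by (auto simp: tensor_product_def null.quotient_carrier)
    have sF: "single s ?c \<in> carrier F" using s by (simp add: single_in_F)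
    have "tensor_null M N +>\<^bsub>F\<^esub> (v \<oplus>\<^bsub>F\<^esub> single s ?c)
        = (tensor_null M N +>\<^bsub>F\<^esub> v) \<oplus>\<^bsub>T\<^esub> pure (?c \<odot>\<^bsub>M\<^esub> a) b"
      using s v sF by (simp add: null.quotient_add[symmetric] tensor_product_def[symmetric] coset_smult_single pure_smult_left
          flip: tensor_product_def)
    then have "P (tensor_null M N +>\<^bsub>F\<^esub> (v \<oplus>\<^bsub>F\<^esub> single s ?c))"
      using add[OF vT v(2), of "?c \<odot>\<^bsub>M\<^esub> a" b] s by simp
    moreover have "v \<oplus>\<^bsub>F\<^esub> single s ?c \<in> carrier F" using v sF by (intro null.a_closed)
    moreover have "(\<Sum>s\<in>insert s K. single s (lookup u s))
        = v \<oplus>\<^bsub>F\<^esub> single s ?c"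
      using insert by (simp add: v_def free_module_simps add.commute)
    ultimately show ?case by simp
  qed
  from this[of "keys u"] show ?thesis
    using u sum_single_lookup[of u] by simp
qed

end

locale bilinear = tensor M N + L: vspace L
  for M :: "('k::field, 'v) module" and N :: "('k, 'w) module" and L :: "('k, 'l) module" +
  fixes f
  assumes bilin: "bilinear_map M N L f"
begin

lemma f_Pi: "f \<in> carrier M \<times> carrier N \<rightarrow> carrier L"
  using bilinear_mapD(1)[OF bilin] by auto

lemma L_add_minus_cancel:
  assumes "x \<in> carrier L" "y \<in> carrier L"
  shows "(x \<oplus>\<^bsub>L\<^esub> y) \<ominus>\<^bsub>L\<^esub> x \<ominus>\<^bsub>L\<^esub> y = \<zero>\<^bsub>L\<^esub>"
proof -
  have "(x \<oplus>\<^bsub>L\<^esub> y) \<ominus>\<^bsub>L\<^esub> x \<ominus>\<^bsub>L\<^esub> y = (x \<oplus>\<^bsub>L\<^esub> y) \<oplus>\<^bsub>L\<^esub> (\<ominus>\<^bsub>L\<^esub> (x \<oplus>\<^bsub>L\<^esub> y))"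
    using assms by (simp add: L.minus_add L.minus_eq L.a_assoc)
  then show ?thesis using assms by (simp add: L.r_neg)
qed

text \<open>The vectors killed by the linear extension form a subspace, so it is enough to check the
  four kinds of relations; each is one clause of bilinearity.\<close>

lemma linear_extension_null:
  assumes "u \<in> tensor_null M N"
  shows "linear_extension L f u = \<zero>\<^bsub>L\<^esub>"
proof -
  let ?S = "carrier M \<times> carrier N"
  let ?W = "{u. keys u \<subseteq> ?S \<and> linear_extension L f u = \<zero>\<^bsub>L\<^esub>}"
  have sub: "poly_mapping.subspace ?W"
  proof (rule poly_mapping.subspaceI)
    fix x y :: "'v \<times> 'w \<Rightarrow>\<^sub>0 'k" and c
    assume x: "x \<in> ?W"
    then show "scale c x \<in> ?W"
      using keys_map_times[of c x] by (auto simp: L.linear_extension_smult[OF f_Pi])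
    assume "y \<in> ?W"
    then show "x + y \<in> ?W"
      using x keys_add[of x y] by (auto simp: L.linear_extension_add[OF f_Pi])
  qed auto
  have k: "keys (single s c) \<subseteq> ?S" if "s \<in> ?S" for s c using that by auto
  have kd: "keys (u - v) \<subseteq> A" if "keys u \<subseteq> A" "keys v \<subseteq> A"
    for u v :: "'v \<times> 'w \<Rightarrow>\<^sub>0 'k" and A using keys_diff[of u v] that by blast
  have "linear_extension L f u = \<zero>\<^bsub>L\<^esub>" if u: "u \<in> tensor_relations M N" for u
  proof -
    note b = bilinear_mapD[OF bilin]
    consider (1) a a' b where "u = single (a \<oplus>\<^bsub>M\<^esub> a', b) 1 - single (a, b) 1 - single (a', b) 1"
        "a \<in> carrier M" "a' \<in> carrier M" "b \<in> carrier N"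
      | (2) a b b' where "u = single (a, b \<oplus>\<^bsub>N\<^esub> b') 1 - single (a, b) 1 - single (a, b') 1"
        "a \<in> carrier M" "b \<in> carrier N" "b' \<in> carrier N"
      | (3) c a b where "u = single (c \<odot>\<^bsub>M\<^esub> a, b) 1 - single (a, b) c" "a \<in> carrier M" "b \<in> carrier N"
      | (4) c a b where "u = single (a, c \<odot>\<^bsub>N\<^esub> b) 1 - single (a, b) c" "a \<in> carrier M" "b \<in> carrier N"
      using u unfolding tensor_relations_def by blast
    then show ?thesis
    proof cases
      case 1
      have [simp]: "f (a, b) \<in> carrier L" "f (a', b) \<in> carrier L" using 1 b(1) by auto
      have "linear_extension L f u = (f (a, b) \<oplus>\<^bsub>L\<^esub> f (a', b)) \<ominus>\<^bsub>L\<^esub> f (a, b) \<ominus>\<^bsub>L\<^esub> f (a', b)"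
        using 1 by (simp add: L.linear_extension_diff[OF f_Pi] L.linear_extension_single k kd b(1,2) del: keys_single)
      then show ?thesis by (simp add: L_add_minus_cancel)
    next
      case 2
      have [simp]: "f (a, b) \<in> carrier L" "f (a, b') \<in> carrier L" using 2 b(1) by auto
      have "linear_extension L f u = (f (a, b) \<oplus>\<^bsub>L\<^esub> f (a, b')) \<ominus>\<^bsub>L\<^esub> f (a, b) \<ominus>\<^bsub>L\<^esub> f (a, b')"
        using 2 by (simp add: L.linear_extension_diff[OF f_Pi] L.linear_extension_single k kd b(1,3) del: keys_single)
      then show ?thesis by (simp add: L_add_minus_cancel)
    next
      case 3
      then show ?thesis
        by (simp add: L.linear_extension_diff[OF f_Pi] L.linear_extension_single k kd b(1,4) L.minus_eq L.r_neg del: keys_single)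
    next
      case 4
      then show ?thesis
        by (simp add: L.linear_extension_diff[OF f_Pi] L.linear_extension_single k kd b(1,5) L.minus_eq L.r_neg del: keys_single)
    qed
  qed
  then have "tensor_relations M N \<subseteq> ?W"
    using keys_tensor_relations[OF M.vspace_axioms N.vspace_axioms] by blast
  then have "tensor_null M N \<subseteq> ?W"
    unfolding tensor_null_def by (rule poly_mapping.span_minimal[OF _ sub])
  then show ?thesis using assms by blast
qed

text \<open>Representatives of a coset differ by elements of \<open>tensor_null\<close>, where the
  extension vanishes. The image of the coset is therefore a singleton, and \<open>the_elem\<close>
  is meaningful.\<close>

lemma tensor_lift_coset:
  assumes u: "keys u \<subseteq> carrier M \<times> carrier N"
  shows "tensor_lift L f (tensor_null M N +>\<^bsub>F\<^esub> u) = linear_extension L f u"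
proof -
  have uF: "u \<in> carrier F" using u by (simp add: free_module_simps)
  have "linear_extension L f v = linear_extension L f u" if v: "v \<in> tensor_null M N +>\<^bsub>F\<^esub> u" for v
  proof -
    obtain h where h: "h \<in> tensor_null M N" "v = h + u"
      using v unfolding a_r_coset_def' by (auto simp: free_module_simps(3))
    then have "keys h \<subseteq> carrier M \<times> carrier N" 
      using null.subset by (auto simp: free_module_simps)
    then have "linear_extension L f v = \<zero>\<^bsub>L\<^esub> \<oplus>\<^bsub>L\<^esub> linear_extension L f u"
      using L.linear_extension_add[OF f_Pi _ u] linear_extension_null h by auto
    also have "\<dots> = linear_extension L f u"
      by (rule L.l_zero, rule L.linear_extension_closed) (use f_Pi u in auto)
    finally show ?thesis .
  qed
  then have "linear_extension L f ` (tensor_null M N +>\<^bsub>F\<^esub> u) = {linear_extension L f u}"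
    using null.coset.a_rcos_self[OF uF] by blast
  then show ?thesis by (simp add: tensor_lift_def)
qed

lemma tensor_lift_closed [simp]:
  assumes "t \<in> carrier T"
  shows "tensor_lift L f t \<in> carrier L"
  using assms
proof (rule tensor_cosetE)
  fix u assume "keys u \<subseteq> carrier M \<times> carrier N" "t = tensor_null M N +>\<^bsub>F\<^esub> u"
  then show ?thesis using f_Pi by (auto simp: tensor_lift_coset intro!: L.linear_extension_closed)
qed

lemma tensor_lift_add:
  assumes "t \<in> carrier T" "t' \<in> carrier T"
  shows "tensor_lift L f (t \<oplus>\<^bsub>T\<^esub> t') = tensor_lift L f t \<oplus>\<^bsub>L\<^esub> tensor_lift L f t'"
proof -
  obtain u where u: "keys u \<subseteq> carrier M \<times> carrier N" "t = tensor_null M N +>\<^bsub>F\<^esub> u"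
    using assms(1) by (rule tensor_cosetE)
  obtain v where v: "keys v \<subseteq> carrier M \<times> carrier N" "t' = tensor_null M N +>\<^bsub>F\<^esub> v"
    using assms(2) by (rule tensor_cosetE)
  have "t \<oplus>\<^bsub>T\<^esub> t' = tensor_null M N +>\<^bsub>F\<^esub> (u + v)"
    using u v null.quotient_add[of u v] by (simp add: tensor_product_def free_module_simps)
  moreover have "keys (u + v) \<subseteq> carrier M \<times> carrier N" using u v keys_add[of u v] by blast
  ultimately show ?thesis using u v by (simp add: tensor_lift_coset L.linear_extension_add[OF f_Pi])
qed

lemma tensor_lift_smult:
  assumes "t \<in> carrier T"
  shows "tensor_lift L f (c \<odot>\<^bsub>T\<^esub> t) = c \<odot>\<^bsub>L\<^esub> tensor_lift L f t"
proof -
  obtain u where u: "keys u \<subseteq> carrier M \<times> carrier N" "t = tensor_null M N +>\<^bsub>F\<^esub> u"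
    using assms(1) by (rule tensor_cosetE)
  have "c \<odot>\<^bsub>T\<^esub> t = tensor_null M N +>\<^bsub>F\<^esub> (scale c u)"
    using u null.quotient_smult[of u c] by (simp add: tensor_product_def free_module_simps)
  moreover have "keys (scale c u) \<subseteq> carrier M \<times> carrier N"
    using u keys_map_times[of c u] by blast
  ultimately show ?thesis using u by (simp add: tensor_lift_coset L.linear_extension_smult[OF f_Pi])
qed

lemma tensor_lift_zero [simp]: "tensor_lift L f \<zero>\<^bsub>T\<^esub> = \<zero>\<^bsub>L\<^esub>"
  using tensor_lift_smult[of "\<zero>\<^bsub>T\<^esub>" 0] by simp

lemma tensor_lift_pure:
  assumes "a \<in> carrier M" "b \<in> carrier N"
  shows "tensor_lift L f (pure a b) = f (a, b)"
  using assms bilinear_mapD(1)[OF bilin]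
  by (simp add: pure_tensor_def tensor_lift_coset L.linear_extension_single)

end

section \<open>Cochain calculus\<close>

text \<open>Inserting \<open>p\<close> leading zeros is the inclusion of the face spanned by the
  last \<open>q + 1\<close> vertices.\<close>

lemma back_vertex_mem:
  assumes "x \<in> standard_simplex q"
  shows "(\<lambda>i. if i < p then 0 else x (i - p)) \<in> standard_simplex (p + q)"
proof -
  have "(\<Sum>i\<le>p + q. if i < p then 0 else x (i - p)) = (\<Sum>i\<in>{p..p + q}. x (i - p))"
    by (rule sum.mono_neutral_cong_right) auto
  also have "\<dots> = (\<Sum>i\<le>q. x i)"
    by (rule sum.reindex_bij_witness[of _ "\<lambda>i. i + p" "\<lambda>i. i - p"]) auto
  finally show ?thesis using assms by (auto simp: standard_simplex_def)
qed

text \<open>This and the next three facts record what omitting vertex \<open>i\<close> does to a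
  simplex cut at vertex \<open>p\<close>. For \<open>i > p\<close> the front part is untouched and
  the back part loses a vertex; for \<open>i \<le> p\<close> the front part comes from one vertex
  further and loses one, and the back part starts one vertex later.\<close>

lemma front_face_singular_face_ge:
  assumes "p < i" "p \<le> n"
  shows "front_face p (singular_face (Suc n) i \<sigma>) = front_face p \<sigma>"
proof
  fix x
  show "front_face p (singular_face (Suc n) i \<sigma>) x = front_face p \<sigma> x"
  proof (cases "x \<in> standard_simplex p")
    case True
    then have "simplical_face i x = x"
      using assms by (auto simp: simplical_face_def standard_simplex_def fun_eq_iff)
    then show ?thesis
      using True standard_simplex_mono[OF assms(2)] by (auto simp: front_face_def singular_face_def)
  qed (simp add: front_face_def)
qed

lemma front_face_singular_face_le:
  assumes "i \<le> p" "p \<le> n"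
  shows "front_face p (singular_face (Suc n) i \<sigma>) = singular_face (Suc p) i (front_face (Suc p) \<sigma>)"
proof
  fix x
  show "front_face p (singular_face (Suc n) i \<sigma>) x = singular_face (Suc p) i (front_face (Suc p) \<sigma>) x"
    using standard_simplex_mono[OF assms(2)] simplical_face_in_standard_simplex[of "Suc p" i x] assms
    by (auto simp: front_face_def singular_face_def restrict_def)
qed

lemma back_face_singular_face_ge:
  assumes "p < i" "p \<le> n" "i \<le> Suc n"
  shows "back_face p (n - p) (singular_face (Suc n) i \<sigma>)
    = singular_face (Suc (n - p)) (i - p) (back_face p (Suc (n - p)) \<sigma>)"
proof
  fix x
  show "back_face p (n - p) (singular_face (Suc n) i \<sigma>) x
    = singular_face (Suc (n - p)) (i - p) (back_face p (Suc (n - p)) \<sigma>) x"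
  proof (cases "x \<in> standard_simplex (n - p)")
    case True
    have "(\<lambda>i. if i < p then 0 else x (i - p)) \<in> standard_simplex n"
      using back_vertex_mem[OF True, of p] assms by simp
    moreover have "simplical_face (i - p) x \<in> standard_simplex (Suc (n - p))"
      using True assms by (intro simplical_face_in_standard_simplex) auto
    moreover have "simplical_face i (\<lambda>i. if i < p then 0 else x (i - p))
        = (\<lambda>j. if j < p then 0 else simplical_face (i - p) x (j - p))"
      using assms by (auto simp: simplical_face_def fun_eq_iff)
    ultimately show ?thesis
      using True by (auto simp: back_face_def singular_face_def)
  qed (simp add: back_face_def singular_face_def)
qed

lemma back_face_singular_face_le:
  assumes "i \<le> p" "p \<le> n"
  shows "back_face p (n - p) (singular_face (Suc n) i \<sigma>) = back_face (Suc p) (n - p) \<sigma>"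
proof
  fix x
  show "back_face p (n - p) (singular_face (Suc n) i \<sigma>) x = back_face (Suc p) (n - p) \<sigma> x"
  proof (cases "x \<in> standard_simplex (n - p)")
    case True
    have "(\<lambda>i. if i < p then 0 else x (i - p)) \<in> standard_simplex n"
      using back_vertex_mem[OF True, of p] assms by simp
    moreover have "simplical_face i (\<lambda>i. if i < p then 0 else x (i - p))
        = (\<lambda>j. if j < Suc p then 0 else x (j - Suc p))"
      using assms by (auto simp: simplical_face_def fun_eq_iff)
    ultimately show ?thesis
      using True by (auto simp: back_face_def singular_face_def)
  qed (simp add: back_face_def)
qed

text \<open>The last face of the longer front part and, in the next lemma, the first face of the
  longer back part: these are the two extra terms that cancel in the Leibniz rule.\<close>

lemma singular_face_front_face_last:
  "singular_face (Suc p) (Suc p) (front_face (Suc p) \<sigma>) = front_face p \<sigma>"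
proof
  fix x
  show "singular_face (Suc p) (Suc p) (front_face (Suc p) \<sigma>) x = front_face p \<sigma> x"
  proof (cases "x \<in> standard_simplex p")
    case True
    then have "simplical_face (Suc p) x = x"
      by (auto simp: simplical_face_def standard_simplex_def fun_eq_iff)
    then show ?thesis
      using True standard_simplex_mono[of p "Suc p"] by (auto simp: front_face_def singular_face_def)
  qed (simp add: front_face_def singular_face_def)
qed

lemma singular_face_back_face_0:
  "singular_face (Suc q) 0 (back_face p (Suc q) \<sigma>) = back_face (Suc p) q \<sigma>"
proof
  fix x
  show "singular_face (Suc q) 0 (back_face p (Suc q) \<sigma>) x = back_face (Suc p) q \<sigma> x"
  proof (cases "x \<in> standard_simplex q")
    case True
    then have "simplical_face 0 x \<in> standard_simplex (Suc q)"
      by (intro simplical_face_in_standard_simplex) auto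
    moreover have "(\<lambda>j. if j < p then 0 else simplical_face 0 x (j - p))
        = (\<lambda>j. if j < Suc p then 0 else x (j - Suc p))"
      by (auto simp: simplical_face_def fun_eq_iff)
    ultimately show ?thesis using True by (simp add: singular_face_def back_face_def)
  qed (simp add: back_face_def singular_face_def)
qed

lemma singular_simplex_front_face:
  assumes "singular_simplex n X \<sigma>" "p \<le> n"
  shows "singular_simplex p X (front_face p \<sigma>)"
  using assms standard_simplex_mono[OF assms(2)] unfolding singular_simplex_def front_face_def
  by (auto intro: continuous_map_from_subtopology_mono)

lemma singular_simplex_back_face:
  assumes "singular_simplex (p + q) X \<sigma>"
  shows "singular_simplex q X (back_face p q \<sigma>)"
proof -
  have "continuous_map (subtopology (powertop_real UNIV) (standard_simplex q))
      (subtopology (powertop_real UNIV) (standard_simplex (p + q))) (\<lambda>x i. if i < p then 0 else x (i - p))"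
    unfolding continuous_map_in_subtopology continuous_map_componentwise_UNIV
  proof (intro conjI allI)
    fix k
    show "continuous_map (subtopology (powertop_real UNIV) (standard_simplex q)) euclideanreal
        (\<lambda>x. if k < p then 0 else x (k - p))"
      by (cases "k < p") (auto intro: continuous_map_from_subtopology continuous_map_product_projection)
  qed (use back_vertex_mem in auto)
  from continuous_map_compose[OF this, of X \<sigma>] assms show ?thesis
    by (simp add: singular_simplex_def back_face_def o_def)
qed

text \<open>Acts on whole graded families and mentions no space, so that the Leibniz rule holds for
  arbitrary functions without side conditions. The value \<open>0\<close> in degree \<open>0\<close>
  lets coboundaries be treated uniformly in all degrees.\<close>

definition cobd :: "(nat \<Rightarrow> 'a simplex \<Rightarrow> 'k) \<Rightarrow> nat \<Rightarrow> 'a simplex \<Rightarrow> 'k::comm_ring_1"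
  where "cobd f n \<sigma> =
    (case n of 0 \<Rightarrow> 0 | Suc m \<Rightarrow> \<Sum>i\<le>Suc m. (-1) ^ i * f m (singular_face (Suc m) i \<sigma>))"

definition cup :: "(nat \<Rightarrow> 'a simplex \<Rightarrow> 'k) \<Rightarrow> (nat \<Rightarrow> 'a simplex \<Rightarrow> 'k) \<Rightarrow>
    nat \<Rightarrow> 'a simplex \<Rightarrow> 'k::comm_ring_1"
  where "cup f g n \<sigma> = (\<Sum>p\<le>n. f p (front_face p \<sigma>) * g (n - p) (back_face p (n - p) \<sigma>))"

lemma cobd_0 [simp]: "cobd f 0 \<sigma> = 0"
  by (simp add: cobd_def)

lemma cobd_Suc: "cobd f (Suc m) \<sigma> = (\<Sum>i\<le>Suc m. (-1) ^ i * f m (singular_face (Suc m) i \<sigma>))"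
  by (simp add: cobd_def)

text \<open>For each cut position \<open>p\<close>, the faces with \<open>i \<le> p\<close> belong
  to the front factor and the others to the back factor. Completing both sums to full coboundaries
  adds the last face of the front and the zeroth face of the back, which give the same product with
  opposite signs.\<close>

lemma cobd_cup:
  "cobd (cup f g) n \<sigma> = cup (cobd f) g n \<sigma> + cup (\<lambda>p \<sigma>. (-1) ^ p * f p \<sigma>) (cobd g) n \<sigma>"
proof (cases n)
  case 0
  then show ?thesis by (simp add: cup_def)
next
  case (Suc m)
  let ?A = "\<lambda>p. f p (front_face p \<sigma>)" and ?B = "\<lambda>p. g (m - p) (back_face (Suc p) (m - p) \<sigma>)"
  let ?A' = "\<lambda>p i. f p (singular_face (Suc p) i (front_face (Suc p) \<sigma>))"
  let ?B' = "\<lambda>p i. g (m - p) (singular_face (Suc (m - p)) i (back_face p (Suc (m - p)) \<sigma>))"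
  have key: "(\<Sum>i\<le>Suc m. (-1) ^ i * (f p (front_face p (singular_face (Suc m) i \<sigma>)) *
        g (m - p) (back_face p (m - p) (singular_face (Suc m) i \<sigma>))))
      = (\<Sum>i\<le>Suc p. (-1) ^ i * ?A' p i) * ?B p
        + (-1) ^ p * ?A p * (\<Sum>i\<le>Suc (m - p). (-1) ^ i * ?B' p i)" if p: "p \<le> m" for p
  proof -
    let ?t = "\<lambda>i. (-1) ^ i * (f p (front_face p (singular_face (Suc m) i \<sigma>)) *
        g (m - p) (back_face p (m - p) (singular_face (Suc m) i \<sigma>)))"
    have "{..Suc m} = {..p} \<union> {Suc p..Suc m}" using p by auto
    then have "sum ?t {..Suc m} = sum ?t {..p} + sum ?t {Suc p..Suc m}"
      by (simp only:) (rule sum.union_disjoint, auto)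
    also have "sum ?t {..p} = (\<Sum>i\<le>p. (-1) ^ i * ?A' p i) * ?B p"
      using p by (simp add: sum_distrib_right front_face_singular_face_le back_face_singular_face_le mult.assoc)
    also have "sum ?t {Suc p..Suc m} = (\<Sum>i\<in>{1..Suc (m - p)}. ?t (i + p))"
      by (rule sum.reindex_bij_witness[of _ "\<lambda>i. i + p" "\<lambda>i. i - p"]) (use p in auto)
    also have "\<dots> = (\<Sum>i\<in>{1..Suc (m - p)}. (-1) ^ p * ?A p * ((-1) ^ i * ?B' p i))"
      using p by (intro sum.cong refl) (auto simp: front_face_singular_face_ge back_face_singular_face_ge power_add mult_ac)
    also have "\<dots> = (-1) ^ p * ?A p * (\<Sum>i\<in>{1..Suc (m - p)}. (-1) ^ i * ?B' p i)"
      by (simp only: sum_distrib_left)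
    also have "(\<Sum>i\<in>{1..Suc (m - p)}. (-1) ^ i * ?B' p i) = (\<Sum>i\<le>Suc (m - p). (-1) ^ i * ?B' p i) - ?B p"
      by (simp add: atMost_atLeast0 sum.atLeast_Suc_atMost[of 0] singular_face_back_face_0 del: sum.cl_ivl_Suc)
    finally show ?thesis
      by (simp add: singular_face_front_face_last algebra_simps)
  qed
  have "cobd (cup f g) n \<sigma> = (\<Sum>p\<le>m. \<Sum>i\<le>Suc m. (-1) ^ i * (f p (front_face p (singular_face (Suc m) i \<sigma>)) *
        g (m - p) (back_face p (m - p) (singular_face (Suc m) i \<sigma>))))"
    unfolding Suc cobd_Suc cup_def sum_distrib_left by (rule sum.swap)
  also have "\<dots> = (\<Sum>p\<le>m. cobd f (Suc p) (front_face (Suc p) \<sigma>) * ?B p)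
      + (\<Sum>p\<le>m. (-1) ^ p * ?A p * cobd g (Suc m - p) (back_face p (Suc m - p) \<sigma>))"
    by (simp add: key cobd_Suc Suc_diff_le sum.distrib del: sum.atMost_Suc)
  \<comment> \<open>The shift of the index loses nothing: the summand \<open>p = 0\<close> on the
    right contains \<open>cobd f 0 = 0\<close>.\<close>
  also have "(\<Sum>p\<le>m. cobd f (Suc p) (front_face (Suc p) \<sigma>) * ?B p) = cup (cobd f) g n \<sigma>"
    unfolding cup_def Suc by (subst sum.atMost_Suc_shift) simp
  also have "(\<Sum>p\<le>m. (-1) ^ p * ?A p * cobd g (Suc m - p) (back_face p (Suc m - p) \<sigma>))
      = cup (\<lambda>p \<sigma>. (-1) ^ p * f p \<sigma>) (cobd g) n \<sigma>"
    unfolding cup_def Suc by simp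
  finally show ?thesis .
qed

text \<open>The pairing of field-valued cochains with integral chains. Through it, facts about
  \<open>chain_boundary\<close> and singular subdivision are transferred to cochains.\<close>

definition ceval :: "('s \<Rightarrow> 'k::comm_ring_1) \<Rightarrow> ('s \<Rightarrow>\<^sub>0 int) \<Rightarrow> 'k"
  where "ceval \<phi> c = (\<Sum>\<sigma>\<in>keys c. of_int (lookup c \<sigma>) * \<phi> \<sigma>)"

lemma ceval_superset:
  "finite K \<Longrightarrow> keys c \<subseteq> K \<Longrightarrow> ceval \<phi> c = (\<Sum>\<sigma>\<in>K. of_int (lookup c \<sigma>) * \<phi> \<sigma>)"
  unfolding ceval_def by (rule sum.mono_neutral_left) (auto simp: in_keys_iff)

lemma ceval_0 [simp]: "ceval \<phi> 0 = 0"
  by (simp add: ceval_def)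

lemma ceval_add: "ceval \<phi> (c + d) = ceval \<phi> c + ceval \<phi> d"
proof -
  let ?K = "keys c \<union> keys d"
  show ?thesis
    using keys_add[of c d]
    by (simp add: ceval_superset[of ?K] lookup_add algebra_simps sum.distrib)
qed

lemma ceval_cmul: "ceval \<phi> (frag_cmul k c) = of_int k * ceval \<phi> c"
  using keys_cmul[of k c]
  by (simp add: ceval_superset[of "keys c"] sum_distrib_left mult.assoc)

lemma ceval_diff: "ceval \<phi> (c - d) = ceval \<phi> c - ceval \<phi> d"
  using ceval_add[of \<phi> "c - d" d] by simp

lemma ceval_frag_of [simp]: "ceval \<phi> (frag_of \<sigma>) = \<phi> \<sigma>"
  by (simp add: ceval_def)

lemma ceval_sum: "ceval \<phi> (\<Sum>i\<in>I. c i) = (\<Sum>i\<in>I. ceval \<phi> (c i))"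
  by (induction I rule: infinite_finite_induct) (simp_all add: ceval_add)

lemma ceval_frag_extend: "ceval \<phi> (frag_extend h c) = ceval (\<lambda>\<sigma>. ceval \<phi> (h \<sigma>)) c"
  by (simp add: frag_extend_def ceval_sum ceval_cmul) (simp add: ceval_def)

lemma ceval_fun_cong: "(\<And>\<sigma>. \<sigma> \<in> keys c \<Longrightarrow> \<phi> \<sigma> = \<psi> \<sigma>) \<Longrightarrow> ceval \<phi> c = ceval \<psi> c"
  by (simp add: ceval_def)

lemma ceval_cobd: "ceval (cobd f (Suc m)) c = ceval (f m) (chain_boundary (Suc m) c)"
  by (simp add: chain_boundary_def ceval_frag_extend ceval_sum ceval_cmul cobd_Suc[abs_def] del: sum.atMost_Suc)

lemma cobd_eq_ceval: "cobd f (Suc m) \<sigma> = ceval (f m) (chain_boundary (Suc m) (frag_of \<sigma>))"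
  using ceval_cobd[of f m "frag_of \<sigma>"] by simp

text \<open>Dual to the vanishing of the double boundary. This transfer is where an actual singular
  simplex is required.\<close>

lemma cobd_cobd:
  assumes "singular_simplex n X \<sigma>"
  shows "cobd (cobd f) n \<sigma> = 0"
proof (cases n)
  case (Suc m)
  show ?thesis
  proof (cases m)
    case (Suc l)
    have "cobd (cobd f) n \<sigma> = ceval (f l) (chain_boundary (Suc l) (chain_boundary (Suc (Suc l)) (frag_of \<sigma>)))"
      unfolding \<open>n = Suc m\<close> Suc cobd_eq_ceval[of _ "Suc l"] ceval_cobd ..
    also have "\<dots> = 0"
      using assms chain_boundary_boundary[of "Suc (Suc l)" X "frag_of \<sigma>"]
      by (simp add: singular_chain_of \<open>n = Suc m\<close> Suc)
    finally show ?thesis .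
  qed (simp add: Suc cobd_Suc)
qed simp

section \<open>The cohomology algebra\<close>

lemma coboundary_eq:
  "coboundary n X \<phi> \<sigma> = (if singular_simplex (Suc n) X \<sigma> then cobd (\<lambda>_. \<phi>) (Suc n) \<sigma> else 0)"
  by (simp add: coboundary_def cobd_Suc)

lemma cobd_cong: "(\<And>\<tau>. f (n - 1) \<tau> = g (n - 1) \<tau>) \<Longrightarrow> cobd f n \<sigma> = cobd g n \<sigma>"
  by (cases n) (auto simp: cobd_Suc)

lemma cobd_cong_simplex:
  assumes "singular_simplex n X \<sigma>" "\<And>m \<tau>. n = Suc m \<Longrightarrow> singular_simplex m X \<tau> \<Longrightarrow> f m \<tau> = g m \<tau>"
  shows "cobd f n \<sigma> = cobd g n \<sigma>"
proof (cases n)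
  case (Suc m)
  have "singular_simplex m X (singular_face (Suc m) i \<sigma>)" if "i \<le> Suc m" for i
    using singular_simplex_singular_face[of "Suc m" X \<sigma> i] assms(1) Suc that by simp
  then show ?thesis using assms(2) Suc by (simp only: cobd_Suc) (rule sum.cong, auto)
qed simp

lemma cobd_add: "cobd (\<lambda>n \<sigma>. f n \<sigma> + g n \<sigma>) n \<sigma> = cobd f n \<sigma> + cobd g n \<sigma>"
  by (cases n) (simp_all add: cobd_Suc sum.distrib algebra_simps del: sum.atMost_Suc)

lemma cobd_mult: "cobd (\<lambda>n \<sigma>. c * f n \<sigma>) n \<sigma> = c * cobd f n \<sigma>"
  by (cases n) (simp_all add: cobd_Suc sum_distrib_left mult.left_commute del: sum.atMost_Suc)

lemma cobd_zero [simp]: "cobd (\<lambda>n \<sigma>. 0) n \<sigma> = 0"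
  by (cases n) (simp_all add: cobd_Suc)

lemma cocycles_iff:
  "\<phi> \<in> cocycles n X \<longleftrightarrow> (\<forall>\<sigma>. \<not> singular_simplex n X \<sigma> \<longrightarrow> \<phi> \<sigma> = 0) \<and>
     (\<forall>\<sigma>. singular_simplex (Suc n) X \<sigma> \<longrightarrow> cobd (\<lambda>_. \<phi>) (Suc n) \<sigma> = 0)"
  by (auto simp: cocycles_def cochains_def fun_eq_iff coboundary_eq)

lemma cocycle_module_simps:
  "carrier (cocycle_module n X) = cocycles n X" "\<zero>\<^bsub>cocycle_module n X\<^esub> = (\<lambda>\<sigma>. 0)"
  "\<phi> \<oplus>\<^bsub>cocycle_module n X\<^esub> \<psi> = (\<lambda>\<sigma>. \<phi> \<sigma> + \<psi> \<sigma>)" "c \<odot>\<^bsub>cocycle_module n X\<^esub> \<phi> = (\<lambda>\<sigma>. c * \<phi> \<sigma>)"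
  by (auto simp: cocycle_module_def)

lemma cocycle_module_vspace: "vspace (cocycle_module n X :: ('k::field, ('a, 'k) cochain) module)"
  by (rule vspaceI)
    (auto simp: cocycle_module_simps cocycles_iff algebra_simps cobd_mult cobd_add)

text \<open>The case distinction on the degree disappears because \<open>cobd f 0 = 0\<close>. The
  witness may be any graded family: only its component in degree \<open>n - 1\<close> matters, and
  cutting it off outside the simplices of \<open>X\<close> produces a genuine cochain.\<close>

lemma coboundaries_iff:
  "\<phi> \<in> coboundaries n X \<longleftrightarrow> (\<forall>\<sigma>. \<not> singular_simplex n X \<sigma> \<longrightarrow> \<phi> \<sigma> = 0) \<and>
     (\<exists>f. \<forall>\<sigma>. singular_simplex n X \<sigma> \<longrightarrow> \<phi> \<sigma> = cobd f n \<sigma>)"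
proof (cases n)
  case 0
  then show ?thesis by (auto simp: coboundaries_def fun_eq_iff)
next
  case (Suc m)
  show ?thesis
  proof
    assume "\<phi> \<in> coboundaries n X"
    then obtain \<alpha> where \<alpha>: "\<phi> = coboundary m X \<alpha>" by (auto simp: coboundaries_def Suc)
    then show "(\<forall>\<sigma>. \<not> singular_simplex n X \<sigma> \<longrightarrow> \<phi> \<sigma> = 0) \<and> (\<exists>f. \<forall>\<sigma>. singular_simplex n X \<sigma> \<longrightarrow> \<phi> \<sigma> = cobd f n \<sigma>)"
      by (auto simp: Suc coboundary_eq)
  next
    assume "(\<forall>\<sigma>. \<not> singular_simplex n X \<sigma> \<longrightarrow> \<phi> \<sigma> = 0) \<and> (\<exists>f. \<forall>\<sigma>. singular_simplex n X \<sigma> \<longrightarrow> \<phi> \<sigma> = cobd f n \<sigma>)"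
    then obtain f where f: "\<And>\<sigma>. \<not> singular_simplex n X \<sigma> \<Longrightarrow> \<phi> \<sigma> = 0" "\<And>\<sigma>. singular_simplex n X \<sigma> \<Longrightarrow> \<phi> \<sigma> = cobd f n \<sigma>"
      by auto
    define \<alpha> where "\<alpha> = (\<lambda>\<sigma>. if singular_simplex m X \<sigma> then f m \<sigma> else 0)"
    have "\<phi> \<sigma> = coboundary m X \<alpha> \<sigma>" for \<sigma>
      using f[of \<sigma>] by (auto simp: coboundary_eq Suc \<alpha>_def intro!: cobd_cong_simplex[of _ X])
    moreover have "\<alpha> \<in> cochains m X" by (auto simp: \<alpha>_def cochains_def)
    ultimately show "\<phi> \<in> coboundaries n X" by (auto simp: coboundaries_def Suc)
  qed
qed

lemma coboundaries_subspace:
  "vsubspace (cocycle_module n X :: ('k::field, ('a, 'k) cochain) module) (coboundaries n X)"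
proof -
  interpret vspace "cocycle_module n X :: ('k, ('a, 'k) cochain) module" by (rule cocycle_module_vspace)
  show ?thesis
  proof
    show "coboundaries n X \<subseteq> carrier (cocycle_module n X :: ('k, ('a, 'k) cochain) module)"
    proof
      fix \<phi> :: "('a, 'k) cochain" assume \<phi>: "\<phi> \<in> coboundaries n X"
      then obtain f where f: "\<And>\<sigma>. singular_simplex n X \<sigma> \<Longrightarrow> \<phi> \<sigma> = cobd f n \<sigma>"
        by (auto simp: coboundaries_iff)
      have "cobd (\<lambda>_. \<phi>) (Suc n) \<sigma> = 0" if "singular_simplex (Suc n) X \<sigma>" for \<sigma>
      proof -
        have "cobd (\<lambda>_. \<phi>) (Suc n) \<sigma> = cobd (cobd f) (Suc n) \<sigma>"
          by (rule cobd_cong_simplex[OF that]) (use f in auto)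
        then show ?thesis using cobd_cobd[OF that] by simp
      qed
      then show "\<phi> \<in> carrier (cocycle_module n X)"
        using \<phi> by (auto simp: cocycle_module_simps cocycles_iff coboundaries_iff)
    qed
    show "\<zero>\<^bsub>cocycle_module n X\<^esub> \<in> (coboundaries n X :: ('a, 'k) cochain set)"
      by (auto simp: cocycle_module_simps coboundaries_iff intro!: exI[of _ "\<lambda>n \<sigma>. 0"])
    show "x \<oplus>\<^bsub>cocycle_module n X\<^esub> y \<in> coboundaries n X" if xy: "x \<in> coboundaries n X" "y \<in> coboundaries n X"
      for x y :: "('a, 'k) cochain"
    proof -
      obtain f where "\<And>\<sigma>. singular_simplex n X \<sigma> \<Longrightarrow> x \<sigma> = cobd f n \<sigma>" using xy by (auto simp: coboundaries_iff)
      moreover obtain g where "\<And>\<sigma>. singular_simplex n X \<sigma> \<Longrightarrow> y \<sigma> = cobd g n \<sigma>" using xy by (auto simp: coboundaries_iff)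
      ultimately show ?thesis using xy
        by (auto simp: coboundaries_iff cocycle_module_simps cobd_add intro!: exI[of _ "\<lambda>n \<sigma>. f n \<sigma> + g n \<sigma>"])
    qed
    show "c \<odot>\<^bsub>cocycle_module n X\<^esub> x \<in> coboundaries n X" if x: "x \<in> coboundaries n X"
      for c and x :: "('a, 'k) cochain"
    proof -
      obtain f where "\<And>\<sigma>. singular_simplex n X \<sigma> \<Longrightarrow> x \<sigma> = cobd f n \<sigma>" using x by (auto simp: coboundaries_iff)
      then show ?thesis using x
        by (auto simp: coboundaries_iff cocycle_module_simps cobd_mult intro!: exI[of _ "\<lambda>n \<sigma>. c * f n \<sigma>"])
    qed
  qed
qed

interpretation coh: vsubspace "cocycle_module n X" "coboundaries n X" for n X
  by (rule coboundaries_subspace)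

lemma singular_cohomology_vspace: "vspace (singular_cohomology n X)"
  unfolding singular_cohomology_def by (rule coh.quotient_vspace)

lemma singular_cohomology_carrier:
  "carrier (singular_cohomology n X) = cohom_class n X ` cocycles n X"
  using coh.quotient_carrier[of n X] by (simp add: singular_cohomology_def cohom_class_def[abs_def] cocycle_module_simps)

lemma cohom_class_eq_iff:
  assumes "\<phi> \<in> cocycles n X" "\<psi> \<in> cocycles n X"
  shows "cohom_class n X \<phi> = cohom_class n X \<psi> \<longleftrightarrow> (\<lambda>\<sigma>. \<phi> \<sigma> - \<psi> \<sigma>) \<in> coboundaries n X"
proof -
  have "\<phi> \<ominus>\<^bsub>cocycle_module n X\<^esub> \<psi> = (\<lambda>\<sigma>. \<phi> \<sigma> - \<psi> \<sigma>)"
    using assms coh.smult_minus_one[of \<psi> n X] by (simp add: coh.minus_eq cocycle_module_simps fun_eq_iff flip: coh.smult_minus_one)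
  then show ?thesis using coh.coset_eq_iff[of \<phi> n X \<psi>] assms by (simp add: cohom_class_def cocycle_module_simps)
qed

lemma cohom_class_zero: "\<zero>\<^bsub>singular_cohomology n X\<^esub> = cohom_class n X (\<lambda>\<sigma>. 0)"
  using coh.quotient_zero[of n X] by (simp add: singular_cohomology_def cohom_class_def cocycle_module_simps)

lemma cohom_class_add:
  "\<phi> \<in> cocycles n X \<Longrightarrow> \<psi> \<in> cocycles n X \<Longrightarrow>
    cohom_class n X \<phi> \<oplus>\<^bsub>singular_cohomology n X\<^esub> cohom_class n X \<psi> = cohom_class n X (\<lambda>\<sigma>. \<phi> \<sigma> + \<psi> \<sigma>)"
  using coh.quotient_add[of \<phi> n X \<psi>] by (simp add: singular_cohomology_def cohom_class_def cocycle_module_simps)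

lemma cohom_class_smult:
  "\<phi> \<in> cocycles n X \<Longrightarrow> c \<odot>\<^bsub>singular_cohomology n X\<^esub> cohom_class n X \<phi> = cohom_class n X (\<lambda>\<sigma>. c * \<phi> \<sigma>)"
  using coh.quotient_smult[of \<phi> n X c] by (simp add: singular_cohomology_def cohom_class_def cocycle_module_simps)

lemma zero_cocycle [simp]: "(\<lambda>\<sigma>. 0) \<in> cocycles n X"
  by (simp add: cocycles_iff)

lemma add_cocycle: "\<phi> \<in> cocycles n X \<Longrightarrow> \<psi> \<in> cocycles n X \<Longrightarrow> (\<lambda>\<sigma>. \<phi> \<sigma> + \<psi> \<sigma>) \<in> cocycles n X"
  using coh.a_closed[of \<phi> n X \<psi>] by (simp add: cocycle_module_simps)

lemma smult_cocycle: "\<phi> \<in> cocycles n X \<Longrightarrow> (\<lambda>\<sigma>. c * \<phi> \<sigma>) \<in> cocycles n X"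
  using coh.smult_closed[of \<phi> n X c] by (simp add: cocycle_module_simps)

text \<open>Both conclusions go through one induction, since adding classes requires the partial sum
  to be a cocycle.\<close>

lemma cohom_class_sum:
  assumes "finite I" "\<And>i. i \<in> I \<Longrightarrow> \<phi> i \<in> cocycles n X"
  shows "(\<Oplus>\<^bsub>singular_cohomology n X\<^esub>i\<in>I. cohom_class n X (\<phi> i)) = cohom_class n X (\<lambda>\<sigma>. \<Sum>i\<in>I. \<phi> i \<sigma>)
    \<and> (\<lambda>\<sigma>. \<Sum>i\<in>I. \<phi> i \<sigma>) \<in> cocycles n X"
  using assms
proof (induction I rule: finite_induct)
  case empty
  interpret vspace "singular_cohomology n X" by (rule singular_cohomology_vspace)
  show ?case by (simp add: finsum_empty cohom_class_zero)
next
  case (insert i I)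
  interpret vspace "singular_cohomology n X" by (rule singular_cohomology_vspace)
  show ?case using insert
    by (subst finsum_insert) (auto simp: cohom_class_add add_cocycle singular_cohomology_carrier)
qed

lemma cohom_class_self: "\<phi> \<in> cocycles n X \<Longrightarrow> \<phi> \<in> cohom_class n X \<phi>"
  using coh.coset.a_rcos_self[of \<phi> n X] by (simp add: cohom_class_def cocycle_module_simps)

lemma cohom_class_mem:
  assumes "\<phi> \<in> cocycles n X" "\<phi>' \<in> cohom_class n X \<phi>"
  shows "\<phi>' \<in> cocycles n X" "(\<lambda>\<sigma>. \<phi>' \<sigma> - \<phi> \<sigma>) \<in> coboundaries n X"
proof -
  obtain h where h: "h \<in> coboundaries n X" "\<phi>' = (\<lambda>\<sigma>. h \<sigma> + \<phi> \<sigma>)"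
    using assms(2) unfolding cohom_class_def a_r_coset_def' by (auto simp: cocycle_module_simps)
  then show "(\<lambda>\<sigma>. \<phi>' \<sigma> - \<phi> \<sigma>) \<in> coboundaries n X" by simp
  show "\<phi>' \<in> cocycles n X" using h assms(1) coh.subset[of n X] add_cocycle[of h n X \<phi>]
    by (auto simp: cocycle_module_simps)
qed

text \<open>Operations on classes are defined as unions over representatives; independence of the
  representative collapses such a union to a single value.\<close>

lemma cohom_class_UN_const:
  assumes "\<phi> \<in> cocycles n X" "\<And>\<phi>'. \<phi>' \<in> cohom_class n X \<phi> \<Longrightarrow> G \<phi>' = G \<phi>"
  shows "(\<Union>\<phi>'\<in>cohom_class n X \<phi>. G \<phi>') = G \<phi>"
  using cohom_class_self[OF assms(1)] by (intro SUP_eq_const assms(2)) blast+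

text \<open>One cocycle per degree represents a class of mixed degree. Finite support of the
  cocycles, not only of their classes, is needed later for finite index sets.\<close>

definition cocycle_families :: "'a topology \<Rightarrow> (nat \<Rightarrow> ('a, 'k::field) cochain) set"
  where "cocycle_families X = {\<phi>. (\<forall>n. \<phi> n \<in> cocycles n X) \<and> finite {n. \<phi> n \<noteq> (\<lambda>\<sigma>. 0)}}"

definition cohomology_class :: "'a topology \<Rightarrow> (nat \<Rightarrow> ('a, 'k::field) cochain) \<Rightarrow> ('a, 'k) cohom"
  where "cohomology_class X \<phi> = (\<lambda>n. cohom_class n X (\<phi> n))"

lemma cocycle_familiesD:
  assumes "\<phi> \<in> cocycle_families X"
  shows "\<phi> n \<in> cocycles n X" "\<not> singular_simplex n X \<sigma> \<Longrightarrow> \<phi> n \<sigma> = 0"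
    "singular_simplex n X \<sigma> \<Longrightarrow> cobd \<phi> n \<sigma> = 0" "finite {n. \<phi> n \<noteq> (\<lambda>\<sigma>. 0)}"
proof -
  show c: "\<phi> n \<in> cocycles n X" for n using assms by (simp add: cocycle_families_def)
  show "\<phi> n \<sigma> = 0" if "\<not> singular_simplex n X \<sigma>" using that c[of n] by (simp add: cocycles_iff)
  show "finite {n. \<phi> n \<noteq> (\<lambda>\<sigma>. 0)}" using assms by (simp add: cocycle_families_def)
  assume s: "singular_simplex n X \<sigma>"
  show "cobd \<phi> n \<sigma> = 0"
  proof (cases n)
    case (Suc m)
    have "cobd \<phi> n \<sigma> = cobd (\<lambda>_. \<phi> m) n \<sigma>" by (rule cobd_cong) (simp add: Suc)
    then show ?thesis using c[of m] s by (simp add: cocycles_iff Suc)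
  qed simp
qed

lemma cocycle_familiesI:
  assumes "\<And>n \<sigma>. \<not> singular_simplex n X \<sigma> \<Longrightarrow> \<phi> n \<sigma> = 0"
    "\<And>n \<sigma>. singular_simplex n X \<sigma> \<Longrightarrow> cobd \<phi> n \<sigma> = 0"
    "finite K" "\<And>n. n \<notin> K \<Longrightarrow> \<phi> n = (\<lambda>\<sigma>. 0)"
  shows "\<phi> \<in> cocycle_families X"
proof -
  have "cobd (\<lambda>_. \<phi> n) (Suc n) \<sigma> = cobd \<phi> (Suc n) \<sigma>" for n \<sigma> by (rule cobd_cong) simp
  moreover have "finite {n. \<phi> n \<noteq> (\<lambda>\<sigma>. 0)}"
    by (rule finite_subset[OF _ assms(3)]) (use assms(4) in auto)
  ultimately show ?thesis using assms(1,2) by (simp add: cocycle_families_def cocycles_iff)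
qed

lemma cohomology_algebra_simps:
  "carrier (H X) = carrier (direct_sum (\<lambda>n. singular_cohomology n X))"
  "zero (H X) = (\<lambda>n. \<zero>\<^bsub>singular_cohomology n X\<^esub>)"
  "add (H X) = (\<lambda>x y n. x n \<oplus>\<^bsub>singular_cohomology n X\<^esub> y n)"
  "smult (H X) = (\<lambda>c x n. c \<odot>\<^bsub>singular_cohomology n X\<^esub> x n)"
  by (simp_all add: cohomology_algebra_def direct_sum_def)

lemma cohomology_algebra_vspace: "vspace (H X)"
  by (rule vspace_cong[OF _ _ _ _ direct_sum_vspace[OF singular_cohomology_vspace]])
    (simp_all add: cohomology_algebra_def)

lemma cohomology_algebra_zero: "\<zero>\<^bsub>H X\<^esub> = cohomology_class X (\<lambda>n \<sigma>. 0)"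
  by (simp add: cohomology_algebra_simps cohomology_class_def cohom_class_zero)

lemma cohomology_algebra_carrier:
  "carrier (H X) = cohomology_class X ` cocycle_families X"
proof (intro equalityI subsetI)
  fix x assume x: "x \<in> carrier (H X)"
  then have x: "\<And>n. x n \<in> cohom_class n X ` cocycles n X" "finite {n. x n \<noteq> cohom_class n X (\<lambda>\<sigma>. 0)}"
    by (auto simp: cohomology_algebra_simps direct_sum_simps singular_cohomology_carrier cohom_class_zero)
  \<comment> \<open>Where the class is zero the zero cocycle is chosen, so that the finite support
    of \<open>x\<close> passes to the representatives.\<close>
  have "\<exists>\<phi>. \<phi> \<in> cocycles n X \<and> x n = cohom_class n X \<phi> \<and> (x n = cohom_class n X (\<lambda>\<sigma>. 0) \<longrightarrow> \<phi> = (\<lambda>\<sigma>. 0))" for n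
    using x(1)[of n] zero_cocycle by blast
  then obtain \<phi> where \<phi>: "\<And>n. \<phi> n \<in> cocycles n X" "\<And>n. x n = cohom_class n X (\<phi> n)"
    "\<And>n. x n = cohom_class n X (\<lambda>\<sigma>. 0) \<Longrightarrow> \<phi> n = (\<lambda>\<sigma>. 0)" by metis
  have "finite {n. \<phi> n \<noteq> (\<lambda>\<sigma>. 0)}"
    by (rule finite_subset[OF _ x(2)]) (use \<phi>(3) in auto)
  then have "\<phi> \<in> cocycle_families X" using \<phi>(1) by (simp add: cocycle_families_def)
  moreover have "x = cohomology_class X \<phi>" using \<phi>(2) by (simp add: cohomology_class_def fun_eq_iff)
  ultimately show "x \<in> cohomology_class X ` cocycle_families X" by blast
next
  fix x assume "x \<in> cohomology_class X ` cocycle_families X"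
  then obtain \<phi> where \<phi>: "\<phi> \<in> cocycle_families X" "x = cohomology_class X \<phi>" by auto
  have "finite {n. x n \<noteq> cohom_class n X (\<lambda>\<sigma>. 0)}"
    by (rule finite_subset[OF _ cocycle_familiesD(4)[OF \<phi>(1)]]) (auto simp: \<phi>(2) cohomology_class_def)
  then show "x \<in> carrier (H X)"
    using cocycle_familiesD(1)[OF \<phi>(1)] \<phi>(2)
    by (auto simp: cohomology_algebra_simps direct_sum_simps singular_cohomology_carrier cohom_class_zero cohomology_class_def)
qed

lemma cohomology_class_closed [simp]:
  "\<phi> \<in> cocycle_families X \<Longrightarrow> cohomology_class X \<phi> \<in> carrier (H X)"
  by (simp add: cohomology_algebra_carrier)

lemma cohomology_class_add:
  "\<phi> \<in> cocycle_families X \<Longrightarrow> \<psi> \<in> cocycle_families X \<Longrightarrow>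
    cohomology_class X \<phi> \<oplus>\<^bsub>H X\<^esub> cohomology_class X \<psi> = cohomology_class X (\<lambda>n \<sigma>. \<phi> n \<sigma> + \<psi> n \<sigma>)"
  by (simp add: cohomology_algebra_simps cohomology_class_def cohom_class_add cocycle_familiesD)

lemma cohomology_class_smult:
  "\<phi> \<in> cocycle_families X \<Longrightarrow>
    c \<odot>\<^bsub>H X\<^esub> cohomology_class X \<phi> = cohomology_class X (\<lambda>n \<sigma>. c * \<phi> n \<sigma>)"
  by (simp add: cohomology_algebra_simps cohomology_class_def cohom_class_smult cocycle_familiesD)

lemma cohomology_class_eq_iff:
  assumes "\<phi> \<in> cocycle_families X" "\<psi> \<in> cocycle_families X"
  shows "cohomology_class X \<phi> = cohomology_class X \<psi> \<longleftrightarrow> (\<forall>n. (\<lambda>\<sigma>. \<phi> n \<sigma> - \<psi> n \<sigma>) \<in> coboundaries n X)"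
  by (simp add: cohomology_class_def fun_eq_iff cohom_class_eq_iff[OF cocycle_familiesD(1)[OF assms(1)] cocycle_familiesD(1)[OF assms(2)]])

lemma zero_family [simp]: "(\<lambda>n \<sigma>. 0) \<in> cocycle_families X"
  by (simp add: cocycle_families_def)

lemma add_family:
  assumes "\<phi> \<in> cocycle_families X" "\<psi> \<in> cocycle_families X"
  shows "(\<lambda>n \<sigma>. \<phi> n \<sigma> + \<psi> n \<sigma>) \<in> cocycle_families X"
  by (rule cocycle_familiesI[of _ _ "{n. \<phi> n \<noteq> (\<lambda>\<sigma>. 0)} \<union> {n. \<psi> n \<noteq> (\<lambda>\<sigma>. 0)}"])
    (use cocycle_familiesD(2-4)[OF assms(1)] cocycle_familiesD(2-4)[OF assms(2)] in \<open>auto simp: cobd_add\<close>)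

lemma smult_family:
  assumes "\<phi> \<in> cocycle_families X"
  shows "(\<lambda>n \<sigma>. c * \<phi> n \<sigma>) \<in> cocycle_families X"
  by (rule cocycle_familiesI[of _ _ "{n. \<phi> n \<noteq> (\<lambda>\<sigma>. 0)}"])
    (use cocycle_familiesD(2-4)[OF assms] in \<open>auto simp: cobd_mult\<close>)

section \<open>Homogeneous parts and cup products\<close>

definition degree_part :: "nat \<Rightarrow> (nat \<Rightarrow> ('a, 'k::field) cochain) \<Rightarrow> nat \<Rightarrow> ('a, 'k) cochain"
  where "degree_part r \<phi> = (\<lambda>n \<sigma>. if n = r then \<phi> n \<sigma> else 0)"

lemma cobd_degree_part: "cobd (degree_part r \<phi>) n \<sigma> = (if n = Suc r then cobd \<phi> n \<sigma> else 0)"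
  by (cases n) (auto simp: cobd_Suc degree_part_def)

text \<open>Keeping a primitive only in degree \<open>p - 1\<close> makes its coboundary live in
  degree \<open>p\<close> alone. This converts a homogeneous coboundary into a family to which the
  Leibniz rule applies.\<close>

lemma cobd_shifted_part:
  "cobd (\<lambda>n \<sigma>. if Suc n = p then f n \<sigma> else 0) n \<sigma> = degree_part p (cobd f) n \<sigma>"
  by (cases n) (auto simp: cobd_Suc degree_part_def)

lemma degree_part_family:
  assumes "\<phi> \<in> cocycle_families X"
  shows "degree_part r \<phi> \<in> cocycle_families X"
  by (rule cocycle_familiesI[of _ _ "{r}"])
    (use assms cocycle_familiesD[OF assms] in \<open>auto simp: cobd_degree_part\<close>, auto simp: degree_part_def)

lemma homogeneous_part_class:
  "homogeneous_part (H X) r (cohomology_class X \<phi>) = cohomology_class X (degree_part r \<phi>)"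
  by (auto simp: homogeneous_part_def cohomology_algebra_zero cohomology_class_def degree_part_def fun_eq_iff)

definition cup_family :: "'a topology \<Rightarrow> (nat \<Rightarrow> ('a, 'k::field) cochain) \<Rightarrow> (nat \<Rightarrow> ('a, 'k) cochain) \<Rightarrow> nat \<Rightarrow> ('a, 'k) cochain"
  where "cup_family X \<phi> \<psi> = (\<lambda>n \<sigma>. if singular_simplex n X \<sigma> then cup \<phi> \<psi> n \<sigma> else 0)"

lemma cup_cong:
  assumes "singular_simplex n X \<sigma>"
    "\<And>p \<tau>. p \<le> n \<Longrightarrow> singular_simplex p X \<tau> \<Longrightarrow> f p \<tau> = f' p \<tau>" "\<And>p \<tau>. p \<le> n \<Longrightarrow> singular_simplex p X \<tau> \<Longrightarrow> g p \<tau> = g' p \<tau>"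
  shows "cup f g n \<sigma> = cup f' g' n \<sigma>"
  unfolding cup_def using assms(1)
  by (intro sum.cong refl arg_cong2[of _ _ _ _ "(*)"] assms(2,3))
    (auto intro: singular_simplex_front_face singular_simplex_back_face)

lemma cup_zero [simp]: "cup (\<lambda>p \<tau>. 0) g n \<sigma> = 0" "cup f (\<lambda>p \<tau>. 0) n \<sigma> = 0"
  by (simp_all add: cup_def)

lemma cup_add: "cup (\<lambda>p \<tau>. f p \<tau> + f' p \<tau>) g n \<sigma> = cup f g n \<sigma> + cup f' g n \<sigma>"
   "cup f (\<lambda>p \<tau>. g p \<tau> + g' p \<tau>) n \<sigma> = cup f g n \<sigma> + cup f g' n \<sigma>"
  by (simp_all add: cup_def algebra_simps sum.distrib)

lemma cup_mult: "cup (\<lambda>p \<tau>. c * f p \<tau>) g n \<sigma> = c * cup f g n \<sigma>"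
   "cup f (\<lambda>p \<tau>. c * g p \<tau>) n \<sigma> = c * cup f g n \<sigma>"
  by (simp_all add: cup_def algebra_simps sum_distrib_left)

lemma cup_cocycle:
  assumes "singular_simplex n X \<sigma>" "\<And>n \<sigma>. singular_simplex n X \<sigma> \<Longrightarrow> cobd f n \<sigma> = 0" "\<And>n \<sigma>. singular_simplex n X \<sigma> \<Longrightarrow> cobd g n \<sigma> = 0"
  shows "cobd (cup f g) n \<sigma> = 0"
proof -
  have "cup (cobd f) g n \<sigma> = cup (\<lambda>p \<tau>. 0) g n \<sigma>" by (rule cup_cong[OF assms(1)]) (use assms in auto)
  moreover have "cup h (cobd g) n \<sigma> = cup h (\<lambda>p \<tau>. 0) n \<sigma>" for h by (rule cup_cong[OF assms(1)]) (use assms in auto)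
  ultimately show ?thesis by (simp add: cobd_cup)
qed

lemma cup_family_closed:
  assumes "\<phi> \<in> cocycle_families X" "\<psi> \<in> cocycle_families X"
  shows "cup_family X \<phi> \<psi> \<in> cocycle_families X"
proof (rule cocycle_familiesI)
  show "finite ((\<lambda>(p, q). p + q) ` ({n. \<phi> n \<noteq> (\<lambda>\<sigma>. 0)} \<times> {n. \<psi> n \<noteq> (\<lambda>\<sigma>. 0)}))"
    using assms cocycle_familiesD(4) by blast
  fix n assume n: "n \<notin> (\<lambda>(p, q). p + q) ` ({n. \<phi> n \<noteq> (\<lambda>\<sigma>. 0)} \<times> {n. \<psi> n \<noteq> (\<lambda>\<sigma>. 0)})"
  have "\<phi> p = (\<lambda>\<sigma>. 0) \<or> \<psi> (n - p) = (\<lambda>\<sigma>. 0)" if "p \<le> n" for p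
  proof (rule ccontr)
    assume "\<not> ?thesis"
    then have "p + (n - p) \<in> (\<lambda>(p, q). p + q) ` ({n. \<phi> n \<noteq> (\<lambda>\<sigma>. 0)} \<times> {n. \<psi> n \<noteq> (\<lambda>\<sigma>. 0)})"
      by (intro rev_image_eqI[of "(p, n - p)"]) auto
    then show False using n that by simp
  qed
  then have "cup \<phi> \<psi> n \<sigma> = 0" for \<sigma>
    unfolding cup_def by (intro sum.neutral) (metis atMost_iff mult_zero_left mult_zero_right)
  then show "cup_family X \<phi> \<psi> n = (\<lambda>\<sigma>. 0)" by (auto simp: cup_family_def fun_eq_iff)
next
  fix n \<sigma> assume s: "singular_simplex n X \<sigma>"
  have "cobd (cup_family X \<phi> \<psi>) n \<sigma> = cobd (cup \<phi> \<psi>) n \<sigma>"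
    by (rule cobd_cong_simplex[OF s]) (simp add: cup_family_def)
  also have "\<dots> = 0" using cup_cocycle[OF s] cocycle_familiesD(3) assms by blast
  finally show "cobd (cup_family X \<phi> \<psi>) n \<sigma> = 0" .
qed (simp add: cup_family_def)

lemma cup_degree_part:
  "cup (degree_part p f) (degree_part q g) n \<sigma>
    = (if n = p + q then f p (front_face p \<sigma>) * g q (back_face p q \<sigma>) else 0)"
proof -
  have "cup (degree_part p f) (degree_part q g) n \<sigma>
      = (\<Sum>r\<le>n. if r = p then if n - p = q then f p (front_face p \<sigma>) * g q (back_face p q \<sigma>) else 0 else 0)"
    unfolding cup_def by (rule sum.cong) (auto simp: degree_part_def)
  then show ?thesis by auto
qed

lemma degree_part_const_family:
  assumes "\<phi> \<in> cocycles p X"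
  shows "degree_part p (\<lambda>_. \<phi>) \<in> cocycle_families X"
  by (rule cocycle_familiesI[of _ _ "{p}"])
    (use assms in \<open>auto simp: cobd_degree_part cocycles_iff\<close>, auto simp: degree_part_def)

text \<open>The product in fixed degrees is the component in degree \<open>p + q\<close> of the
  total product of two families concentrated in one degree each, so the total Leibniz rule covers
  it.\<close>

lemma cup_cochain_cocycle:
  assumes "\<phi> \<in> cocycles p X" "\<psi> \<in> cocycles q X"
  shows "cup_cochain p q X \<phi> \<psi> \<in> cocycles (p + q) X"
proof -
  have "cup_cochain p q X \<phi> \<psi> = cup_family X (degree_part p (\<lambda>_. \<phi>)) (degree_part q (\<lambda>_. \<psi>)) (p + q)"
    by (auto simp: cup_cochain_def cup_family_def cup_degree_part)
  then show ?thesis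
    using cocycle_familiesD(1)[OF cup_family_closed[OF degree_part_const_family[OF assms(1)] degree_part_const_family[OF assms(2)]]]
    by simp
qed

lemma cup_cochain_coboundary_left:
  assumes "\<psi> \<in> cocycles q X" "\<phi> \<in> coboundaries p X"
  shows "cup_cochain p q X \<phi> \<psi> \<in> coboundaries (p + q) X"
proof -
  obtain f where f: "\<And>\<sigma>. singular_simplex p X \<sigma> \<Longrightarrow> \<phi> \<sigma> = cobd f p \<sigma>" using assms(2) by (auto simp: coboundaries_iff)
  let ?f = "\<lambda>n \<sigma>. if Suc n = p then f n \<sigma> else 0" and ?g = "degree_part q (\<lambda>_. \<psi>)"
  have "cup_cochain p q X \<phi> \<psi> \<sigma> = cobd (cup ?f ?g) (p + q) \<sigma>" if s: "singular_simplex (p + q) X \<sigma>" for \<sigma>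
  proof -
    have "cup h (cobd ?g) (p + q) \<sigma> = cup h (\<lambda>p \<tau>. 0) (p + q) \<sigma>" for h
      by (rule cup_cong[OF s]) (use assms cocycle_familiesD(3)[OF degree_part_const_family[OF assms(1)]] in auto)
    then have "cobd (cup ?f ?g) (p + q) \<sigma> = cup (cobd ?f) ?g (p + q) \<sigma>" by (simp add: cobd_cup)
    also have "\<dots> = cup (degree_part p (cobd f)) ?g (p + q) \<sigma>"
      by (rule cup_cong[OF s]) (simp_all add: cobd_shifted_part degree_part_def)
    also have "\<dots> = cup_cochain p q X \<phi> \<psi> \<sigma>"
      using s f[OF singular_simplex_front_face[OF s]] by (simp add: cup_degree_part cup_cochain_def)
    finally show ?thesis by simp
  qed
  then show ?thesis by (auto simp: coboundaries_iff cup_cochain_def)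
qed

lemma cup_cochain_coboundary_right:
  assumes "\<phi> \<in> cocycles p X" "\<psi> \<in> coboundaries q X"
  shows "cup_cochain p q X \<phi> \<psi> \<in> coboundaries (p + q) X"
proof -
  obtain g where g: "\<And>\<sigma>. singular_simplex q X \<sigma> \<Longrightarrow> \<psi> \<sigma> = cobd g q \<sigma>" using assms(2) by (auto simp: coboundaries_iff)
  \<comment> \<open>The factor \<open>(-1) ^ p\<close> compensates the sign that the Leibniz rule
    puts on the first factor when the coboundary passes to the second.\<close>
  let ?f = "degree_part p (\<lambda>_ \<sigma>. (-1) ^ p * \<phi> \<sigma>)" and ?g = "\<lambda>n \<sigma>. if Suc n = q then g n \<sigma> else 0"
  have "cup_cochain p q X \<phi> \<psi> \<sigma> = cobd (cup ?f ?g) (p + q) \<sigma>" if s: "singular_simplex (p + q) X \<sigma>" for \<sigma>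
  proof -
    have "cup (cobd ?f) h (p + q) \<sigma> = cup (\<lambda>p \<tau>. 0) h (p + q) \<sigma>" for h
      by (rule cup_cong[OF s])
        (use assms cocycle_familiesD(3)[OF degree_part_const_family[OF smult_cocycle[OF assms(1)]]] in auto)
    then have "cobd (cup ?f ?g) (p + q) \<sigma> = cup (\<lambda>r \<sigma>. (-1) ^ r * ?f r \<sigma>) (cobd ?g) (p + q) \<sigma>"
      by (simp add: cobd_cup)
    also have "\<dots> = cup (degree_part p (\<lambda>_. \<phi>)) (degree_part q (cobd g)) (p + q) \<sigma>"
      by (rule cup_cong[OF s])
        (simp_all add: cobd_shifted_part, simp_all add: degree_part_def flip: mult.assoc power_add mult_2)
    also have "\<dots> = cup_cochain p q X \<phi> \<psi> \<sigma>"
      using s g[OF singular_simplex_back_face[OF s]] by (simp add: cup_degree_part cup_cochain_def)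
    finally show ?thesis by simp
  qed
  then show ?thesis by (auto simp: coboundaries_iff cup_cochain_def)
qed

lemma cup_class_cohom_class:
  assumes "\<phi> \<in> cocycles p X" "\<psi> \<in> cocycles q X"
  shows "cup_class p q X (cohom_class p X \<phi>) (cohom_class q X \<psi>) = cohom_class (p + q) X (cup_cochain p q X \<phi> \<psi>)"
proof -
  \<comment> \<open>Here \<open>\<phi>\<close> is an arbitrary cocycle, because the second class is
    varied for each representative of the first.\<close>
  have 1: "cohom_class (p + q) X (cup_cochain p q X \<phi> \<psi>') = cohom_class (p + q) X (cup_cochain p q X \<phi> \<psi>)"
    if "\<phi> \<in> cocycles p X" "\<psi>' \<in> cohom_class q X \<psi>" for \<phi> \<psi>'
  proof -
    note m = cohom_class_mem[OF assms(2) that(2)]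
    have "(\<lambda>\<sigma>. cup_cochain p q X \<phi> \<psi>' \<sigma> - cup_cochain p q X \<phi> \<psi> \<sigma>) = cup_cochain p q X \<phi> (\<lambda>\<sigma>. \<psi>' \<sigma> - \<psi> \<sigma>)"
      by (auto simp: cup_cochain_def algebra_simps)
    then show ?thesis using cup_cochain_coboundary_right[OF that(1) m(2)]
      by (subst cohom_class_eq_iff) (auto intro: cup_cochain_cocycle that m assms)
  qed
  have 2: "cohom_class (p + q) X (cup_cochain p q X \<phi>' \<psi>) = cohom_class (p + q) X (cup_cochain p q X \<phi> \<psi>)"
    if "\<phi>' \<in> cohom_class p X \<phi>" for \<phi>'
  proof -
    note m = cohom_class_mem[OF assms(1) that]
    have "(\<lambda>\<sigma>. cup_cochain p q X \<phi>' \<psi> \<sigma> - cup_cochain p q X \<phi> \<psi> \<sigma>) = cup_cochain p q X (\<lambda>\<sigma>. \<phi>' \<sigma> - \<phi> \<sigma>) \<psi>"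
      by (auto simp: cup_cochain_def algebra_simps)
    then show ?thesis using cup_cochain_coboundary_left[OF assms(2) m(2)]
      by (subst cohom_class_eq_iff) (auto intro: cup_cochain_cocycle that m assms)
  qed
  have "cup_class p q X (cohom_class p X \<phi>) (cohom_class q X \<psi>)
      = (\<Union>\<phi>'\<in>cohom_class p X \<phi>. cohom_class (p + q) X (cup_cochain p q X \<phi>' \<psi>))"
    unfolding cup_class_def
  proof (rule SUP_cong[OF refl])
    fix \<phi>' assume "\<phi>' \<in> cohom_class p X \<phi>"
    then have "\<phi>' \<in> cocycles p X" using cohom_class_mem[OF assms(1)] by blast
    then show "(\<Union>\<psi>'\<in>cohom_class q X \<psi>. cohom_class (p + q) X (cup_cochain p q X \<phi>' \<psi>'))
        = cohom_class (p + q) X (cup_cochain p q X \<phi>' \<psi>)"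
      by (intro cohom_class_UN_const[OF assms(2)] 1)
  qed
  also have "\<dots> = cohom_class (p + q) X (cup_cochain p q X \<phi> \<psi>)"
    by (intro cohom_class_UN_const[OF assms(1)] 2)
  finally show ?thesis .
qed

lemma cohomology_class_mult:
  assumes "\<phi> \<in> cocycle_families X" "\<psi> \<in> cocycle_families X"
  shows "cohomology_class X \<phi> \<otimes>\<^bsub>H X\<^esub> cohomology_class X \<psi> = cohomology_class X (cup_family X \<phi> \<psi>)"
proof
  fix n
  note c = cocycle_familiesD(1)[OF assms(1)] cocycle_familiesD(1)[OF assms(2)]
  interpret H: vspace "singular_cohomology n X" by (rule singular_cohomology_vspace)
  have cc: "cup_cochain p (n - p) X (\<phi> p) (\<psi> (n - p)) \<in> cocycles n X" if "p \<le> n" for p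
    using cup_cochain_cocycle[OF c(1)[of p] c(2)[of "n - p"]] that by simp
  have "(cohomology_class X \<phi> \<otimes>\<^bsub>H X\<^esub> cohomology_class X \<psi>) n
      = (\<Oplus>\<^bsub>singular_cohomology n X\<^esub>p\<in>{..n}. cup_class p (n - p) X (cohom_class p X (\<phi> p)) (cohom_class (n - p) X (\<psi> (n - p))))"
    by (simp add: cohomology_algebra_def cohomology_class_def)
  also have "\<dots> = (\<Oplus>\<^bsub>singular_cohomology n X\<^esub>p\<in>{..n}. cohom_class n X (cup_cochain p (n - p) X (\<phi> p) (\<psi> (n - p))))"
    by (rule H.finsum_cong') (use c cc in \<open>auto simp: cup_class_cohom_class singular_cohomology_carrier\<close>)
  also have "\<dots> = cohom_class n X (\<lambda>\<sigma>. \<Sum>p\<in>{..n}. cup_cochain p (n - p) X (\<phi> p) (\<psi> (n - p)) \<sigma>)"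
    using cohom_class_sum[of "{..n}" "\<lambda>p. cup_cochain p (n - p) X (\<phi> p) (\<psi> (n - p))" n X] cc by simp
  also have "(\<lambda>\<sigma>. \<Sum>p\<in>{..n}. cup_cochain p (n - p) X (\<phi> p) (\<psi> (n - p)) \<sigma>) = cup_family X \<phi> \<psi> n"
    by (auto simp: cup_family_def cup_def cup_cochain_def)
  finally show "(cohomology_class X \<phi> \<otimes>\<^bsub>H X\<^esub> cohomology_class X \<psi>) n = cohomology_class X (cup_family X \<phi> \<psi>) n"
    by (simp add: cohomology_class_def)
qed

section \<open>The unit and restriction to subspaces\<close>

definition unit_family :: "'a topology \<Rightarrow> nat \<Rightarrow> ('a, 'k::field) cochain"
  where "unit_family X = (\<lambda>n \<sigma>. if n = 0 \<and> singular_simplex 0 X \<sigma> then 1 else 0)"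

lemma unit_family_closed: "unit_family X \<in> cocycle_families X"
proof (rule cocycle_familiesI[of _ _ "{0}"])
  fix n and \<sigma> :: "'a simplex" assume s: "singular_simplex n X \<sigma>"
  have "unit_family X m \<tau> = degree_part 0 (\<lambda>_ _. 1) m \<tau>" if "singular_simplex m X \<tau>" for m \<tau>
    using that by (cases "m = 0") (auto simp: unit_family_def degree_part_def)
  then have "cobd (unit_family X) n \<sigma> = cobd (degree_part 0 (\<lambda>_ _. 1)) n \<sigma>"
    by (intro cobd_cong_simplex[OF s])
  then show "cobd (unit_family X) n \<sigma> = 0"
    unfolding cobd_degree_part by (cases "n = Suc 0") (auto simp: cobd_Suc degree_part_def)
qed (auto simp: unit_family_def)

lemma cohomology_algebra_one: "\<one>\<^bsub>H X\<^esub> = cohomology_class X (unit_family X)"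
  by (auto simp: cohomology_algebra_def cohomology_class_def unit_family_def fun_eq_iff cohom_class_zero)

definition restrict_family :: "'a topology \<Rightarrow> (nat \<Rightarrow> ('a, 'k::field) cochain) \<Rightarrow> nat \<Rightarrow> ('a, 'k) cochain"
  where "restrict_family Y \<phi> = (\<lambda>n \<sigma>. if singular_simplex n Y \<sigma> then \<phi> n \<sigma> else 0)"

lemma restrict_family_closed:
  assumes "\<phi> \<in> cocycle_families X"
  shows "restrict_family (subtopology X S) \<phi> \<in> cocycle_families (subtopology X S)"
proof (rule cocycle_familiesI[of _ _ "{n. \<phi> n \<noteq> (\<lambda>\<sigma>. 0)}"])
  fix n \<sigma> assume s: "singular_simplex n (subtopology X S) \<sigma>"
  have "cobd (restrict_family (subtopology X S) \<phi>) n \<sigma> = cobd \<phi> n \<sigma>"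
    by (rule cobd_cong_simplex[OF s]) (auto simp: restrict_family_def)
  then show "cobd (restrict_family (subtopology X S) \<phi>) n \<sigma> = 0"
    using cocycle_familiesD(3)[OF assms] s by (simp add: singular_simplex_subtopology)
qed (use cocycle_familiesD(4)[OF assms] in \<open>auto simp: restrict_family_def\<close>)

text \<open>Singular simplices are extensional, so composing one with \<open>id\<close> returns the
  simplex itself; pulling back along an inclusion is therefore truncation to the simplices of the
  subspace.\<close>

lemma cohom_pullback_class:
  assumes "\<phi> \<in> cocycle_families X"
  shows "cohom_pullback (subtopology X S) id (cohomology_class X \<phi>)
    = cohomology_class (subtopology X S) (restrict_family (subtopology X S) \<phi>)"
proof
  fix n
  let ?Y = "subtopology X S"
  have pb: "cochain_pullback n ?Y id \<phi> = (\<lambda>\<sigma>. if singular_simplex n ?Y \<sigma> then \<phi> \<sigma> else 0)"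
    for \<phi> :: "('a, 'b) cochain"
    by (auto simp: cochain_pullback_def fun_eq_iff singular_simplex_def extensional_restrict)
  have cl: "cochain_pullback n ?Y id \<phi>' \<in> cocycles n ?Y" if "\<phi>' \<in> cocycles n X" for \<phi>' :: "('a, 'b) cochain"
    using cocycle_familiesD(1)[OF restrict_family_closed[OF degree_part_const_family[OF that]], of S n]
    unfolding pb restrict_family_def degree_part_def if_True simp_thms .
  have "(\<Union>\<phi>'\<in>cohom_class n X (\<phi> n). cohom_class n ?Y (cochain_pullback n ?Y id \<phi>'))
      = cohom_class n ?Y (cochain_pullback n ?Y id (\<phi> n))"
  proof (rule cohom_class_UN_const)
    show c: "\<phi> n \<in> cocycles n X" using cocycle_familiesD[OF assms] by blast
    fix \<phi>' assume "\<phi>' \<in> cohom_class n X (\<phi> n)"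
    from cohom_class_mem[OF c this] have m: "\<phi>' \<in> cocycles n X" "(\<lambda>\<sigma>. \<phi>' \<sigma> - \<phi> n \<sigma>) \<in> coboundaries n X" by auto
    obtain f where "\<And>\<sigma>. singular_simplex n X \<sigma> \<Longrightarrow> \<phi>' \<sigma> - \<phi> n \<sigma> = cobd f n \<sigma>"
      using m(2) by (auto simp: coboundaries_iff)
    then have "(\<lambda>\<sigma>. cochain_pullback n ?Y id \<phi>' \<sigma> - cochain_pullback n ?Y id (\<phi> n) \<sigma>) \<in> coboundaries n ?Y"
      unfolding coboundaries_iff pb by (auto simp: singular_simplex_subtopology)
    then show "cohom_class n ?Y (cochain_pullback n ?Y id \<phi>') = cohom_class n ?Y (cochain_pullback n ?Y id (\<phi> n))"
      by (subst cohom_class_eq_iff) (use c m cl in auto)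
  qed
  then show "cohom_pullback ?Y id (cohomology_class X \<phi>) n = cohomology_class ?Y (restrict_family ?Y \<phi>) n"
    by (simp add: cohom_pullback_def cohomology_class_def pb restrict_family_def)
qed

section \<open>Bicochains\<close>

type_synonym ('a, 'k) bicochain = "nat \<Rightarrow> nat \<Rightarrow> 'a simplex \<Rightarrow> 'a simplex \<Rightarrow> 'k"

text \<open>Total differential of a double complex: \<open>(-1) ^ p\<close> makes the two partial
  differentials anticommute.\<close>

definition bicobd :: "('a, 'k::field) bicochain \<Rightarrow> ('a, 'k) bicochain"
  where "bicobd F p q \<sigma> \<tau> = cobd (\<lambda>p' \<sigma>'. F p' q \<sigma>' \<tau>) p \<sigma> + (-1) ^ p * cobd (\<lambda>q' \<tau>'. F p q' \<sigma> \<tau>') q \<tau>"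

definition bicup :: "('a, 'k::field) bicochain \<Rightarrow> ('a, 'k) bicochain \<Rightarrow> ('a, 'k) bicochain"
  where "bicup F G p q \<sigma> \<tau> = (\<Sum>p'\<le>p. \<Sum>q'\<le>q. (-1) ^ (q' * (p - p')) *
    F p' q' (front_face p' \<sigma>) (front_face q' \<tau>) * G (p - p') (q - q') (back_face p' (p - p') \<sigma>) (back_face q' (q - q') \<tau>))"

text \<open>The grading involution by total degree; it carries the sign of the graded Leibniz
  rule.\<close>

definition bisign :: "('a, 'k::field) bicochain \<Rightarrow> ('a, 'k) bicochain"
  where "bisign F p q \<sigma> \<tau> = (-1) ^ (p + q) * F p q \<sigma> \<tau>"

lemma cobd_sum: "cobd (\<lambda>n \<sigma>. \<Sum>i\<in>I. f i n \<sigma>) n \<sigma> = (\<Sum>i\<in>I. cobd (f i) n \<sigma>)"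
  by (induction I rule: infinite_finite_induct) (simp_all add: cobd_add)

text \<open>The component entering \<open>cobd\<close> in degree \<open>n\<close> has degree
  \<open>n - 1\<close>, which accounts for the extra factor \<open>(-1) ^ m\<close> when the twist
  is pulled out.\<close>

lemma cobd_power_mult:
  fixes f :: "nat \<Rightarrow> 'a simplex \<Rightarrow> 'k::comm_ring_1"
  shows "cobd (\<lambda>r \<sigma>. (-1) ^ (m * r) * f r \<sigma>) n \<sigma> = (-1) ^ m * ((-1) ^ (m * n) * cobd f n \<sigma>)"
proof (cases n)
  case (Suc l)
  have s: "((-1::'k) ^ m * (-1) ^ m) = 1" by (simp flip: power_add mult_2)
  have "cobd (\<lambda>r \<sigma>. (-1) ^ (m * r) * f r \<sigma>) n \<sigma> = (-1) ^ (m * l) * cobd f n \<sigma>"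
    by (simp add: Suc cobd_Suc sum_distrib_left mult.left_commute del: sum.atMost_Suc)
  also have "\<dots> = ((-1) ^ m * (-1) ^ m) * ((-1) ^ (m * l) * cobd f n \<sigma>)" unfolding s by simp
  finally show ?thesis by (simp add: Suc power_add mult_ac)
qed simp

lemma cobd_power: "cobd (\<lambda>r \<sigma>. (-1) ^ r * f r \<sigma>) n \<sigma> = - ((-1) ^ n * cobd f n \<sigma>)"
  using cobd_power_mult[of 1 f n \<sigma>] by simp

text \<open>With the second variable fixed, \<open>bicup\<close> is a sum over \<open>q'\<close> of
  one-variable cup products whose sign is absorbed into the second factor. Pulling that sign through
  the coboundary leaves \<open>(-1) ^ q'\<close>, which joins the \<open>(-1) ^ p'\<close> of the
  Leibniz rule to form \<open>bisign\<close>.\<close>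

lemma bicup_bicobd_fst:
  "cobd (\<lambda>p' \<sigma>'. bicup F G p' q \<sigma>' \<tau>) p \<sigma>
    = bicup (\<lambda>p q \<sigma> \<tau>. cobd (\<lambda>p' \<sigma>'. F p' q \<sigma>' \<tau>) p \<sigma>) G p q \<sigma> \<tau>
      + bicup (bisign F) (\<lambda>p q \<sigma> \<tau>. cobd (\<lambda>p' \<sigma>'. G p' q \<sigma>' \<tau>) p \<sigma>) p q \<sigma> \<tau>"
proof -
  let ?f = "\<lambda>q' p' \<sigma>'. F p' q' \<sigma>' (front_face q' \<tau>)"
  let ?G = "\<lambda>q' r \<sigma>'. G r (q - q') \<sigma>' (back_face q' (q - q') \<tau>)"
  let ?g = "\<lambda>q' r \<sigma>'. (-1) ^ (q' * r) * ?G q' r \<sigma>'"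
  have "bicup F G p' q \<sigma>' \<tau> = (\<Sum>q'\<le>q. cup (?f q') (?g q') p' \<sigma>')" for p' \<sigma>'
    unfolding bicup_def cup_def by (subst sum.swap) (simp add: mult_ac)
  then have "cobd (\<lambda>p' \<sigma>'. bicup F G p' q \<sigma>' \<tau>) p \<sigma> = (\<Sum>q'\<le>q. cobd (cup (?f q') (?g q')) p \<sigma>)"
    by (simp add: cobd_sum)
  also have "\<dots> = (\<Sum>q'\<le>q. cup (cobd (?f q')) (?g q') p \<sigma>)
      + (\<Sum>q'\<le>q. cup (\<lambda>p' \<sigma>'. (-1) ^ p' * ?f q' p' \<sigma>') (cobd (?g q')) p \<sigma>)"
    by (simp add: cobd_cup sum.distrib)
  also have "(\<Sum>q'\<le>q. cup (cobd (?f q')) (?g q') p \<sigma>)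
      = bicup (\<lambda>p q \<sigma> \<tau>. cobd (\<lambda>p' \<sigma>'. F p' q \<sigma>' \<tau>) p \<sigma>) G p q \<sigma> \<tau>"
    unfolding bicup_def cup_def by (subst sum.swap) (simp add: mult_ac)
  also have "(\<Sum>q'\<le>q. cup (\<lambda>p' \<sigma>'. (-1) ^ p' * ?f q' p' \<sigma>') (cobd (?g q')) p \<sigma>)
      = bicup (bisign F) (\<lambda>p q \<sigma> \<tau>. cobd (\<lambda>p' \<sigma>'. G p' q \<sigma>' \<tau>) p \<sigma>) p q \<sigma> \<tau>"
    unfolding bicup_def cup_def cobd_power_mult[abs_def] bisign_def
    by (subst sum.swap) (simp add: mult_ac power_add)
  finally show ?thesis .
qed

text \<open>The same with the first variable fixed, but the sign is now absorbed into the first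
  factor. The prefactor splits as \<open>(-1) ^ p' * (-1) ^ (p - p')\<close>: one half cancels
  against the twist when the first factor is differentiated, and both halves are used up when the
  second one is.\<close>

lemma bicup_bicobd_snd:
  fixes F G :: "('a, 'k::field) bicochain"
  shows "(-1) ^ p * cobd (\<lambda>q' \<tau>'. bicup F G p q' \<sigma> \<tau>') q \<tau>
    = bicup (\<lambda>p q \<sigma> \<tau>. (-1) ^ p * cobd (\<lambda>q' \<tau>'. F p q' \<sigma> \<tau>') q \<tau>) G p q \<sigma> \<tau>
      + bicup (bisign F) (\<lambda>p q \<sigma> \<tau>. (-1) ^ p * cobd (\<lambda>q' \<tau>'. G p q' \<sigma> \<tau>') q \<tau>) p q \<sigma> \<tau>"
proof -
  let ?F = "\<lambda>p' q' \<tau>'. F p' q' (front_face p' \<sigma>) \<tau>'"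
  let ?f = "\<lambda>p' q' \<tau>'. (-1) ^ ((p - p') * q') * ?F p' q' \<tau>'"
  let ?g = "\<lambda>p' s \<tau>'. G (p - p') s (back_face p' (p - p') \<sigma>) \<tau>'"
  have "bicup F G p q' \<sigma> \<tau>' = (\<Sum>p'\<le>p. cup (?f p') (?g p') q' \<tau>')" for q' \<tau>'
    unfolding bicup_def cup_def by (simp add: mult_ac)
  then have "(-1) ^ p * cobd (\<lambda>q' \<tau>'. bicup F G p q' \<sigma> \<tau>') q \<tau> = (-1) ^ p * (\<Sum>p'\<le>p. cobd (cup (?f p') (?g p')) q \<tau>)"
    by (simp add: cobd_sum)
  also have "\<dots> = (-1) ^ p * (\<Sum>p'\<le>p. cup (cobd (?f p')) (?g p') q \<tau>)
      + (-1) ^ p * (\<Sum>p'\<le>p. cup (\<lambda>q' \<tau>'. (-1) ^ q' * ?f p' q' \<tau>') (cobd (?g p')) q \<tau>)"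
    by (simp add: cobd_cup sum.distrib distrib_left)
  also have "(-1) ^ p * (\<Sum>p'\<le>p. cup (cobd (?f p')) (?g p') q \<tau>)
      = bicup (\<lambda>p q \<sigma> \<tau>. (-1) ^ p * cobd (\<lambda>q' \<tau>'. F p q' \<sigma> \<tau>') q \<tau>) G p q \<sigma> \<tau>"
    unfolding bicup_def cup_def cobd_power_mult[abs_def] sum_distrib_left
  proof (intro sum.cong refl)
    fix p' q' assume "p' \<in> {..p}"
    then obtain r where r: "p = p' + r" by (auto simp: le_iff_add)
    have "(-1::'k) ^ p * (-1) ^ (p - p') = (-1) ^ p' * ((-1) ^ r * (-1) ^ r)"
      by (simp add: r power_add)
    also have "\<dots> = (-1) ^ p'" by (simp flip: power_add mult_2)
    finally have "(-1) ^ p * ((-1) ^ (p - p') * x) = (-1) ^ p' * x" for x :: 'k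
      by (simp flip: mult.assoc)
    then show "(- 1) ^ p * ((- 1) ^ (p - p') * ((- 1) ^ ((p - p') * q') * cobd (?F p') q' (front_face q' \<tau>)) *
            G (p - p') (q - q') (back_face p' (p - p') \<sigma>) (back_face q' (q - q') \<tau>)) =
        (- 1) ^ (q' * (p - p')) * ((- 1) ^ p' * cobd (?F p') q' (front_face q' \<tau>)) *
            G (p - p') (q - q') (back_face p' (p - p') \<sigma>) (back_face q' (q - q') \<tau>)"
      by (simp add: mult_ac)
  qed
  also have "(-1) ^ p * (\<Sum>p'\<le>p. cup (\<lambda>q' \<tau>'. (-1) ^ q' * ?f p' q' \<tau>') (cobd (?g p')) q \<tau>)
      = bicup (bisign F) (\<lambda>p q \<sigma> \<tau>. (-1) ^ p * cobd (\<lambda>q' \<tau>'. G p q' \<sigma> \<tau>') q \<tau>) p q \<sigma> \<tau>"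
    unfolding bicup_def cup_def bisign_def sum_distrib_left
  proof (intro sum.cong refl)
    fix p' q' assume "p' \<in> {..p}"
    then have "(-1::'k) ^ p = (-1) ^ p' * (-1) ^ (p - p')" by (simp flip: power_add)
    then show "(- 1) ^ p * ((- 1) ^ q' * ((- 1) ^ ((p - p') * q') * ?F p' q' (front_face q' \<tau>)) *
            cobd (?g p') (q - q') (back_face q' (q - q') \<tau>)) =
        (- 1) ^ (q' * (p - p')) * ((- 1) ^ (p' + q') * ?F p' q' (front_face q' \<tau>)) *
            ((- 1) ^ (p - p') * cobd (?g p') (q - q') (back_face q' (q - q') \<tau>))"
      by (simp add: mult_ac power_add)
  qed
  finally show ?thesis .
qed

lemma bicup_add:
  "bicup (\<lambda>p q \<sigma> \<tau>. F p q \<sigma> \<tau> + F' p q \<sigma> \<tau>) G p q \<sigma> \<tau> = bicup F G p q \<sigma> \<tau> + bicup F' G p q \<sigma> \<tau>"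
  "bicup F (\<lambda>p q \<sigma> \<tau>. G p q \<sigma> \<tau> + G' p q \<sigma> \<tau>) p q \<sigma> \<tau> = bicup F G p q \<sigma> \<tau> + bicup F G' p q \<sigma> \<tau>"
  by (simp_all add: bicup_def algebra_simps sum.distrib)

lemma bicup_zero [simp]: "bicup (\<lambda>p q \<sigma> \<tau>. 0) G p q \<sigma> \<tau> = 0" "bicup F (\<lambda>p q \<sigma> \<tau>. 0) p q \<sigma> \<tau> = 0"
  by (simp_all add: bicup_def)

lemma bicobd_bicup: "bicobd (bicup F G) p q \<sigma> \<tau> = bicup (bicobd F) G p q \<sigma> \<tau> + bicup (bisign F) (bicobd G) p q \<sigma> \<tau>"
  unfolding bicobd_def[abs_def] bicup_add bicup_bicobd_fst bicup_bicobd_snd by simp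

lemma bicobd_add: "bicobd (\<lambda>p q \<sigma> \<tau>. F p q \<sigma> \<tau> + G p q \<sigma> \<tau>) p q \<sigma> \<tau> = bicobd F p q \<sigma> \<tau> + bicobd G p q \<sigma> \<tau>"
  by (simp add: bicobd_def cobd_add algebra_simps)

lemma bicobd_bisign: "bicobd (bisign F) p q \<sigma> \<tau> = - bisign (bicobd F) p q \<sigma> \<tau>"
proof -
  have "cobd (\<lambda>p' \<sigma>'. bisign F p' q \<sigma>' \<tau>) p \<sigma> = - ((-1) ^ (p + q) * cobd (\<lambda>p' \<sigma>'. F p' q \<sigma>' \<tau>) p \<sigma>)"
    using cobd_power[of "\<lambda>p' \<sigma>'. (-1) ^ q * F p' q \<sigma>' \<tau>" p \<sigma>]
    by (simp add: bisign_def power_add mult.assoc cobd_mult)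
  moreover have "cobd (\<lambda>q' \<tau>'. bisign F p q' \<sigma> \<tau>') q \<tau> = - ((-1) ^ (p + q) * cobd (\<lambda>q' \<tau>'. F p q' \<sigma> \<tau>') q \<tau>)"
    using cobd_power[of "\<lambda>q' \<tau>'. (-1) ^ p * F p q' \<sigma> \<tau>'" q \<tau>]
    by (simp add: bisign_def power_add mult.left_commute mult.assoc cobd_mult)
  ultimately show ?thesis by (simp add: bicobd_def bisign_def algebra_simps)
qed

lemma bicobd_cong:
  assumes "singular_simplex p X \<sigma>" "singular_simplex q X \<tau>"
    "\<And>p q \<sigma> \<tau>. singular_simplex p X \<sigma> \<Longrightarrow> singular_simplex q X \<tau> \<Longrightarrow> F p q \<sigma> \<tau> = G p q \<sigma> \<tau>"
  shows "bicobd F p q \<sigma> \<tau> = bicobd G p q \<sigma> \<tau>"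
  unfolding bicobd_def
  using cobd_cong_simplex[OF assms(1), of "\<lambda>p' \<sigma>'. F p' q \<sigma>' \<tau>" "\<lambda>p' \<sigma>'. G p' q \<sigma>' \<tau>"]
    cobd_cong_simplex[OF assms(2), of "\<lambda>q' \<tau>'. F p q' \<sigma> \<tau>'" "\<lambda>q' \<tau>'. G p q' \<sigma> \<tau>'"] assms by simp

lemma bicup_cong:
  assumes "singular_simplex p X \<sigma>" "singular_simplex q X \<tau>"
    "\<And>p q \<sigma> \<tau>. singular_simplex p X \<sigma> \<Longrightarrow> singular_simplex q X \<tau> \<Longrightarrow> F p q \<sigma> \<tau> = F' p q \<sigma> \<tau>"
    "\<And>p q \<sigma> \<tau>. singular_simplex p X \<sigma> \<Longrightarrow> singular_simplex q X \<tau> \<Longrightarrow> G p q \<sigma> \<tau> = G' p q \<sigma> \<tau>"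
  shows "bicup F G p q \<sigma> \<tau> = bicup F' G' p q \<sigma> \<tau>"
  unfolding bicup_def using assms(1,2)
  by (intro sum.cong refl arg_cong2[of _ _ _ _ "(*)"] assms(3,4))
    (auto intro: singular_simplex_front_face singular_simplex_back_face)

lemma cobd_swap:
  "cobd (\<lambda>p' \<sigma>'. cobd (\<lambda>q' \<tau>'. F p' q' \<sigma>' \<tau>') q \<tau>) p \<sigma> = cobd (\<lambda>q' \<tau>'. cobd (\<lambda>p' \<sigma>'. F p' q' \<sigma>' \<tau>') p \<sigma>) q \<tau>"
proof (cases p; cases q)
  fix m n assume p: "p = Suc m" and q: "q = Suc n"
  let ?t = "\<lambda>i j. (-1) ^ i * ((-1) ^ j * F m n (singular_face p i \<sigma>) (singular_face q j \<tau>))"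
  have "cobd (\<lambda>p' \<sigma>'. cobd (\<lambda>q' \<tau>'. F p' q' \<sigma>' \<tau>') q \<tau>) p \<sigma> = (\<Sum>i\<le>p. \<Sum>j\<le>q. ?t i j)"
    unfolding p q cobd_Suc sum_distrib_left ..
  also have "\<dots> = (\<Sum>j\<le>q. \<Sum>i\<le>p. ?t i j)" by (rule sum.swap)
  also have "\<dots> = (\<Sum>j\<le>q. (-1) ^ j * (\<Sum>i\<le>p. (-1) ^ i * F m n (singular_face p i \<sigma>) (singular_face q j \<tau>)))"
    unfolding sum_distrib_left by (intro sum.cong refl mult.left_commute)
  also have "\<dots> = cobd (\<lambda>q' \<tau>'. cobd (\<lambda>p' \<sigma>'. F p' q' \<sigma>' \<tau>') p \<sigma>) q \<tau>"
    unfolding p q cobd_Suc ..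
  finally show ?thesis .
qed (simp_all)

text \<open>The pure second coboundaries vanish by \<open>cobd_cobd\<close>, and the two mixed terms
  cancel by the sign in \<open>bicobd\<close>.\<close>

lemma bicobd_bicobd:
  assumes "singular_simplex p X \<sigma>" "singular_simplex q X \<tau>"
  shows "bicobd (bicobd F) p q \<sigma> \<tau> = 0"
proof -
  have "cobd (\<lambda>p' \<sigma>'. bicobd F p' q \<sigma>' \<tau>) p \<sigma>
      = cobd (\<lambda>p' \<sigma>'. (-1) ^ p' * cobd (\<lambda>q' \<tau>'. F p' q' \<sigma>' \<tau>') q \<tau>) p \<sigma>"
    using cobd_cobd[OF assms(1), of "\<lambda>p' \<sigma>'. F p' q \<sigma>' \<tau>"] by (simp add: bicobd_def cobd_add)
  also have "\<dots> = - ((-1) ^ p * cobd (\<lambda>q' \<tau>'. cobd (\<lambda>p' \<sigma>'. F p' q' \<sigma>' \<tau>') p \<sigma>) q \<tau>)"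
    unfolding cobd_power by (subst cobd_swap) rule
  finally have 1: "cobd (\<lambda>p' \<sigma>'. bicobd F p' q \<sigma>' \<tau>) p \<sigma>
      = - ((-1) ^ p * cobd (\<lambda>q' \<tau>'. cobd (\<lambda>p' \<sigma>'. F p' q' \<sigma>' \<tau>') p \<sigma>) q \<tau>)" .
  have 2: "cobd (\<lambda>q' \<tau>'. bicobd F p q' \<sigma> \<tau>') q \<tau> = cobd (\<lambda>q' \<tau>'. cobd (\<lambda>p' \<sigma>'. F p' q' \<sigma>' \<tau>') p \<sigma>) q \<tau>"
    using cobd_cobd[OF assms(2), of "\<lambda>q' \<tau>'. F p q' \<sigma> \<tau>'"] by (simp add: bicobd_def cobd_add cobd_mult)
  show ?thesis unfolding bicobd_def[of "bicobd F"] 1 2 by simp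
qed

definition cross :: "(nat \<Rightarrow> 'a simplex \<Rightarrow> 'k::field) \<Rightarrow> (nat \<Rightarrow> 'a simplex \<Rightarrow> 'k) \<Rightarrow> ('a, 'k) bicochain"
  where "cross \<phi> \<psi> p q \<sigma> \<tau> = \<phi> p \<sigma> * \<psi> q \<tau>"

lemma bicobd_cross:
  "bicobd (cross \<phi> \<psi>) p q \<sigma> \<tau> = cobd \<phi> p \<sigma> * \<psi> q \<tau> + (-1) ^ p * (\<phi> p \<sigma> * cobd \<psi> q \<tau>)"
proof -
  have "cobd (\<lambda>p' \<sigma>'. cross \<phi> \<psi> p' q \<sigma>' \<tau>) p \<sigma> = cobd \<phi> p \<sigma> * \<psi> q \<tau>"
    using cobd_mult[of "\<psi> q \<tau>" \<phi> p \<sigma>] by (simp add: cross_def mult.commute)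
  then show ?thesis by (simp add: bicobd_def cross_def cobd_mult)
qed

section \<open>The graded tensor product\<close>

lemma bilinear_mapI:
  assumes "\<And>a b. a \<in> carrier M \<Longrightarrow> b \<in> carrier N \<Longrightarrow> f (a, b) \<in> carrier L"
    "\<And>a a' b. a \<in> carrier M \<Longrightarrow> a' \<in> carrier M \<Longrightarrow> b \<in> carrier N \<Longrightarrow> f (a \<oplus>\<^bsub>M\<^esub> a', b) = f (a, b) \<oplus>\<^bsub>L\<^esub> f (a', b)"
    "\<And>a b b'. a \<in> carrier M \<Longrightarrow> b \<in> carrier N \<Longrightarrow> b' \<in> carrier N \<Longrightarrow> f (a, b \<oplus>\<^bsub>N\<^esub> b') = f (a, b) \<oplus>\<^bsub>L\<^esub> f (a, b')"
    "\<And>c a b. a \<in> carrier M \<Longrightarrow> b \<in> carrier N \<Longrightarrow> f (c \<odot>\<^bsub>M\<^esub> a, b) = c \<odot>\<^bsub>L\<^esub> f (a, b)"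
    "\<And>c a b. a \<in> carrier M \<Longrightarrow> b \<in> carrier N \<Longrightarrow> f (a, c \<odot>\<^bsub>N\<^esub> b) = c \<odot>\<^bsub>L\<^esub> f (a, b)"
  shows "bilinear_map M N L f"
  using assms unfolding bilinear_map_def by blast

context tensor
begin

text \<open>The graded product is a lift of lifts, and the outer pair of factors enters the inner
  lift as a parameter. Linearity in that parameter is linearity of the lift in the bilinear map
  itself.\<close>

lemma tensor_lift_fun_add:
  assumes L: "vspace L" and f: "bilinear_map M N L f" "bilinear_map M N L f1" "bilinear_map M N L f2"
    and eq: "\<And>a b. a \<in> carrier M \<Longrightarrow> b \<in> carrier N \<Longrightarrow> f (a, b) = f1 (a, b) \<oplus>\<^bsub>L\<^esub> f2 (a, b)"
    and t: "t \<in> carrier T"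
  shows "tensor_lift L f t = tensor_lift L f1 t \<oplus>\<^bsub>L\<^esub> tensor_lift L f2 t"
proof -
  interpret L: vspace L by fact
  interpret f: bilinear M N L f by unfold_locales (rule f)
  interpret f1: bilinear M N L f1 by unfold_locales (rule f)
  interpret f2: bilinear M N L f2 by unfold_locales (rule f)
  show ?thesis using t
  proof (induction t rule: tensor_induct)
    case (add t a b)
    then show ?case
      using bilinear_mapD(1)[OF f(2), of a b] bilinear_mapD(1)[OF f(3), of a b]
      by (simp add: f.tensor_lift_add f1.tensor_lift_add f2.tensor_lift_add f.tensor_lift_pure
          f1.tensor_lift_pure f2.tensor_lift_pure eq L.a_ac)
  qed simp
qed

lemma tensor_lift_fun_smult:
  assumes L: "vspace L" and f: "bilinear_map M N L f" "bilinear_map M N L f1"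
    and eq: "\<And>a b. a \<in> carrier M \<Longrightarrow> b \<in> carrier N \<Longrightarrow> f (a, b) = c \<odot>\<^bsub>L\<^esub> f1 (a, b)"
    and t: "t \<in> carrier T"
  shows "tensor_lift L f t = c \<odot>\<^bsub>L\<^esub> tensor_lift L f1 t"
proof -
  interpret L: vspace L by fact
  interpret f: bilinear M N L f by unfold_locales (rule f)
  interpret f1: bilinear M N L f1 by unfold_locales (rule f)
  show ?thesis using t
  proof (induction t rule: tensor_induct)
    case (add t a b)
    then show ?case
      using bilinear_mapD(1)[OF f(2), of a b]
      by (simp add: f.tensor_lift_add f1.tensor_lift_add f.tensor_lift_pure
          f1.tensor_lift_pure eq L.smult_add_right)
  qed simp
qed

end

text \<open>Collects what makes the multiplication of \<open>graded_tensor_product\<close> well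
  defined: bilinear products, linear projections to the degrees, and finite support, which keeps the
  sums over degrees finite.\<close>

locale graded_algebras = tensor M N
  for M :: "('k::field, nat \<Rightarrow> 'v) module" and N :: "('k, nat \<Rightarrow> 'w) module" +
  assumes multM: "bilinear_map M M M (\<lambda>(a, b). a \<otimes>\<^bsub>M\<^esub> b)"
    and multN: "bilinear_map N N N (\<lambda>(a, b). a \<otimes>\<^bsub>N\<^esub> b)"
    and partM: "a \<in> carrier M \<Longrightarrow> homogeneous_part M n a \<in> carrier M"
      "a \<in> carrier M \<Longrightarrow> a' \<in> carrier M \<Longrightarrow>
        homogeneous_part M n (a \<oplus>\<^bsub>M\<^esub> a') = homogeneous_part M n a \<oplus>\<^bsub>M\<^esub> homogeneous_part M n a'"
      "a \<in> carrier M \<Longrightarrow> homogeneous_part M n (x \<odot>\<^bsub>M\<^esub> a) = x \<odot>\<^bsub>M\<^esub> homogeneous_part M n a"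
    and partN: "b \<in> carrier N \<Longrightarrow> homogeneous_part N n b \<in> carrier N"
      "b \<in> carrier N \<Longrightarrow> b' \<in> carrier N \<Longrightarrow>
        homogeneous_part N n (b \<oplus>\<^bsub>N\<^esub> b') = homogeneous_part N n b \<oplus>\<^bsub>N\<^esub> homogeneous_part N n b'"
      "b \<in> carrier N \<Longrightarrow> homogeneous_part N n (x \<odot>\<^bsub>N\<^esub> b) = x \<odot>\<^bsub>N\<^esub> homogeneous_part N n b"
    and finM: "a \<in> carrier M \<Longrightarrow> finite {n. a n \<noteq> \<zero>\<^bsub>M\<^esub> n}"
    and finN: "b \<in> carrier N \<Longrightarrow> finite {n. b n \<noteq> \<zero>\<^bsub>N\<^esub> n}"
begin

lemmas multMD = bilinear_mapD[OF multM, simplified]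
lemmas multND = bilinear_mapD[OF multN, simplified]

definition gterm where
  "gterm a b c d q r = (-1) ^ (q * r) \<odot>\<^bsub>T\<^esub>
     pure (a \<otimes>\<^bsub>M\<^esub> homogeneous_part M r c) (homogeneous_part N q b \<otimes>\<^bsub>N\<^esub> d)"

definition gmul where
  "gmul a b c d = (\<Oplus>\<^bsub>T\<^esub>q\<in>{q. b q \<noteq> \<zero>\<^bsub>N\<^esub> q}. \<Oplus>\<^bsub>T\<^esub>r\<in>{r. c r \<noteq> \<zero>\<^bsub>M\<^esub> r}. gterm a b c d q r)"

lemma gterm_closed [simp]:
  "a \<in> carrier M \<Longrightarrow> b \<in> carrier N \<Longrightarrow> c \<in> carrier M \<Longrightarrow> d \<in> carrier N \<Longrightarrow> gterm a b c d q r \<in> carrier T"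
  by (simp add: gterm_def multMD multND partM partN)

lemma gterm_zero:
  assumes "a \<in> carrier M" "b \<in> carrier N" "c \<in> carrier M" "d \<in> carrier N" "b q = \<zero>\<^bsub>N\<^esub> q \<or> c r = \<zero>\<^bsub>M\<^esub> r"
  shows "gterm a b c d q r = \<zero>\<^bsub>T\<^esub>"
  using assms(5)
proof
  assume "b q = \<zero>\<^bsub>N\<^esub> q"
  then have "homogeneous_part N q b = \<zero>\<^bsub>N\<^esub>" by (simp add: homogeneous_part_def fun_upd_idem)
  moreover have "\<zero>\<^bsub>N\<^esub> \<otimes>\<^bsub>N\<^esub> d = \<zero>\<^bsub>N\<^esub>" using multND(4)[of "\<zero>\<^bsub>N\<^esub>" d 0] assms by (simp add: multND(1))
  ultimately show ?thesis using assms by (simp add: gterm_def multMD(1) partM)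
next
  assume "c r = \<zero>\<^bsub>M\<^esub> r"
  then have "homogeneous_part M r c = \<zero>\<^bsub>M\<^esub>" by (simp add: homogeneous_part_def fun_upd_idem)
  moreover have "a \<otimes>\<^bsub>M\<^esub> \<zero>\<^bsub>M\<^esub> = \<zero>\<^bsub>M\<^esub>" using multMD(5)[of a "\<zero>\<^bsub>M\<^esub>" 0] assms by (simp add: multMD(1))
  ultimately show ?thesis using assms by (simp add: gterm_def multND(1) partN)
qed

text \<open>The index sets in \<open>gmul\<close> depend on \<open>b\<close> and \<open>c\<close>,
  so linearity is visible only after passing to larger common index sets, where the additional terms
  are zero.\<close>

lemma gmul_superset:
  assumes c: "a \<in> carrier M" "b \<in> carrier N" "c \<in> carrier M" "d \<in> carrier N"
    and Q: "finite Q" "{q. b q \<noteq> \<zero>\<^bsub>N\<^esub> q} \<subseteq> Q" and R: "finite R" "{r. c r \<noteq> \<zero>\<^bsub>M\<^esub> r} \<subseteq> R"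
  shows "gmul a b c d = (\<Oplus>\<^bsub>T\<^esub>q\<in>Q. \<Oplus>\<^bsub>T\<^esub>r\<in>R. gterm a b c d q r)"
proof -
  have "gmul a b c d = (\<Oplus>\<^bsub>T\<^esub>q\<in>{q. b q \<noteq> \<zero>\<^bsub>N\<^esub> q}. \<Oplus>\<^bsub>T\<^esub>r\<in>R. gterm a b c d q r)"
    unfolding gmul_def
  proof (rule T.finsum_cong'[OF refl])
    fix q
    show "(\<Oplus>\<^bsub>T\<^esub>r\<in>{r. c r \<noteq> \<zero>\<^bsub>M\<^esub> r}. gterm a b c d q r) = (\<Oplus>\<^bsub>T\<^esub>r\<in>R. gterm a b c d q r)"
      by (rule T.finsum_superset[OF R]) (use c in \<open>simp_all add: gterm_zero Pi_iff\<close>)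
  qed (use c in auto)
  also have "\<dots> = (\<Oplus>\<^bsub>T\<^esub>q\<in>Q. \<Oplus>\<^bsub>T\<^esub>r\<in>R. gterm a b c d q r)"
  proof (intro T.finsum_superset Q Pi_I T.finsum_closed)
    fix q assume "q \<in> Q - {q. b q \<noteq> \<zero>\<^bsub>N\<^esub> q}"
    then have "(\<Oplus>\<^bsub>T\<^esub>r\<in>R. gterm a b c d q r) = (\<Oplus>\<^bsub>T\<^esub>r\<in>R. \<zero>\<^bsub>T\<^esub>)"
      using c by (intro T.finsum_cong') (simp_all add: gterm_zero)
    then show "(\<Oplus>\<^bsub>T\<^esub>r\<in>R. gterm a b c d q r) = \<zero>\<^bsub>T\<^esub>" by (simp add: T.finsum_zero)
  qed (use c in auto)
  finally show ?thesis .
qed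

lemma gmul_closed [simp]:
  "a \<in> carrier M \<Longrightarrow> b \<in> carrier N \<Longrightarrow> c \<in> carrier M \<Longrightarrow> d \<in> carrier N \<Longrightarrow> gmul a b c d \<in> carrier T"
  unfolding gmul_def by (intro T.finsum_closed Pi_I) simp

text \<open>Stated through \<open>gterm\<close> so that one lemma serves additivity in each of the
  four arguments.\<close>

lemma gmul_add:
  assumes c: "a1 \<in> carrier M" "b1 \<in> carrier N" "c1 \<in> carrier M" "d1 \<in> carrier N"
      "a2 \<in> carrier M" "b2 \<in> carrier N" "c2 \<in> carrier M" "d2 \<in> carrier N"
      "a3 \<in> carrier M" "b3 \<in> carrier N" "c3 \<in> carrier M" "d3 \<in> carrier N"
    and eq: "\<And>q r. gterm a1 b1 c1 d1 q r = gterm a2 b2 c2 d2 q r \<oplus>\<^bsub>T\<^esub> gterm a3 b3 c3 d3 q r"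
  shows "gmul a1 b1 c1 d1 = gmul a2 b2 c2 d2 \<oplus>\<^bsub>T\<^esub> gmul a3 b3 c3 d3"
proof -
  define Q where "Q = {q. b1 q \<noteq> \<zero>\<^bsub>N\<^esub> q} \<union> {q. b2 q \<noteq> \<zero>\<^bsub>N\<^esub> q} \<union> {q. b3 q \<noteq> \<zero>\<^bsub>N\<^esub> q}"
  define R where "R = {q. c1 q \<noteq> \<zero>\<^bsub>M\<^esub> q} \<union> {q. c2 q \<noteq> \<zero>\<^bsub>M\<^esub> q} \<union> {q. c3 q \<noteq> \<zero>\<^bsub>M\<^esub> q}"
  have fin: "finite Q" "finite R" using c finM finN by (auto simp: Q_def R_def)
  have 1: "gmul a1 b1 c1 d1 = (\<Oplus>\<^bsub>T\<^esub>q\<in>Q. \<Oplus>\<^bsub>T\<^esub>r\<in>R. gterm a1 b1 c1 d1 q r)"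
    using c fin by (intro gmul_superset) (auto simp: Q_def R_def)
  have 2: "gmul a2 b2 c2 d2 = (\<Oplus>\<^bsub>T\<^esub>q\<in>Q. \<Oplus>\<^bsub>T\<^esub>r\<in>R. gterm a2 b2 c2 d2 q r)"
    using c fin by (intro gmul_superset) (auto simp: Q_def R_def)
  have 3: "gmul a3 b3 c3 d3 = (\<Oplus>\<^bsub>T\<^esub>q\<in>Q. \<Oplus>\<^bsub>T\<^esub>r\<in>R. gterm a3 b3 c3 d3 q r)"
    using c fin by (intro gmul_superset) (auto simp: Q_def R_def)
  have "gmul a1 b1 c1 d1 = (\<Oplus>\<^bsub>T\<^esub>q\<in>Q. (\<Oplus>\<^bsub>T\<^esub>r\<in>R. gterm a2 b2 c2 d2 q r) \<oplus>\<^bsub>T\<^esub> (\<Oplus>\<^bsub>T\<^esub>r\<in>R. gterm a3 b3 c3 d3 q r))"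
    unfolding 1 eq
    by (intro T.finsum_cong' refl T.finsum_addf Pi_I T.a_closed T.finsum_closed) (use c in auto)
  also have "\<dots> = gmul a2 b2 c2 d2 \<oplus>\<^bsub>T\<^esub> gmul a3 b3 c3 d3"
    unfolding 2 3 by (intro T.finsum_addf Pi_I T.finsum_closed) (use c in auto)
  finally show ?thesis .
qed

lemma gmul_smult:
  assumes c: "a1 \<in> carrier M" "b1 \<in> carrier N" "c1 \<in> carrier M" "d1 \<in> carrier N"
      "a2 \<in> carrier M" "b2 \<in> carrier N" "c2 \<in> carrier M" "d2 \<in> carrier N"
    and eq: "\<And>q r. gterm a1 b1 c1 d1 q r = x \<odot>\<^bsub>T\<^esub> gterm a2 b2 c2 d2 q r"
  shows "gmul a1 b1 c1 d1 = x \<odot>\<^bsub>T\<^esub> gmul a2 b2 c2 d2"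
proof -
  define Q where "Q = {q. b1 q \<noteq> \<zero>\<^bsub>N\<^esub> q} \<union> {q. b2 q \<noteq> \<zero>\<^bsub>N\<^esub> q}"
  define R where "R = {q. c1 q \<noteq> \<zero>\<^bsub>M\<^esub> q} \<union> {q. c2 q \<noteq> \<zero>\<^bsub>M\<^esub> q}"
  have fin: "finite Q" "finite R" using c finM finN by (auto simp: Q_def R_def)
  have 1: "gmul a1 b1 c1 d1 = (\<Oplus>\<^bsub>T\<^esub>q\<in>Q. \<Oplus>\<^bsub>T\<^esub>r\<in>R. gterm a1 b1 c1 d1 q r)"
    using c fin by (intro gmul_superset) (auto simp: Q_def R_def)
  have 2: "gmul a2 b2 c2 d2 = (\<Oplus>\<^bsub>T\<^esub>q\<in>Q. \<Oplus>\<^bsub>T\<^esub>r\<in>R. gterm a2 b2 c2 d2 q r)"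
    using c fin by (intro gmul_superset) (auto simp: Q_def R_def)
  have "gmul a1 b1 c1 d1 = (\<Oplus>\<^bsub>T\<^esub>q\<in>Q. x \<odot>\<^bsub>T\<^esub> (\<Oplus>\<^bsub>T\<^esub>r\<in>R. gterm a2 b2 c2 d2 q r))"
    unfolding 1 eq
    by (intro T.finsum_cong' refl T.finsum_smult[symmetric] Pi_I T.smult_closed T.finsum_closed) (use c in auto)
  also have "\<dots> = x \<odot>\<^bsub>T\<^esub> gmul a2 b2 c2 d2"
    unfolding 2 by (intro T.finsum_smult[symmetric] Pi_I T.finsum_closed) (use c in auto)
  finally show ?thesis .
qed

lemma gmul_bilinear_right:
  assumes "a \<in> carrier M" "b \<in> carrier N"
  shows "bilinear_map M N T (\<lambda>(c, d). gmul a b c d)"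
proof (rule bilinear_mapI, unfold prod.case)
  fix c d assume c: "c \<in> carrier M" and d: "d \<in> carrier N"
  show "gmul a b c d \<in> carrier T" using assms c d by simp
  show "gmul a b (x \<odot>\<^bsub>M\<^esub> c) d = x \<odot>\<^bsub>T\<^esub> gmul a b c d" for x
    using assms c d
    by (intro gmul_smult) (auto simp: gterm_def partM partN multMD multND pure_smult_left T.smult_smult mult.commute)
  show "gmul a b c (x \<odot>\<^bsub>N\<^esub> d) = x \<odot>\<^bsub>T\<^esub> gmul a b c d" for x
    using assms c d
    by (intro gmul_smult) (auto simp: gterm_def partM partN multMD multND pure_smult_right T.smult_smult mult.commute)
  show "gmul a b (c \<oplus>\<^bsub>M\<^esub> c') d = gmul a b c d \<oplus>\<^bsub>T\<^esub> gmul a b c' d" if "c' \<in> carrier M" for c'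
    using assms c d that
    by (intro gmul_add) (auto simp: gterm_def partM partN multMD multND pure_add_left T.smult_add_right)
  show "gmul a b c (d \<oplus>\<^bsub>N\<^esub> d') = gmul a b c d \<oplus>\<^bsub>T\<^esub> gmul a b c d'" if "d' \<in> carrier N" for d'
    using assms c d that
    by (intro gmul_add) (auto simp: gterm_def partM partN multMD multND pure_add_right T.smult_add_right)
qed

lemma gmul_bilinear_left:
  assumes t: "t \<in> carrier T"
  shows "bilinear_map M N T (\<lambda>(a, b). tensor_lift T (\<lambda>(c, d). gmul a b c d) t)"
proof (rule bilinear_mapI, unfold prod.case)
  fix a b assume a: "a \<in> carrier M" and b: "b \<in> carrier N"
  interpret bilinear M N T "\<lambda>(c, d). gmul a b c d"
    by unfold_locales (rule gmul_bilinear_right[OF a b])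
  show "tensor_lift T (\<lambda>(c, d). gmul a b c d) t \<in> carrier T" using t by simp
  have "gmul (x \<odot>\<^bsub>M\<^esub> a) b c d = x \<odot>\<^bsub>T\<^esub> gmul a b c d" if "c \<in> carrier M" "d \<in> carrier N" for x c d
    by (rule gmul_smult) (use a b that in \<open>simp_all add: gterm_def partM partN multMD multND pure_smult_left T.smult_smult mult.commute\<close>)
  then show "tensor_lift T (\<lambda>(c, d). gmul (x \<odot>\<^bsub>M\<^esub> a) b c d) t = x \<odot>\<^bsub>T\<^esub> tensor_lift T (\<lambda>(c, d). gmul a b c d) t" for x
    using a b by (intro tensor_lift_fun_smult[OF T.vspace_axioms gmul_bilinear_right gmul_bilinear_right _ t]) simp_all
  have "gmul a (x \<odot>\<^bsub>N\<^esub> b) c d = x \<odot>\<^bsub>T\<^esub> gmul a b c d" if "c \<in> carrier M" "d \<in> carrier N" for x c d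
    by (rule gmul_smult) (use a b that in \<open>simp_all add: gterm_def partM partN multMD multND pure_smult_right T.smult_smult mult.commute\<close>)
  then show "tensor_lift T (\<lambda>(c, d). gmul a (x \<odot>\<^bsub>N\<^esub> b) c d) t = x \<odot>\<^bsub>T\<^esub> tensor_lift T (\<lambda>(c, d). gmul a b c d) t" for x
    using a b by (intro tensor_lift_fun_smult[OF T.vspace_axioms gmul_bilinear_right gmul_bilinear_right _ t]) simp_all
  have "gmul (a \<oplus>\<^bsub>M\<^esub> a') b c d = gmul a b c d \<oplus>\<^bsub>T\<^esub> gmul a' b c d"
    if "a' \<in> carrier M" "c \<in> carrier M" "d \<in> carrier N" for a' c d
    by (rule gmul_add) (use a b that in \<open>simp_all add: gterm_def partM partN multMD multND pure_add_left T.smult_add_right\<close>)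
  then show "tensor_lift T (\<lambda>(c, d). gmul (a \<oplus>\<^bsub>M\<^esub> a') b c d) t = tensor_lift T (\<lambda>(c, d). gmul a b c d) t \<oplus>\<^bsub>T\<^esub> tensor_lift T (\<lambda>(c, d). gmul a' b c d) t"
    if "a' \<in> carrier M" for a'
    using a b that
    by (intro tensor_lift_fun_add[OF T.vspace_axioms gmul_bilinear_right gmul_bilinear_right gmul_bilinear_right _ t]) simp_all
  have "gmul a (b \<oplus>\<^bsub>N\<^esub> b') c d = gmul a b c d \<oplus>\<^bsub>T\<^esub> gmul a b' c d"
    if "b' \<in> carrier N" "c \<in> carrier M" "d \<in> carrier N" for b' c d
    by (rule gmul_add) (use a b that in \<open>simp_all add: gterm_def partM partN multMD multND pure_add_right T.smult_add_right\<close>)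
  then show "tensor_lift T (\<lambda>(c, d). gmul a (b \<oplus>\<^bsub>N\<^esub> b') c d) t = tensor_lift T (\<lambda>(c, d). gmul a b c d) t \<oplus>\<^bsub>T\<^esub> tensor_lift T (\<lambda>(c, d). gmul a b' c d) t"
    if "b' \<in> carrier N" for b'
    using a b that
    by (intro tensor_lift_fun_add[OF T.vspace_axioms gmul_bilinear_right gmul_bilinear_right gmul_bilinear_right _ t]) simp_all
qed

abbreviation "G \<equiv> graded_tensor_product M N"

lemma graded_mult:
  "t \<otimes>\<^bsub>G\<^esub> t' = tensor_lift T (\<lambda>(a, b). tensor_lift T (\<lambda>(c, d). gmul a b c d) t') t"
  by (simp add: graded_tensor_product_def Let_def gmul_def gterm_def)

lemma graded_mult_closed [simp]:
  assumes "t \<in> carrier T" "t' \<in> carrier T"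
  shows "t \<otimes>\<^bsub>G\<^esub> t' \<in> carrier T"
proof -
  interpret bilinear M N T "\<lambda>(a, b). tensor_lift T (\<lambda>(c, d). gmul a b c d) t'"
    by unfold_locales (rule gmul_bilinear_left[OF assms(2)])
  show ?thesis unfolding graded_mult using assms(1) by simp
qed

lemma graded_mult_add_left:
  assumes "t \<in> carrier T" "u \<in> carrier T" "t' \<in> carrier T"
  shows "(t \<oplus>\<^bsub>T\<^esub> u) \<otimes>\<^bsub>G\<^esub> t' = t \<otimes>\<^bsub>G\<^esub> t' \<oplus>\<^bsub>T\<^esub> u \<otimes>\<^bsub>G\<^esub> t'"
proof -
  interpret bilinear M N T "\<lambda>(a, b). tensor_lift T (\<lambda>(c, d). gmul a b c d) t'"
    by unfold_locales (rule gmul_bilinear_left[OF assms(3)])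
  show ?thesis unfolding graded_mult using assms(1,2) by (rule tensor_lift_add)
qed

lemma graded_mult_zero_left:
  assumes "t' \<in> carrier T"
  shows "\<zero>\<^bsub>T\<^esub> \<otimes>\<^bsub>G\<^esub> t' = \<zero>\<^bsub>T\<^esub>"
proof -
  interpret bilinear M N T "\<lambda>(a, b). tensor_lift T (\<lambda>(c, d). gmul a b c d) t'"
    by unfold_locales (rule gmul_bilinear_left[OF assms])
  show ?thesis unfolding graded_mult by simp
qed

lemma graded_mult_pure_left:
  assumes "a \<in> carrier M" "b \<in> carrier N" "t' \<in> carrier T"
  shows "pure a b \<otimes>\<^bsub>G\<^esub> t' = tensor_lift T (\<lambda>(c, d). gmul a b c d) t'"
proof -
  interpret bilinear M N T "\<lambda>(a, b). tensor_lift T (\<lambda>(c, d). gmul a b c d) t'"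
    by unfold_locales (rule gmul_bilinear_left[OF assms(3)])
  show ?thesis unfolding graded_mult using assms(1,2) by (simp add: tensor_lift_pure)
qed

lemma graded_mult_pure_add_right:
  assumes "a \<in> carrier M" "b \<in> carrier N" "t \<in> carrier T" "t' \<in> carrier T"
  shows "pure a b \<otimes>\<^bsub>G\<^esub> (t \<oplus>\<^bsub>T\<^esub> t') = pure a b \<otimes>\<^bsub>G\<^esub> t \<oplus>\<^bsub>T\<^esub> pure a b \<otimes>\<^bsub>G\<^esub> t'"
proof -
  interpret bilinear M N T "\<lambda>(c, d). gmul a b c d"
    by unfold_locales (rule gmul_bilinear_right[OF assms(1,2)])
  show ?thesis using assms by (simp add: graded_mult_pure_left tensor_lift_add)
qed

lemma graded_mult_pure_zero_right:
  assumes "a \<in> carrier M" "b \<in> carrier N"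
  shows "pure a b \<otimes>\<^bsub>G\<^esub> \<zero>\<^bsub>T\<^esub> = \<zero>\<^bsub>T\<^esub>"
proof -
  interpret bilinear M N T "\<lambda>(c, d). gmul a b c d"
    by unfold_locales (rule gmul_bilinear_right[OF assms(1,2)])
  show ?thesis using assms by (simp add: graded_mult_pure_left)
qed

lemma graded_mult_pure:
  assumes "a \<in> carrier M" "b \<in> carrier N" "c \<in> carrier M" "d \<in> carrier N"
  shows "pure a b \<otimes>\<^bsub>G\<^esub> pure c d = gmul a b c d"
proof -
  interpret bilinear M N T "\<lambda>(c, d). gmul a b c d"
    by unfold_locales (rule gmul_bilinear_right[OF assms(1,2)])
  show ?thesis using assms by (simp add: graded_mult_pure_left tensor_lift_pure)
qed

end

section \<open>Tensors represented by bicochains\<close>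

lemma cup_family_add_left:
  "cup_family X (\<lambda>n \<sigma>. \<phi> n \<sigma> + \<phi>' n \<sigma>) \<psi> = (\<lambda>n \<sigma>. cup_family X \<phi> \<psi> n \<sigma> + cup_family X \<phi>' \<psi> n \<sigma>)"
  by (auto simp: cup_family_def cup_add fun_eq_iff)

lemma cup_family_add_right:
  "cup_family X \<phi> (\<lambda>n \<sigma>. \<psi> n \<sigma> + \<psi>' n \<sigma>) = (\<lambda>n \<sigma>. cup_family X \<phi> \<psi> n \<sigma> + cup_family X \<phi> \<psi>' n \<sigma>)"
  by (auto simp: cup_family_def cup_add fun_eq_iff)

lemma cup_family_smult:
  "cup_family X (\<lambda>n \<sigma>. c * \<phi> n \<sigma>) \<psi> = (\<lambda>n \<sigma>. c * cup_family X \<phi> \<psi> n \<sigma>)"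
  "cup_family X \<phi> (\<lambda>n \<sigma>. c * \<psi> n \<sigma>) = (\<lambda>n \<sigma>. c * cup_family X \<phi> \<psi> n \<sigma>)"
  by (auto simp: cup_family_def cup_mult fun_eq_iff)

lemma cohomology_mult_bilinear:
  "bilinear_map (H X) (H X) (H X)
     (\<lambda>(a, b). a \<otimes>\<^bsub>H X\<^esub> b)"
  by (rule bilinear_mapI)
    (auto simp: cohomology_algebra_carrier cohomology_class_mult cohomology_class_add cohomology_class_smult
      add_family smult_family cup_family_closed cup_family_add_left cup_family_add_right cup_family_smult)

lemma degree_part_linear:
  "degree_part r (\<lambda>n \<sigma>. \<phi> n \<sigma> + \<psi> n \<sigma>) = (\<lambda>n \<sigma>. degree_part r \<phi> n \<sigma> + degree_part r \<psi> n \<sigma>)"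
  "degree_part r (\<lambda>n \<sigma>. c * \<phi> n \<sigma>) = (\<lambda>n \<sigma>. c * degree_part r \<phi> n \<sigma>)"
  by (auto simp: degree_part_def fun_eq_iff)

interpretation ct: tensor "H X1" "H X2" for X1 X2
  by (intro tensor.intro cohomology_algebra_vspace)

lemma cohomology_finite_support:
  "a \<in> carrier (H X) \<Longrightarrow> finite {n. a n \<noteq> \<zero>\<^bsub>H X\<^esub> n}"
  by (simp add: cohomology_algebra_simps direct_sum_simps)

lemma homogeneous_part_linear:
  "a \<in> carrier (H X) \<Longrightarrow> homogeneous_part (H X) n a \<in> carrier (H X)"
  "a \<in> carrier (H X) \<Longrightarrow> a' \<in> carrier (H X) \<Longrightarrow>
    homogeneous_part (H X) n (a \<oplus>\<^bsub>H X\<^esub> a')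
      = homogeneous_part (H X) n a \<oplus>\<^bsub>H X\<^esub> homogeneous_part (H X) n a'"
  "a \<in> carrier (H X) \<Longrightarrow>
    homogeneous_part (H X) n (x \<odot>\<^bsub>H X\<^esub> a)
      = x \<odot>\<^bsub>H X\<^esub> homogeneous_part (H X) n a"
  by (auto simp: cohomology_algebra_carrier homogeneous_part_class cohomology_class_add cohomology_class_smult
      add_family smult_family degree_part_family degree_part_linear)

interpretation cg: graded_algebras "H X" "H X" for X
  by unfold_locales
    (auto intro: cohomology_mult_bilinear cohomology_finite_support homogeneous_part_linear)

text \<open>A relation and not a function, because cocycle representatives and the presentation as a
  sum of pure tensors are both choices. The rule \<open>agree\<close> discards values off the
  simplices of \<open>X1\<close> and \<open>X2\<close>; it later lets a bicochain over
  \<open>X\<close> serve its subspaces unchanged.\<close>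

inductive represented :: "'a topology \<Rightarrow> 'a topology \<Rightarrow> ('a, 'k::field) cohom_tensor \<Rightarrow> ('a, 'k) bicochain \<Rightarrow> bool"
  for X1 X2 where
  zero: "represented X1 X2 \<zero>\<^bsub>HH X1 X2\<^esub> (\<lambda>p q \<sigma> \<tau>. 0)"
| add: "represented X1 X2 t \<Theta> \<Longrightarrow> \<phi> \<in> cocycle_families X1 \<Longrightarrow> \<psi> \<in> cocycle_families X2 \<Longrightarrow>
    represented X1 X2
      (t \<oplus>\<^bsub>HH X1 X2\<^esub>
        HH_pure X1 X2 (cohomology_class X1 \<phi>) (cohomology_class X2 \<psi>))
      (\<lambda>p q \<sigma> \<tau>. \<Theta> p q \<sigma> \<tau> + cross \<phi> \<psi> p q \<sigma> \<tau>)"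
| agree: "represented X1 X2 t \<Theta> \<Longrightarrow>
    (\<And>p q \<sigma> \<tau>. singular_simplex p X1 \<sigma> \<Longrightarrow> singular_simplex q X2 \<tau> \<Longrightarrow> \<Theta> p q \<sigma> \<tau> = \<Theta>' p q \<sigma> \<tau>) \<Longrightarrow>
    represented X1 X2 t \<Theta>'"

lemma represented_closed:
  "represented X1 X2 t \<Theta> \<Longrightarrow> t \<in> carrier (HH X1 X2)"
  by (induction rule: represented.induct) auto

lemma represented_plus:
  assumes "represented X1 X2 t' \<Theta>'" "represented X1 X2 t \<Theta>"
  shows "represented X1 X2 (t \<oplus>\<^bsub>HH X1 X2\<^esub> t')
    (\<lambda>p q \<sigma> \<tau>. \<Theta> p q \<sigma> \<tau> + \<Theta>' p q \<sigma> \<tau>)"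
  using assms(1)
proof (induction rule: represented.induct)
  case zero
  then show ?case using assms(2) represented_closed[OF assms(2)] by simp
next
  case (add t' \<Theta>' \<phi> \<psi>)
  show ?case
    using represented.add[OF add.IH add.hyps(2,3)] represented_closed[OF assms(2)] represented_closed[OF add.hyps(1)] add.hyps(2,3)
    by (simp add: ct.T.a_assoc add.assoc)
next
  case (agree t' \<Theta>1 \<Theta>2)
  show ?case by (rule represented.agree[OF agree.IH]) (simp add: agree.hyps)
qed

lemma represented_pure:
  assumes "\<phi> \<in> cocycle_families X1" "\<psi> \<in> cocycle_families X2"
  shows "represented X1 X2 (HH_pure X1 X2 (cohomology_class X1 \<phi>) (cohomology_class X2 \<psi>)) (cross \<phi> \<psi>)"
  using represented.add[OF represented.zero assms] assms by simp

lemma represented_smult_pure: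
  assumes "\<phi> \<in> cocycle_families X1" "\<psi> \<in> cocycle_families X2"
  shows "represented X1 X2 (c \<odot>\<^bsub>HH X1 X2\<^esub>
    HH_pure X1 X2 (cohomology_class X1 \<phi>) (cohomology_class X2 \<psi>)) (\<lambda>p q \<sigma> \<tau>. c * cross \<phi> \<psi> p q \<sigma> \<tau>)"
  using represented_pure[OF smult_family[OF assms(1), of c] assms(2)] assms
  by (simp add: ct.pure_smult_left cross_def[abs_def] mult.assoc flip: cohomology_class_smult)

lemma represented_finsum:
  assumes "finite I" "\<And>i. i \<in> I \<Longrightarrow> represented X1 X2 (t i) (\<Theta> i)"
  shows "represented X1 X2 (\<Oplus>\<^bsub>HH X1 X2\<^esub>i\<in>I. t i)
    (\<lambda>p q \<sigma> \<tau>. \<Sum>i\<in>I. \<Theta> i p q \<sigma> \<tau>)"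
  using assms
proof (induction I rule: finite_induct)
  case empty
  show ?case using represented.zero[of X1 X2] by (simp add: ct.T.finsum_empty)
next
  case (insert i I)
  have "(\<Oplus>\<^bsub>HH X1 X2\<^esub>i\<in>insert i I. t i)
      = t i \<oplus>\<^bsub>HH X1 X2\<^esub>
        (\<Oplus>\<^bsub>HH X1 X2\<^esub>i\<in>I. t i)"
    using insert.hyps insert.prems[THEN represented_closed] by (intro ct.T.finsum_insert) auto
  then show ?case using represented_plus[OF insert.IH, of "t i" "\<Theta> i"] insert by simp
qed

lemma represented_exists:
  assumes "t \<in> carrier (HH X1 X2)"
  obtains \<Theta> where "represented X1 X2 t \<Theta>"
proof -
  from assms have "\<exists>\<Theta>. represented X1 X2 t \<Theta>"
  proof (induction t rule: ct.tensor_induct)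
    case zero
    then show ?case using represented.zero by blast
  next
    case (add t a b)
    then show ?case by (auto simp: cohomology_algebra_carrier intro: represented.add)
  qed
  then show ?thesis using that by blast
qed

lemma represented_cocycle:
  assumes "represented X X t \<Theta>" "singular_simplex p X \<sigma>" "singular_simplex q X \<tau>"
  shows "bicobd \<Theta> p q \<sigma> \<tau> = 0"
  using assms
proof (induction arbitrary: p q \<sigma> \<tau> rule: represented.induct)
  case zero
  then show ?case by (simp add: bicobd_def)
next
  case (add t \<Theta> \<phi> \<psi>)
  then show ?case
    by (simp add: bicobd_add bicobd_cross cocycle_familiesD(3)[OF add.hyps(2)] cocycle_familiesD(3)[OF add.hyps(3)])
next
  case (agree t \<Theta> \<Theta>')
  have "bicobd \<Theta>' p q \<sigma> \<tau> = bicobd \<Theta> p q \<sigma> \<tau>"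
    by (rule bicobd_cong[OF agree.prems]) (use agree.hyps in auto)
  then show ?case using agree by simp
qed

lemma cup_degree_part_right:
  "cup \<phi> (degree_part r \<psi>) p \<sigma>
    = (\<Sum>p'\<le>p. if p - p' = r then \<phi> p' (front_face p' \<sigma>) * \<psi> r (back_face p' r \<sigma>) else 0)"
  unfolding cup_def by (rule sum.cong) (auto simp: degree_part_def)

lemma cup_degree_part_left:
  "cup (degree_part r \<phi>) \<psi> p \<sigma>
    = (\<Sum>p'\<le>p. if p' = r then \<phi> r (front_face r \<sigma>) * \<psi> (p - r) (back_face r (p - r) \<sigma>) else 0)"
  unfolding cup_def by (rule sum.cong) (auto simp: degree_part_def)

text \<open>The product sums over the degrees \<open>q'\<close> of \<open>\<psi>\<close> and
  \<open>r\<close> of \<open>\<phi>'\<close>. In a fixed bidegree a cut at \<open>p'\<close> and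
  \<open>q''\<close> meets only \<open>r = p - p'\<close> and \<open>q' = q''\<close>, so the
  fourfold sum collapses to the double sum of \<open>bicup\<close>, with matching sign.\<close>

lemma represented_gmul:
  assumes "\<phi> \<in> cocycle_families X" "\<psi> \<in> cocycle_families X" "\<phi>' \<in> cocycle_families X" "\<psi>' \<in> cocycle_families X"
  shows "represented X X
    (cg.gmul X (cohomology_class X \<phi>) (cohomology_class X \<psi>) (cohomology_class X \<phi>') (cohomology_class X \<psi>'))
    (bicup (cross \<phi> \<psi>) (cross \<phi>' \<psi>'))"
proof -
  let ?T = "HH X X"
  define Q where "Q = {n. \<psi> n \<noteq> (\<lambda>\<sigma>. 0)}"
  define R where "R = {n. \<phi>' n \<noteq> (\<lambda>\<sigma>. 0)}"
  have fin: "finite Q" "finite R" using cocycle_familiesD(4) assms by (auto simp: Q_def R_def)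
  have eq: "cg.gmul X (cohomology_class X \<phi>) (cohomology_class X \<psi>) (cohomology_class X \<phi>') (cohomology_class X \<psi>')
      = (\<Oplus>\<^bsub>?T\<^esub>q\<in>Q. \<Oplus>\<^bsub>?T\<^esub>r\<in>R. cg.gterm X (cohomology_class X \<phi>) (cohomology_class X \<psi>) (cohomology_class X \<phi>') (cohomology_class X \<psi>') q r)"
  proof (rule cg.gmul_superset)
    show "{q. cohomology_class X \<psi> q \<noteq> \<zero>\<^bsub>H X\<^esub> q} \<subseteq> Q"
      "{r. cohomology_class X \<phi>' r \<noteq> \<zero>\<^bsub>H X\<^esub> r} \<subseteq> R"
      by (auto simp: Q_def R_def cohomology_algebra_zero cohomology_class_def)
  qed (use assms fin in auto)
  have rep: "represented X X (\<Oplus>\<^bsub>?T\<^esub>q\<in>Q. \<Oplus>\<^bsub>?T\<^esub>r\<in>R. cg.gterm X (cohomology_class X \<phi>) (cohomology_class X \<psi>) (cohomology_class X \<phi>') (cohomology_class X \<psi>') q r)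
      (\<lambda>p q \<sigma> \<tau>. \<Sum>q'\<in>Q. \<Sum>r\<in>R. (-1) ^ (q' * r) *
        cross (cup_family X \<phi> (degree_part r \<phi>')) (cup_family X (degree_part q' \<psi>) \<psi>') p q \<sigma> \<tau>)"
    using assms unfolding cg.gterm_def homogeneous_part_class
    by (intro represented_finsum fin)
      (simp add: cohomology_class_mult degree_part_family represented_smult_pure cup_family_closed)
  have agree: "(\<Sum>q'\<in>Q. \<Sum>r\<in>R. (-1) ^ (q' * r) *
        cross (cup_family X \<phi> (degree_part r \<phi>')) (cup_family X (degree_part q' \<psi>) \<psi>') p q \<sigma> \<tau>)
      = bicup (cross \<phi> \<psi>) (cross \<phi>' \<psi>') p q \<sigma> \<tau>"
    if s: "singular_simplex p X \<sigma>" "singular_simplex q X \<tau>" for p q \<sigma> \<tau>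
  proof -
    let ?u = "\<lambda>p' r. \<phi> p' (front_face p' \<sigma>) * \<phi>' r (back_face p' r \<sigma>)"
    let ?v = "\<lambda>q'. \<psi> q' (front_face q' \<tau>) * \<psi>' (q - q') (back_face q' (q - q') \<tau>)"
    have "(\<Sum>q'\<in>Q. \<Sum>r\<in>R. (-1) ^ (q' * r) *
        cross (cup_family X \<phi> (degree_part r \<phi>')) (cup_family X (degree_part q' \<psi>) \<psi>') p q \<sigma> \<tau>)
      = (\<Sum>q'\<in>Q. \<Sum>r\<in>R. \<Sum>p'\<le>p. \<Sum>q''\<le>q. if p - p' = r then if q'' = q' then (-1) ^ (q' * r) * (?u p' r * ?v q') else 0 else 0)"
    proof (rule sum.cong[OF refl], rule sum.cong[OF refl])
      fix q' r
      have "cross (cup_family X \<phi> (degree_part r \<phi>')) (cup_family X (degree_part q' \<psi>) \<psi>') p q \<sigma> \<tau>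
          = (\<Sum>p'\<le>p. if p - p' = r then ?u p' r else 0) * (\<Sum>q''\<le>q. if q'' = q' then ?v q' else 0)"
        by (simp only: cross_def cup_family_def s if_True cup_degree_part_right cup_degree_part_left)
      then show "(-1) ^ (q' * r) * cross (cup_family X \<phi> (degree_part r \<phi>')) (cup_family X (degree_part q' \<psi>) \<psi>') p q \<sigma> \<tau>
          = (\<Sum>p'\<le>p. \<Sum>q''\<le>q. if p - p' = r then if q'' = q' then (-1) ^ (q' * r) * (?u p' r * ?v q') else 0 else 0)"
        by (simp only: sum_product) (simp only: sum_distrib_left, intro sum.cong refl, simp)
    qed
    also have "\<dots> = (\<Sum>q'\<in>Q. \<Sum>p'\<le>p. \<Sum>r\<in>R. \<Sum>q''\<le>q. if p - p' = r then if q'' = q' then (-1) ^ (q' * r) * (?u p' r * ?v q') else 0 else 0)"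
      by (rule sum.cong[OF refl], rule sum.swap)
    also have "\<dots> = (\<Sum>p'\<le>p. \<Sum>q'\<in>Q. \<Sum>r\<in>R. \<Sum>q''\<le>q. if p - p' = r then if q'' = q' then (-1) ^ (q' * r) * (?u p' r * ?v q') else 0 else 0)"
      by (rule sum.swap)
    also have "\<dots> = (\<Sum>p'\<le>p. \<Sum>q'\<in>Q. \<Sum>q''\<le>q. \<Sum>r\<in>R. if p - p' = r then if q'' = q' then (-1) ^ (q' * r) * (?u p' r * ?v q') else 0 else 0)"
      by (rule sum.cong[OF refl], rule sum.cong[OF refl], rule sum.swap)
    also have "\<dots> = (\<Sum>p'\<le>p. \<Sum>q''\<le>q. \<Sum>q'\<in>Q. \<Sum>r\<in>R. if p - p' = r then if q'' = q' then (-1) ^ (q' * r) * (?u p' r * ?v q') else 0 else 0)"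
      by (rule sum.cong[OF refl], rule sum.swap)
    also have "\<dots> = (\<Sum>p'\<le>p. \<Sum>q''\<le>q. (-1) ^ (q'' * (p - p')) * (?u p' (p - p') * ?v q''))"
    proof (intro sum.cong refl)
      fix p' q''
      have "(\<Sum>q'\<in>Q. \<Sum>r\<in>R. if p - p' = r then if q'' = q' then (-1) ^ (q' * r) * (?u p' r * ?v q') else 0 else 0)
          = (if q'' \<in> Q then if p - p' \<in> R then (-1) ^ (q'' * (p - p')) * (?u p' (p - p') * ?v q'') else 0 else 0)"
        by (cases "p - p' \<in> R") (simp_all only: sum.delta'[OF fin(2)] sum.delta'[OF fin(1)] if_True if_False sum.neutral_const if_cancel)
      \<comment> \<open>Outside \<open>Q\<close> or \<open>R\<close> the corresponding cochain is
        zero, so the right-hand side vanishes there as well.\<close>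
      also have "\<dots> = (-1) ^ (q'' * (p - p')) * (?u p' (p - p') * ?v q'')"
        by (auto simp: Q_def R_def)
      finally show "(\<Sum>q'\<in>Q. \<Sum>r\<in>R. if p - p' = r then if q'' = q' then (-1) ^ (q' * r) * (?u p' r * ?v q') else 0 else 0)
        = (-1) ^ (q'' * (p - p')) * (?u p' (p - p') * ?v q'')" .
    qed
    also have "\<dots> = bicup (cross \<phi> \<psi>) (cross \<phi>' \<psi>') p q \<sigma> \<tau>"
      unfolding bicup_def cross_def by (simp add: mult_ac)
    finally show ?thesis .
  qed
  show ?thesis unfolding eq by (rule represented.agree[OF rep]) (rule agree)
qed

lemma cohom_tensor_algebra_simps:
  "carrier (cohom_tensor_algebra X) = carrier (HH X X)"
  "\<one>\<^bsub>cohom_tensor_algebra X\<^esub> = HH_pure X X \<one>\<^bsub>H X\<^esub> \<one>\<^bsub>H X\<^esub>"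
  by (simp_all add: cohom_tensor_algebra_def graded_tensor_product_def Let_def)

text \<open>Induction on the right factor comes first, for a pure left factor: the inner lift is
  visible only once \<open>a\<close> and \<open>b\<close> are fixed. Additivity on the left then
  gives the general case.\<close>

lemma represented_mult:
  assumes "represented X X t \<Theta>" "represented X X t' \<Theta>'"
  shows "represented X X (t \<otimes>\<^bsub>cohom_tensor_algebra X\<^esub> t') (bicup \<Theta> \<Theta>')"
proof -
  have pure: "represented X X (HH_pure X X (cohomology_class X \<phi>) (cohomology_class X \<psi>) \<otimes>\<^bsub>cohom_tensor_algebra X\<^esub> t') (bicup (cross \<phi> \<psi>) \<Theta>')"
    if f: "\<phi> \<in> cocycle_families X" "\<psi> \<in> cocycle_families X" for \<phi> \<psi> :: "nat \<Rightarrow> ('a, 'b) cochain"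
    using assms(2)
  proof (induction rule: represented.induct)
    case zero
    then show ?case using represented.zero[of X X] f
      unfolding cohom_tensor_algebra_def by (simp add: cg.graded_mult_pure_zero_right bicup_def)
  next
    case (add t' \<Theta>' \<phi>' \<psi>')
    have "represented X X (HH_pure X X (cohomology_class X \<phi>) (cohomology_class X \<psi>)
        \<otimes>\<^bsub>graded_tensor_product (H X) (H X)\<^esub>
        HH_pure X X (cohomology_class X \<phi>') (cohomology_class X \<psi>'))
        (bicup (cross \<phi> \<psi>) (cross \<phi>' \<psi>'))"
      using represented_gmul[OF f add.hyps(2,3)] f add.hyps(2,3) by (simp add: cg.graded_mult_pure)
    from represented_plus[OF this add.IH[unfolded cohom_tensor_algebra_def]] show ?case
      unfolding cohom_tensor_algebra_def bicup_add[abs_def]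
      using f add.hyps(2,3) represented_closed[OF add.hyps(1)] by (simp add: cg.graded_mult_pure_add_right)
  next
    case (agree t' \<Theta>1 \<Theta>2)
    show ?case
      by (rule represented.agree[OF agree.IH], rule bicup_cong) (use agree.hyps in auto)
  qed
  note t' = represented_closed[OF assms(2)]
  show ?thesis
    using assms(1)
  proof (induction rule: represented.induct)
    case zero
    then show ?case using represented.zero[of X X] t'
      unfolding cohom_tensor_algebra_def by (simp add: cg.graded_mult_zero_left bicup_def)
  next
    case (add t \<Theta> \<phi> \<psi>)
    from represented_plus[OF pure[OF add.hyps(2,3)] add.IH] show ?case
      unfolding cohom_tensor_algebra_def bicup_add[abs_def]
      using add.hyps(2,3) represented_closed[OF add.hyps(1)] t' by (simp add: cg.graded_mult_add_left)
  next
    case (agree t \<Theta>1 \<Theta>2)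
    show ?case
      by (rule represented.agree[OF agree.IH], rule bicup_cong) (use agree.hyps in auto)
  qed
qed

lemma represented_one:
  "represented X X \<one>\<^bsub>cohom_tensor_algebra X\<^esub> (cross (unit_family X) (unit_family X))"
  by (simp add: cohom_tensor_algebra_simps cohomology_algebra_one represented_pure unit_family_closed)

lemma pullback_linear:
  assumes "a \<in> carrier (H X)"
  shows "cohom_pullback (subtopology X S) id a \<in> carrier (H (subtopology X S))"
    "a' \<in> carrier (H X) \<Longrightarrow>
      cohom_pullback (subtopology X S) id (a \<oplus>\<^bsub>H X\<^esub> a')
        = cohom_pullback (subtopology X S) id a \<oplus>\<^bsub>H (subtopology X S)\<^esub> cohom_pullback (subtopology X S) id a'"
    "cohom_pullback (subtopology X S) id (x \<odot>\<^bsub>H X\<^esub> a)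
      = x \<odot>\<^bsub>H (subtopology X S)\<^esub> cohom_pullback (subtopology X S) id a"
proof -
  have r: "restrict_family (subtopology X S) (\<lambda>n \<sigma>. \<phi> n \<sigma> + \<psi> n \<sigma>)
      = (\<lambda>n \<sigma>. restrict_family (subtopology X S) \<phi> n \<sigma> + restrict_family (subtopology X S) \<psi> n \<sigma>)"
    "restrict_family (subtopology X S) (\<lambda>n \<sigma>. x * \<phi> n \<sigma>) = (\<lambda>n \<sigma>. x * restrict_family (subtopology X S) \<phi> n \<sigma>)"
    for \<phi> \<psi> :: "nat \<Rightarrow> ('a, 'b) cochain" and x
    by (auto simp: restrict_family_def fun_eq_iff)
  obtain \<phi> where a: "\<phi> \<in> cocycle_families X" "a = cohomology_class X \<phi>"
    using assms by (auto simp: cohomology_algebra_carrier)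
  show "cohom_pullback (subtopology X S) id a \<in> carrier (H (subtopology X S))"
    using a by (simp add: cohom_pullback_class restrict_family_closed)
  show "cohom_pullback (subtopology X S) id (x \<odot>\<^bsub>H X\<^esub> a)
      = x \<odot>\<^bsub>H (subtopology X S)\<^esub> cohom_pullback (subtopology X S) id a"
    using a by (simp add: cohom_pullback_class restrict_family_closed cohomology_class_smult smult_family r)
  assume "a' \<in> carrier (H X)"
  then obtain \<psi> where b: "\<psi> \<in> cocycle_families X" "a' = cohomology_class X \<psi>"
    by (auto simp: cohomology_algebra_carrier)
  show "cohom_pullback (subtopology X S) id (a \<oplus>\<^bsub>H X\<^esub> a')
      = cohom_pullback (subtopology X S) id a \<oplus>\<^bsub>H (subtopology X S)\<^esub> cohom_pullback (subtopology X S) id a'"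
    using a b by (simp add: cohom_pullback_class restrict_family_closed cohomology_class_add add_family r)
qed

text \<open>The same \<open>\<Theta>\<close> works because pulling back to a subspace only truncates
  cocycles, and \<open>represented\<close> ignores values off the subspace.\<close>

lemma represented_pullback:
  assumes "represented X X t \<Theta>"
  shows "represented (subtopology X S1) (subtopology X S2)
    (tensor_map (H (subtopology X S1)) (H (subtopology X S2))
      (cohom_pullback (subtopology X S1) id) (cohom_pullback (subtopology X S2) id) t) \<Theta>"
proof -
  let ?Y1 = "subtopology X S1" and ?Y2 = "subtopology X S2"
  let ?T = "HH ?Y1 ?Y2"
  define g1 :: "('a, 'b) cohom \<Rightarrow> ('a, 'b) cohom" where "g1 = cohom_pullback ?Y1 id"
  define g2 :: "('a, 'b) cohom \<Rightarrow> ('a, 'b) cohom" where "g2 = cohom_pullback ?Y2 id"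
  let ?f = "\<lambda>(a, b). HH_pure ?Y1 ?Y2 (g1 a) (g2 b)"
  have "bilinear_map (H X) (H X) ?T ?f"
    unfolding g1_def g2_def
    by (rule bilinear_mapI)
      (simp_all add: pullback_linear ct.pure_add_left ct.pure_add_right ct.pure_smult_left ct.pure_smult_right)
  then interpret b: bilinear "H X" "H X" ?T ?f
    by unfold_locales
  show ?thesis
    using assms unfolding tensor_map_def g1_def[symmetric] g2_def[symmetric]
  proof (induction rule: represented.induct)
    case zero
    show ?case unfolding b.tensor_lift_zero by (rule represented.zero)
  next
    case (add t \<Theta> \<phi> \<psi>)
    have "represented ?Y1 ?Y2 (tensor_lift ?T ?f t \<oplus>\<^bsub>?T\<^esub> ?f (cohomology_class X \<phi>, cohomology_class X \<psi>))
        (\<lambda>p q \<sigma> \<tau>. \<Theta> p q \<sigma> \<tau> + cross (restrict_family ?Y1 \<phi>) (restrict_family ?Y2 \<psi>) p q \<sigma> \<tau>)"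
      using represented.add[OF add.IH restrict_family_closed[OF add.hyps(2)] restrict_family_closed[OF add.hyps(3)]] add.hyps
      by (simp add: cohom_pullback_class[OF add.hyps(2), of S1, folded g1_def]
          cohom_pullback_class[OF add.hyps(3), of S2, folded g2_def])
    then have "represented ?Y1 ?Y2 (tensor_lift ?T ?f t \<oplus>\<^bsub>?T\<^esub> ?f (cohomology_class X \<phi>, cohomology_class X \<psi>))
        (\<lambda>p q \<sigma> \<tau>. \<Theta> p q \<sigma> \<tau> + cross \<phi> \<psi> p q \<sigma> \<tau>)"
      by (rule represented.agree) (simp add: cross_def restrict_family_def)
    then show ?case
      using add.hyps represented_closed[OF add.hyps(1)] by (simp add: b.tensor_lift_add b.tensor_lift_pure)
  next
    case (agree t \<Theta> \<Theta>')
    show ?case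
      by (rule represented.agree[OF agree.IH]) (use agree.hyps in \<open>auto simp: singular_simplex_subtopology\<close>)
  qed
qed

text \<open>\<open>F\<close> is a bicochain cocycle that may leave the span of products of cocycles.
  This freedom is what permits representatives vanishing on the pairs inside an open set.\<close>

definition represented_mod :: "'a topology \<Rightarrow> ('a, 'k::field) cohom_tensor \<Rightarrow> ('a, 'k) bicochain \<Rightarrow> bool"
  where "represented_mod X t F \<longleftrightarrow> (\<exists>\<Theta> G. represented X X t \<Theta> \<and>
    (\<forall>p q \<sigma> \<tau>. singular_simplex p X \<sigma> \<longrightarrow> singular_simplex q X \<tau> \<longrightarrow> F p q \<sigma> \<tau> = \<Theta> p q \<sigma> \<tau> + bicobd G p q \<sigma> \<tau>))"

lemma represented_mod_cocycle:
  assumes "represented_mod X t F" "singular_simplex p X \<sigma>" "singular_simplex q X \<tau>"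
  shows "bicobd F p q \<sigma> \<tau> = 0"
proof -
  obtain \<Theta> G where F: "represented X X t \<Theta>"
    "\<And>p q \<sigma> \<tau>. singular_simplex p X \<sigma> \<Longrightarrow> singular_simplex q X \<tau> \<Longrightarrow> F p q \<sigma> \<tau> = \<Theta> p q \<sigma> \<tau> + bicobd G p q \<sigma> \<tau>"
    using assms(1) unfolding represented_mod_def by blast
  have "bicobd F p q \<sigma> \<tau> = bicobd (\<lambda>p q \<sigma> \<tau>. \<Theta> p q \<sigma> \<tau> + bicobd G p q \<sigma> \<tau>) p q \<sigma> \<tau>"
    by (rule bicobd_cong[OF assms(2,3)]) (rule F(2))
  also have "\<dots> = 0"
    unfolding bicobd_add using represented_cocycle[OF F(1) assms(2,3)] bicobd_bicobd[OF assms(2,3), of G] by simp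
  finally show ?thesis .
qed

lemma represented_mod_mult:
  assumes "represented_mod X t F" "represented_mod X t' F'"
  shows "represented_mod X (t \<otimes>\<^bsub>cohom_tensor_algebra X\<^esub> t') (bicup F F')"
proof -
  obtain \<Theta> G where F: "represented X X t \<Theta>"
    "\<And>p q \<sigma> \<tau>. singular_simplex p X \<sigma> \<Longrightarrow> singular_simplex q X \<tau> \<Longrightarrow> F p q \<sigma> \<tau> = \<Theta> p q \<sigma> \<tau> + bicobd G p q \<sigma> \<tau>"
    using assms(1) unfolding represented_mod_def by blast
  obtain \<Theta>' G' where F': "represented X X t' \<Theta>'"
    "\<And>p q \<sigma> \<tau>. singular_simplex p X \<sigma> \<Longrightarrow> singular_simplex q X \<tau> \<Longrightarrow> F' p q \<sigma> \<tau> = \<Theta>' p q \<sigma> \<tau> + bicobd G' p q \<sigma> \<tau>"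
    using assms(2) unfolding represented_mod_def by blast
  \<comment> \<open>From \<open>F = \<Theta> + dG\<close> and \<open>F' = \<Theta>' + dG'\<close>
    the product is the product of \<open>\<Theta>\<close> and \<open>\<Theta>'\<close>, plus
    \<open>\<Theta>\<close> times \<open>dG'\<close>, plus \<open>dG\<close> times
    \<open>F'\<close>. Since \<open>\<Theta>\<close> and \<open>F'\<close> are closed, the last two
    terms are the coboundaries of the two summands of \<open>?H\<close>; \<open>bisign\<close>
    cancels the Leibniz sign.\<close>
  let ?H = "\<lambda>p q \<sigma> \<tau>. bicup (bisign \<Theta>) G' p q \<sigma> \<tau> + bicup G F' p q \<sigma> \<tau>"
  have "bicup F F' p q \<sigma> \<tau> = bicup \<Theta> \<Theta>' p q \<sigma> \<tau> + bicobd ?H p q \<sigma> \<tau>"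
    if s: "singular_simplex p X \<sigma>" "singular_simplex q X \<tau>" for p q \<sigma> \<tau>
  proof -
    have 0: "bicup K (bicobd F') p q \<sigma> \<tau> = bicup K (\<lambda>p q \<sigma> \<tau>. 0) p q \<sigma> \<tau>" for K
      by (rule bicup_cong[OF s]) (use represented_mod_cocycle[OF assms(2)] in auto)
    have 1: "bicup (bicobd (bisign \<Theta>)) K p q \<sigma> \<tau> = bicup (\<lambda>p q \<sigma> \<tau>. 0) K p q \<sigma> \<tau>" for K
      by (rule bicup_cong[OF s]) (use represented_cocycle[OF F(1)] in \<open>auto simp: bicobd_bisign bisign_def\<close>)
    have 2: "bisign (bisign \<Theta>) = \<Theta>"
      by (intro ext) (simp add: bisign_def flip: mult.assoc power_add mult_2)
    have "bicup F F' p q \<sigma> \<tau> = bicup (\<lambda>p q \<sigma> \<tau>. \<Theta> p q \<sigma> \<tau> + bicobd G p q \<sigma> \<tau>) F' p q \<sigma> \<tau>"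
      by (rule bicup_cong[OF s]) (use F in auto)
    also have "\<dots> = bicup \<Theta> F' p q \<sigma> \<tau> + bicup (bicobd G) F' p q \<sigma> \<tau>" by (rule bicup_add)
    also have "bicup \<Theta> F' p q \<sigma> \<tau> = bicup \<Theta> (\<lambda>p q \<sigma> \<tau>. \<Theta>' p q \<sigma> \<tau> + bicobd G' p q \<sigma> \<tau>) p q \<sigma> \<tau>"
      by (rule bicup_cong[OF s]) (use F' in auto)
    also have "\<dots> = bicup \<Theta> \<Theta>' p q \<sigma> \<tau> + bicup \<Theta> (bicobd G') p q \<sigma> \<tau>" by (rule bicup_add)
    finally show ?thesis
      by (simp add: bicobd_add bicobd_bicup 0 1 2)
  qed
  then show ?thesis
    using represented_mult[OF F(1) F'(1)] unfolding represented_mod_def by blast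
qed

section \<open>Detection by cycles\<close>

interpretation poly_mapping_pair: vector_space_pair
  "scale :: 'k::field \<Rightarrow> ('s \<Rightarrow>\<^sub>0 'k) \<Rightarrow> _" "scale :: 'k::field \<Rightarrow> ('t \<Rightarrow>\<^sub>0 'k) \<Rightarrow> _"
  by (intro vector_space_pair.intro poly_mapping_vector_space)

text \<open>Chains carry coefficients in the field here, so that linear algebra applies to them;
  integral chains are paired by \<open>ceval\<close>.\<close>

definition keval :: "('s \<Rightarrow> 'k::field) \<Rightarrow> ('s \<Rightarrow>\<^sub>0 'k) \<Rightarrow> 'k"
  where "keval \<phi> z = (\<Sum>\<sigma>\<in>keys z. lookup z \<sigma> * \<phi> \<sigma>)"

lemma keval_superset:
  "finite K \<Longrightarrow> keys z \<subseteq> K \<Longrightarrow> keval \<phi> z = (\<Sum>\<sigma>\<in>K. lookup z \<sigma> * \<phi> \<sigma>)"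
  unfolding keval_def by (rule sum.mono_neutral_left) (auto simp: in_keys_iff)

lemma keval_add: "keval \<phi> (z + w) = keval \<phi> z + keval \<phi> w"
proof -
  let ?K = "keys z \<union> keys w"
  show ?thesis
    using keys_add[of z w] by (simp add: keval_superset[of ?K] lookup_add algebra_simps sum.distrib)
qed

lemma keval_scale: "keval \<phi> (scale c z) = c * keval \<phi> z"
  using keys_map_times[of c z]
  by (simp add: keval_superset[of "keys z"] sum_distrib_left mult.assoc)

lemma keval_zero [simp]: "keval \<phi> 0 = 0"
  by (simp add: keval_def)

lemma keval_diff: "keval \<phi> (z - w) = keval \<phi> z - keval \<phi> w"
  using keval_add[of \<phi> "z - w" w] by simp

lemma keval_single [simp]: "keval \<phi> (single \<sigma> c) = c * \<phi> \<sigma>"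
  by (simp add: keval_superset[of "{\<sigma>}"])

lemma keval_sum: "keval \<phi> (\<Sum>i\<in>I. z i) = (\<Sum>i\<in>I. keval \<phi> (z i))"
  by (induction I rule: infinite_finite_induct) (simp_all add: keval_add)

lemma keval_cong: "(\<And>\<sigma>. \<sigma> \<in> keys z \<Longrightarrow> \<phi> \<sigma> = \<psi> \<sigma>) \<Longrightarrow> keval \<phi> z = keval \<psi> z"
  by (simp add: keval_def)

lemma keval_fun_add: "keval (\<lambda>\<sigma>. \<phi> \<sigma> + \<psi> \<sigma>) z = keval \<phi> z + keval \<psi> z"
  by (simp add: keval_def sum.distrib distrib_left)

lemma keval_fun_diff: "keval (\<lambda>\<sigma>. \<phi> \<sigma> - \<psi> \<sigma>) z = keval \<phi> z - keval \<psi> z"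
  by (simp add: keval_def sum_subtractf right_diff_distrib)

lemma keval_fun_mult: "keval (\<lambda>\<sigma>. c * \<phi> \<sigma>) z = c * keval \<phi> z"
  by (simp add: keval_def sum_distrib_left mult.left_commute)

lemma keval_fun_mult_right: "keval (\<lambda>\<sigma>. \<phi> \<sigma> * c) z = keval \<phi> z * c"
  by (simp add: keval_def sum_distrib_right mult.assoc)

lemma keval_fun_zero [simp]: "keval (\<lambda>\<sigma>. 0) z = 0"
  by (simp add: keval_def)

lemma keval_fun_sum: "keval (\<lambda>\<sigma>. \<Sum>i\<in>I. \<phi> i \<sigma>) z = (\<Sum>i\<in>I. keval (\<phi> i) z)"
  by (induction I rule: infinite_finite_induct) (simp_all add: keval_fun_add)

lemma keval_fun_sum_list: "keval (\<lambda>\<sigma>. \<Sum>x\<leftarrow>xs. \<phi> x \<sigma>) z = (\<Sum>x\<leftarrow>xs. keval (\<phi> x) z)"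
  by (induction xs) (simp_all add: keval_fun_add)

definition poly_extend :: "('s \<Rightarrow> 't \<Rightarrow>\<^sub>0 'k::field) \<Rightarrow> ('s \<Rightarrow>\<^sub>0 'k) \<Rightarrow> 't \<Rightarrow>\<^sub>0 'k"
  where "poly_extend b z = (\<Sum>\<sigma>\<in>keys z. scale (lookup z \<sigma>) (b \<sigma>))"

lemma poly_extend_superset:
  "finite K \<Longrightarrow> keys z \<subseteq> K \<Longrightarrow>
    poly_extend b z = (\<Sum>\<sigma>\<in>K. scale (lookup z \<sigma>) (b \<sigma>))"
  unfolding poly_extend_def by (rule sum.mono_neutral_left) (auto simp: in_keys_iff)

lemma keval_poly_extend: "keval \<phi> (poly_extend b z) = keval (\<lambda>\<sigma>. keval \<phi> (b \<sigma>)) z"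
  by (simp add: poly_extend_def keval_sum keval_scale) (simp add: keval_def)

lemma linear_poly_extend:
  "Vector_Spaces.linear (scale :: 'k::field \<Rightarrow> _) scale
     (poly_extend (b :: 's \<Rightarrow> 't \<Rightarrow>\<^sub>0 'k))"
  unfolding Vector_Spaces.linear_iff
proof (intro conjI allI poly_mapping_vector_space)
  fix z w :: "'s \<Rightarrow>\<^sub>0 'k" and c
  let ?K = "keys z \<union> keys w"
  show "poly_extend b (z + w) = poly_extend b z + poly_extend b w"
    using keys_add[of z w]
    by (simp add: poly_extend_superset[of ?K] lookup_add poly_mapping.scale_left_distrib sum.distrib)
  show "poly_extend b (scale c z) = scale c (poly_extend b z)"
    using keys_map_times[of c z]
    by (simp add: poly_extend_superset[of "keys z"] poly_mapping.scale_sum_right)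
qed

text \<open>A chain is a cycle iff all coboundaries vanish on it, which spares a boundary operator with
  coefficients in the field.\<close>

definition kcycle :: "nat \<Rightarrow> 'a topology \<Rightarrow> ('a simplex \<Rightarrow>\<^sub>0 'k::field) \<Rightarrow> bool"
  where "kcycle n Y z \<longleftrightarrow> keys z \<subseteq> singular_simplex_set n Y \<and> (\<forall>f. keval (cobd f n) z = 0)"

text \<open>Over a field the boundary operator splits over its image. A functional that vanishes on
  cycles factors through the boundary, and composing it with the splitting gives the
  primitive.\<close>

lemma coboundaries_if_zero_on_cycles:
  fixes \<phi> :: "('a, 'k::field) cochain"
  assumes supp: "\<And>\<sigma>. \<not> singular_simplex n Y \<sigma> \<Longrightarrow> \<phi> \<sigma> = 0"
    and zero: "\<And>z. kcycle n Y z \<Longrightarrow> keval \<phi> z = 0"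
  shows "\<phi> \<in> coboundaries n Y"
proof -
  let ?b = "\<lambda>\<sigma>. (\<Sum>i\<le>n. single (singular_face n i \<sigma>) ((-1) ^ i)) :: 'a simplex \<Rightarrow>\<^sub>0 'k"
  \<comment> \<open>In degree \<open>0\<close> the boundary is the zero map, in accordance with
    \<open>cobd f 0 = 0\<close>.\<close>
  let ?bd = "poly_extend (if n = 0 then \<lambda>_. 0 else ?b)"
  let ?V = "{z :: 'a simplex \<Rightarrow>\<^sub>0 'k. keys z \<subseteq> singular_simplex_set n Y}"
  have bd: "keval (f (n - 1)) (?bd z) = keval (cobd f n) z" for f z
    unfolding keval_poly_extend
    by (rule keval_cong) (cases n; simp add: keval_sum cobd_Suc del: sum.atMost_Suc)
  have V: "poly_mapping.subspace ?V"
  proof (rule poly_mapping.subspaceI)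
    fix x y :: "'a simplex \<Rightarrow>\<^sub>0 'k" and c
    assume x: "x \<in> ?V"
    then show "scale c x \<in> ?V" using keys_map_times[of c x] by auto
    assume "y \<in> ?V"
    then show "x + y \<in> ?V" using x keys_add[of x y] by auto
  qed auto
  have lbd: "Vector_Spaces.linear scale scale ?bd"
    by (rule linear_poly_extend)
  \<comment> \<open>The splitting: a linear choice of a chain in \<open>Y\<close> for each boundary.
    Linear extension from the image to all chains uses that the coefficients form a field.\<close>
  obtain g where g: "range g \<subseteq> ?V" "Vector_Spaces.linear scale scale g"
    "\<And>v. v \<in> ?bd ` ?V \<Longrightarrow> ?bd (g v) = v"
    using poly_mapping_pair.linear_exists_right_inverse_on[OF lbd V] by blast
  interpret bd: Vector_Spaces.linear scale scale ?bd by (rule lbd)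
  interpret g: Vector_Spaces.linear scale scale g by (rule g)
  define \<psi> where "\<psi> \<rho> = keval \<phi> (g (single \<rho> 1))" for \<rho>
  have \<psi>: "keval \<psi> u = keval \<phi> (g u)" for u
  proof -
    have "g u = g (\<Sum>\<rho>\<in>keys u. scale (lookup u \<rho>) (single \<rho> 1))"
      by (simp add: map_times_single sum_single_lookup)
    also have "\<dots> = (\<Sum>\<rho>\<in>keys u. scale (lookup u \<rho>) (g (single \<rho> 1)))"
      by (simp only: g.sum g.scale)
    finally show ?thesis by (simp add: keval_sum keval_scale \<psi>_def) (simp add: keval_def \<psi>_def)
  qed
  have "\<phi> \<sigma> = cobd (\<lambda>_. \<psi>) n \<sigma>" if s: "singular_simplex n Y \<sigma>" for \<sigma>
  proof -
    let ?s = "single \<sigma> (1::'k)"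
    have sV: "?s \<in> ?V" using s by simp
    have gs: "g (?bd ?s) \<in> ?V" using g(1) by blast
    \<comment> \<open>A simplex and the chosen chain with the same boundary differ by a cycle, on
      which \<open>\<phi>\<close> vanishes.\<close>
    have "?bd (g (?bd ?s) - ?s) = 0" using g(3)[of "?bd ?s"] sV by (simp add: bd.diff)
    then have "keval (cobd f n) (g (?bd ?s) - ?s) = 0" for f using bd[of f "g (?bd ?s) - ?s"] by simp
    then have "kcycle n Y (g (?bd ?s) - ?s)"
      using poly_mapping.subspace_diff[OF V gs sV] by (simp add: kcycle_def)
    from zero[OF this] have "\<phi> \<sigma> = keval \<phi> (g (?bd ?s))" by (simp add: keval_diff)
    also have "\<dots> = keval \<psi> (?bd ?s)" by (simp add: \<psi>)
    also have "\<dots> = cobd (\<lambda>_. \<psi>) n \<sigma>" using bd[of "\<lambda>_. \<psi>" ?s] by simp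
    finally show ?thesis .
  qed
  then show ?thesis unfolding coboundaries_iff using supp by blast
qed

lemma cohomology_class_zero_if_zero_on_cycles:
  assumes "\<phi> \<in> cocycle_families Y" "\<And>n z. kcycle n Y z \<Longrightarrow> keval (\<phi> n) z = 0"
  shows "cohomology_class Y \<phi> = \<zero>\<^bsub>H Y\<^esub>"
  unfolding cohomology_algebra_zero cohomology_class_eq_iff[OF assms(1) zero_family]
  using coboundaries_if_zero_on_cycles[OF cocycle_familiesD(2)[OF assms(1)] assms(2)] by simp

definition tensor_sum where
  "tensor_sum Y1 Y2 xs = foldr (\<lambda>(\<phi>, \<psi>) t. t \<oplus>\<^bsub>HH Y1 Y2\<^esub>
     HH_pure Y1 Y2 (cohomology_class Y1 \<phi>) (cohomology_class Y2 \<psi>)) xs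
     \<zero>\<^bsub>HH Y1 Y2\<^esub>"

lemma tensor_sum_closed:
  "set xs \<subseteq> cocycle_families Y1 \<times> cocycle_families Y2 \<Longrightarrow>
    tensor_sum Y1 Y2 xs \<in> carrier (HH Y1 Y2)"
  by (induction xs) (auto simp: tensor_sum_def)

lemma sum_list_family:
  "(\<And>\<phi> \<psi>. (\<phi>, \<psi>) \<in> set xs \<Longrightarrow> \<psi> \<in> cocycle_families Y) \<Longrightarrow>
    (\<lambda>n \<tau>. \<Sum>(\<phi>, \<psi>)\<leftarrow>xs. d \<phi> * \<psi> n \<tau>) \<in> cocycle_families Y"
proof (induction xs)
  case (Cons x xs)
  then show ?case by (cases x) (auto intro!: add_family smult_family)
qed simp

lemma diff_family:
  assumes "\<phi> \<in> cocycle_families X" "\<psi> \<in> cocycle_families X"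
  shows "(\<lambda>n \<sigma>. \<phi> n \<sigma> - c * \<psi> n \<sigma>) \<in> cocycle_families X"
  using add_family[OF assms(1) smult_family[OF assms(2), of "- c"]] by simp

text \<open>Subtracting multiples \<open>d \<phi>'\<close> of a fixed \<open>\<phi>\<close> from the
  left factors is compensated by one pure tensor with left factor \<open>\<phi>\<close>, by
  bilinearity.\<close>

lemma tensor_sum_shift:
  assumes "\<phi> \<in> cocycle_families Y1" "set xs \<subseteq> cocycle_families Y1 \<times> cocycle_families Y2"
  shows "tensor_sum Y1 Y2 (map (\<lambda>(\<phi>', \<psi>'). (\<lambda>n \<sigma>. \<phi>' n \<sigma> + (- d \<phi>') * \<phi> n \<sigma>, \<psi>')) xs)
      \<oplus>\<^bsub>HH Y1 Y2\<^esub>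
      HH_pure Y1 Y2 (cohomology_class Y1 \<phi>)
        (cohomology_class Y2 (\<lambda>n \<tau>. \<Sum>(\<phi>', \<psi>')\<leftarrow>xs. d \<phi>' * \<psi>' n \<tau>))
    = tensor_sum Y1 Y2 xs"
  using assms(2)
proof (induction xs)
  case Nil
  then show ?case using assms(1) by (simp add: tensor_sum_def flip: cohomology_algebra_zero)
next
  case (Cons x xs)
  let ?T = "HH Y1 Y2"
  let ?P = "\<lambda>\<phi> \<psi>. HH_pure Y1 Y2 (cohomology_class Y1 \<phi>) (cohomology_class Y2 \<psi>)"
  obtain \<phi>' \<psi>' where x: "x = (\<phi>', \<psi>')" by (cases x)
  have f: "\<phi>' \<in> cocycle_families Y1" "\<psi>' \<in> cocycle_families Y2" and xs: "set xs \<subseteq> cocycle_families Y1 \<times> cocycle_families Y2"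
    using Cons.prems x by auto
  let ?c = "\<lambda>n \<tau>. \<Sum>(\<phi>', \<psi>')\<leftarrow>xs. d \<phi>' * \<psi>' n \<tau>"
  let ?m = "map (\<lambda>(\<phi>', \<psi>'). (\<lambda>n \<sigma>. \<phi>' n \<sigma> + (- d \<phi>') * \<phi> n \<sigma>, \<psi>')) xs"
  have c: "?c \<in> cocycle_families Y2" by (rule sum_list_family) (use xs in auto)
  have m: "tensor_sum Y1 Y2 ?m \<in> carrier ?T"
    by (rule tensor_sum_closed) (use xs assms(1) in \<open>auto intro!: diff_family\<close>)
  have 1: "?P (\<lambda>n \<sigma>. \<phi>' n \<sigma> + (- d \<phi>') * \<phi> n \<sigma>) \<psi>' = ?P \<phi>' \<psi>' \<oplus>\<^bsub>?T\<^esub> (- d \<phi>') \<odot>\<^bsub>?T\<^esub> ?P \<phi> \<psi>'"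
    unfolding cohomology_class_add[OF f(1) smult_family[OF assms(1)], symmetric] cohomology_class_smult[OF assms(1), symmetric]
    using f assms(1) by (simp add: ct.pure_add_left ct.pure_smult_left)
  have 2: "?P \<phi> (\<lambda>n \<tau>. d \<phi>' * \<psi>' n \<tau> + ?c n \<tau>) = d \<phi>' \<odot>\<^bsub>?T\<^esub> ?P \<phi> \<psi>' \<oplus>\<^bsub>?T\<^esub> ?P \<phi> ?c"
    using f assms(1) c by (simp add: cohomology_class_add[symmetric] cohomology_class_smult[symmetric] smult_family
        ct.pure_add_right ct.pure_smult_right)
  have 3: "(- d \<phi>') \<odot>\<^bsub>?T\<^esub> ?P \<phi> \<psi>' \<oplus>\<^bsub>?T\<^esub> (d \<phi>' \<odot>\<^bsub>?T\<^esub> ?P \<phi> \<psi>' \<oplus>\<^bsub>?T\<^esub> ?P \<phi> ?c) = ?P \<phi> ?c"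
    using f assms(1) c ct.T.smult_add_left[of "?P \<phi> \<psi>'" Y1 Y2 "- d \<phi>'" "d \<phi>'"]
    by (simp flip: ct.T.a_assoc)
  have "tensor_sum Y1 Y2 (map (\<lambda>(\<phi>', \<psi>'). (\<lambda>n \<sigma>. \<phi>' n \<sigma> + (- d \<phi>') * \<phi> n \<sigma>, \<psi>')) (x # xs))
      \<oplus>\<^bsub>?T\<^esub> ?P \<phi> (\<lambda>n \<tau>. \<Sum>(\<phi>', \<psi>')\<leftarrow>x # xs. d \<phi>' * \<psi>' n \<tau>)
    = (tensor_sum Y1 Y2 ?m \<oplus>\<^bsub>?T\<^esub> (?P \<phi>' \<psi>' \<oplus>\<^bsub>?T\<^esub> (- d \<phi>') \<odot>\<^bsub>?T\<^esub> ?P \<phi> \<psi>'))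
      \<oplus>\<^bsub>?T\<^esub> (d \<phi>' \<odot>\<^bsub>?T\<^esub> ?P \<phi> \<psi>' \<oplus>\<^bsub>?T\<^esub> ?P \<phi> ?c)"
    unfolding 1[symmetric] 2[symmetric] by (simp add: x tensor_sum_def)
  also have "\<dots> = tensor_sum Y1 Y2 ?m \<oplus>\<^bsub>?T\<^esub> (?P \<phi>' \<psi>' \<oplus>\<^bsub>?T\<^esub> ?P \<phi> ?c)"
    using m f assms(1) c by (simp add: ct.T.a_assoc 3)
  also have "\<dots> = (tensor_sum Y1 Y2 ?m \<oplus>\<^bsub>?T\<^esub> ?P \<phi> ?c) \<oplus>\<^bsub>?T\<^esub> ?P \<phi>' \<psi>'"
    using m f assms(1) c by (simp add: ct.T.a_assoc ct.T.a_comm[of "?P \<phi>' \<psi>'"])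
  also have "\<dots> = tensor_sum Y1 Y2 (x # xs)"
    unfolding Cons.IH[OF xs] by (simp add: x tensor_sum_def)
  finally show ?case .
qed

text \<open>Induction on the length of \<open>\<Sum>\<^sub>i x\<^sub>i \<otimes> y\<^sub>i\<close>: a cycle \<open>z\<close> with \<open>x\<^sub>1(z) \<noteq> 0\<close> exhibits \<open>y\<^sub>1\<close> as a linear combination of
  the other \<open>y\<^sub>i\<close>, and \<open>tensor_sum_shift\<close> then removes one summand.\<close>

lemma tensor_sum_zero_if_zero_on_cycles:
  fixes Y1 Y2 :: "'a topology" and xs :: "((nat \<Rightarrow> ('a, 'k::field) cochain) \<times> (nat \<Rightarrow> ('a, 'k) cochain)) list"
  assumes "set xs \<subseteq> cocycle_families Y1 \<times> cocycle_families Y2"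
    "\<And>p q z w. kcycle p Y1 z \<Longrightarrow> kcycle q Y2 w \<Longrightarrow> (\<Sum>(\<phi>, \<psi>)\<leftarrow>xs. keval (\<phi> p) z * keval (\<psi> q) w) = 0"
  shows "tensor_sum Y1 Y2 xs = \<zero>\<^bsub>HH Y1 Y2\<^esub>"
  using assms
proof (induction "length xs" arbitrary: xs)
  case 0
  then show ?case by (simp add: tensor_sum_def)
next
  case (Suc n)
  let ?T = "HH Y1 Y2"
  let ?P = "\<lambda>\<phi> \<psi>. HH_pure Y1 Y2 (cohomology_class Y1 \<phi>) (cohomology_class Y2 \<psi>)"
  obtain \<phi> \<psi> ys where xs: "xs = (\<phi>, \<psi>) # ys" "length ys = n"
    using Suc.hyps(2) by (cases xs) auto
  have f: "\<phi> \<in> cocycle_families Y1" "\<psi> \<in> cocycle_families Y2" and ys: "set ys \<subseteq> cocycle_families Y1 \<times> cocycle_families Y2"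
    using Suc.prems(1) xs by auto
  have zero: "keval (\<phi> p) z * keval (\<psi> q) w + (\<Sum>(\<phi>, \<psi>)\<leftarrow>ys. keval (\<phi> p) z * keval (\<psi> q) w) = 0"
    if "kcycle p Y1 z" "kcycle q Y2 w" for p q z w
    using Suc.prems(2)[OF that] by (simp add: xs)
  have t: "tensor_sum Y1 Y2 xs = tensor_sum Y1 Y2 ys \<oplus>\<^bsub>?T\<^esub> ?P \<phi> \<psi>"
    by (simp add: xs tensor_sum_def)
  show ?case
  proof (cases "\<forall>p z. kcycle p Y1 z \<longrightarrow> keval (\<phi> p) z = 0")
    case True
    then have "tensor_sum Y1 Y2 ys = \<zero>\<^bsub>?T\<^esub>"
      using zero by (intro Suc.hyps(1)) (auto simp: xs ys subsetD[OF ys])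
    moreover have "cohomology_class Y1 \<phi> = \<zero>\<^bsub>H Y1\<^esub>"
      using cohomology_class_zero_if_zero_on_cycles[OF f(1)] True by blast
    ultimately show ?thesis using f by (simp add: t)
  next
    case False
    then obtain p0 z0 where z0: "kcycle p0 Y1 z0" "keval (\<phi> p0) z0 \<noteq> 0" by blast
    define d where "d \<phi>' = keval (\<phi>' p0) z0 / keval (\<phi> p0) z0" for \<phi>' :: "nat \<Rightarrow> ('a, 'k) cochain"
    let ?c = "\<lambda>n \<tau>. \<Sum>(\<phi>', \<psi>')\<leftarrow>ys. d \<phi>' * \<psi>' n \<tau>"
    let ?m = "map (\<lambda>(\<phi>', \<psi>'). (\<lambda>n \<sigma>. \<phi>' n \<sigma> + (- d \<phi>') * \<phi> n \<sigma>, \<psi>')) ys"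
    have c: "?c \<in> cocycle_families Y2" by (rule sum_list_family) (use ys in auto)
    have kc: "keval (?c q) w = (\<Sum>(\<phi>', \<psi>')\<leftarrow>ys. d \<phi>' * keval (\<psi>' q) w)" for q w
      using keval_fun_sum_list[of "\<lambda>x \<tau>. case x of (\<phi>', \<psi>') \<Rightarrow> d \<phi>' * \<psi>' q \<tau>" ys w]
      by (simp add: case_prod_unfold keval_fun_mult)
    have cw: "keval (?c q) w = - keval (\<psi> q) w" if "kcycle q Y2 w" for q w
    proof -
      have "keval (\<phi> p0) z0 * keval (?c q) w = (\<Sum>(\<phi>', \<psi>')\<leftarrow>ys. keval (\<phi>' p0) z0 * keval (\<psi>' q) w)"
        using z0(2) unfolding kc by (simp add: d_def case_prod_unfold flip: sum_list_const_mult)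
      then have "keval (\<phi> p0) z0 * (keval (\<psi> q) w + keval (?c q) w) = 0"
        using zero[OF z0(1) that] by (simp add: distrib_left)
      then show ?thesis using z0(2) by (simp add: eq_neg_iff_add_eq_0 add.commute)
    qed
    have 0: "cohomology_class Y2 (\<lambda>n \<tau>. ?c n \<tau> + \<psi> n \<tau>) = \<zero>\<^bsub>H Y2\<^esub>"
      by (rule cohomology_class_zero_if_zero_on_cycles) (use add_family[OF c f(2)] cw in \<open>simp_all add: keval_fun_add\<close>)
    have m: "set ?m \<subseteq> cocycle_families Y1 \<times> cocycle_families Y2"
      using ys f(1) by (auto intro!: diff_family)
    \<comment> \<open>The shifted list is one entry shorter than \<open>xs\<close> and still pairs
      to zero with all cycles: on a cycle \<open>?c\<close> takes the value of
      \<open>- \<psi>\<close>, so the correction restores the removed summand.\<close>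
    have "tensor_sum Y1 Y2 ?m = \<zero>\<^bsub>?T\<^esub>"
    proof (rule Suc.hyps(1)[OF _ m])
      fix p q and z w :: "'a simplex \<Rightarrow>\<^sub>0 'k"
      assume zw: "kcycle p Y1 z" "kcycle q Y2 w"
      have "(\<Sum>(\<phi>, \<psi>)\<leftarrow>?m. keval (\<phi> p) z * keval (\<psi> q) w)
          = (\<Sum>(\<phi>', \<psi>')\<leftarrow>ys. keval (\<phi>' p) z * keval (\<psi>' q) w) - keval (\<phi> p) z * keval (?c q) w"
        unfolding kc
        by (induction ys) (auto simp: keval_fun_add keval_fun_mult keval_fun_diff algebra_simps)
      also have "\<dots> = 0" using zero[OF zw] cw[OF zw(2)] by (simp add: add.commute)
      finally show "(\<Sum>(\<phi>, \<psi>)\<leftarrow>?m. keval (\<phi> p) z * keval (\<psi> q) w) = 0" .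
    qed (simp add: xs)
    then have "tensor_sum Y1 Y2 ys = ?P \<phi> ?c"
      using tensor_sum_shift[OF f(1) ys, of d] f(1) c by simp
    then have "tensor_sum Y1 Y2 xs = ?P \<phi> (\<lambda>n \<tau>. ?c n \<tau> + \<psi> n \<tau>)"
      using f c by (simp add: t ct.pure_add_right cohomology_class_add[symmetric])
    also have "\<dots> = \<zero>\<^bsub>?T\<^esub>" unfolding 0 using f by simp
    finally show ?thesis .
  qed
qed

lemma represented_tensor_sum:
  assumes "represented Y1 Y2 t \<Theta>"
  obtains xs where "set xs \<subseteq> cocycle_families Y1 \<times> cocycle_families Y2" "t = tensor_sum Y1 Y2 xs"
    "\<And>p q \<sigma> \<tau>. singular_simplex p Y1 \<sigma> \<Longrightarrow> singular_simplex q Y2 \<tau> \<Longrightarrow> \<Theta> p q \<sigma> \<tau> = (\<Sum>(\<phi>, \<psi>)\<leftarrow>xs. \<phi> p \<sigma> * \<psi> q \<tau>)"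
proof -
  from assms have "\<exists>xs. set xs \<subseteq> cocycle_families Y1 \<times> cocycle_families Y2 \<and> t = tensor_sum Y1 Y2 xs \<and>
    (\<forall>p q \<sigma> \<tau>. singular_simplex p Y1 \<sigma> \<longrightarrow> singular_simplex q Y2 \<tau> \<longrightarrow> \<Theta> p q \<sigma> \<tau> = (\<Sum>(\<phi>, \<psi>)\<leftarrow>xs. \<phi> p \<sigma> * \<psi> q \<tau>))"
  proof (induction rule: represented.induct)
    case zero
    show ?case by (rule exI[of _ "[]"]) (simp add: tensor_sum_def)
  next
    case (add t \<Theta> \<phi> \<psi>)
    then obtain xs where "set xs \<subseteq> cocycle_families Y1 \<times> cocycle_families Y2" "t = tensor_sum Y1 Y2 xs"
      "\<forall>p q \<sigma> \<tau>. singular_simplex p Y1 \<sigma> \<longrightarrow> singular_simplex q Y2 \<tau> \<longrightarrow> \<Theta> p q \<sigma> \<tau> = (\<Sum>(\<phi>, \<psi>)\<leftarrow>xs. \<phi> p \<sigma> * \<psi> q \<tau>)"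
      by blast
    then show ?case using add.hyps(2,3)
      by (intro exI[of _ "(\<phi>, \<psi>) # xs"]) (simp add: tensor_sum_def cross_def add.commute)
  next
    case (agree t \<Theta> \<Theta>')
    then obtain xs where "set xs \<subseteq> cocycle_families Y1 \<times> cocycle_families Y2" "t = tensor_sum Y1 Y2 xs"
      "\<forall>p q \<sigma> \<tau>. singular_simplex p Y1 \<sigma> \<longrightarrow> singular_simplex q Y2 \<tau> \<longrightarrow> \<Theta> p q \<sigma> \<tau> = (\<Sum>(\<phi>, \<psi>)\<leftarrow>xs. \<phi> p \<sigma> * \<psi> q \<tau>)"
      by blast
    then show ?case using agree.hyps(2) by (intro exI[of _ xs]) simp
  qed
  then show ?thesis using that by blast
qed

lemma represented_zero_if_zero_on_cycles:
  fixes \<Theta> :: "('a, 'k::field) bicochain"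
  assumes "represented Y1 Y2 t \<Theta>"
    and zero: "\<And>p q (z :: _ \<Rightarrow>\<^sub>0 'k) (w :: _ \<Rightarrow>\<^sub>0 'k).
      kcycle p Y1 z \<Longrightarrow> kcycle q Y2 w \<Longrightarrow> keval (\<lambda>\<sigma>. keval (\<Theta> p q \<sigma>) w) z = 0"
  shows "t = \<zero>\<^bsub>HH Y1 Y2\<^esub>"
proof -
  obtain xs where xs: "set xs \<subseteq> cocycle_families Y1 \<times> cocycle_families Y2" "t = tensor_sum Y1 Y2 xs"
    "\<And>p q \<sigma> \<tau>. singular_simplex p Y1 \<sigma> \<Longrightarrow> singular_simplex q Y2 \<tau> \<Longrightarrow> \<Theta> p q \<sigma> \<tau> = (\<Sum>(\<phi>, \<psi>)\<leftarrow>xs. \<phi> p \<sigma> * \<psi> q \<tau>)"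
    using represented_tensor_sum[OF assms(1)] by blast
  show ?thesis unfolding xs(2)
  proof (rule tensor_sum_zero_if_zero_on_cycles[OF xs(1)])
    fix p q and z w :: "'a simplex \<Rightarrow>\<^sub>0 'k"
    assume zw: "kcycle p Y1 z" "kcycle q Y2 w"
    have "0 = keval (\<lambda>\<sigma>. keval (\<lambda>\<tau>. \<Sum>(\<phi>, \<psi>)\<leftarrow>xs. \<phi> p \<sigma> * \<psi> q \<tau>) w) z"
      unfolding zero[OF zw, symmetric]
      by (intro keval_cong xs(3)) (use zw in \<open>auto simp: kcycle_def\<close>)
    also have "\<dots> = keval (\<lambda>\<sigma>. \<Sum>(\<phi>, \<psi>)\<leftarrow>xs. \<phi> p \<sigma> * keval (\<psi> q) w) z"
      using keval_fun_sum_list[of "\<lambda>x \<tau>. fst x p _ * snd x q \<tau>" xs w]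
      by (simp add: case_prod_unfold keval_fun_mult)
    also have "\<dots> = (\<Sum>(\<phi>, \<psi>)\<leftarrow>xs. keval (\<phi> p) z * keval (\<psi> q) w)"
      using keval_fun_sum_list[of "\<lambda>x \<sigma>. fst x p \<sigma> * keval (snd x q) w" xs z]
      by (simp add: case_prod_unfold keval_fun_mult_right)
    finally show "(\<Sum>(\<phi>, \<psi>)\<leftarrow>xs. keval (\<phi> p) z * keval (\<psi> q) w) = 0" by simp
  qed
qed

section \<open>Joins of simplices along a section\<close>

lemma path_space_continuous:
  assumes "\<gamma> \<in> topspace (path_space X)"
  shows "continuous_map (top_of_set {0..1}) X \<gamma>"
  using assms by (auto simp: path_space_def compact_open_topology_def)

text \<open>The exponential law for the locally compact interval: near \<open>t\<close> a path stays
  in \<open>V\<close> on a compact neighbourhood \<open>?K\<close> of \<open>t\<close>, and all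
  paths sending \<open>?K\<close> into \<open>V\<close> form a subbasic open set.\<close>

lemma continuous_map_path_evaluation:
  assumes s: "continuous_map Z (path_space X) s"
  shows "continuous_map (prod_topology Z (top_of_set {0..1})) X (\<lambda>(u, t). s u t)"
  unfolding continuous_map_def
proof (intro conjI allI impI)
  let ?I = "top_of_set {0..1::real}"
  have path: "continuous_map ?I X (s u)" if "u \<in> topspace Z" for u
    using continuous_map_image_subset_topspace[OF s] that path_space_continuous by blast
  show "(\<lambda>(u, t). s u t) \<in> topspace (prod_topology Z ?I) \<rightarrow> topspace X"
    using path continuous_map_image_subset_topspace by fastforce
  fix V assume V: "openin X V"
  let ?P = "{x \<in> topspace (prod_topology Z ?I). (case x of (u, t) \<Rightarrow> s u t) \<in> V}"
  show "openin (prod_topology Z ?I) ?P"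
    unfolding openin_prod_topology_alt
  proof (intro allI impI)
    fix u t assume "(u, t) \<in> ?P"
    then have u: "u \<in> topspace Z" and t: "t \<in> {0..1}" and tV: "s u t \<in> V" by auto
    have "openin ?I {t \<in> {0..1}. s u t \<in> V}"
      using openin_continuous_map_preimage[OF path[OF u] V] by simp
    then obtain e where e: "e > 0" "\<And>t'. t' \<in> {0..1} \<Longrightarrow> dist t' t < e \<Longrightarrow> s u t' \<in> V"
      using t tV unfolding openin_euclidean_subtopology_iff by blast
    \<comment> \<open>Half the radius, so that the closed ball still lies in the open ball of radius
      \<open>e\<close>.\<close>
    let ?K = "{0..1} \<inter> cball t (e / 2)"
    let ?S = "{\<gamma>. continuous_map ?I X \<gamma> \<and> \<gamma> \<in> extensional (topspace ?I) \<and> \<gamma> ` ?K \<subseteq> V}"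
    have "compactin ?I ?K" by (simp add: compactin_subtopology compact_Int_closed)
    then have "openin (path_space X) ?S"
      unfolding path_space_def compact_open_topology_def using V
      by (intro topology_generated_by_Basis) blast
    then have 1: "openin Z {u \<in> topspace Z. s u \<in> ?S}" by (rule openin_continuous_map_preimage[OF s])
    have 2: "openin ?I ({0..1} \<inter> ball t (e / 2))" by (simp add: openin_open_Int)
    have "s u \<in> topspace (path_space X)" using continuous_map_image_subset_topspace[OF s] u by blast
    then have ext: "s u \<in> extensional (topspace ?I)" by (auto simp: path_space_def compact_open_topology_def)
    have "s u ` ?K \<subseteq> V"
      using e by (auto simp: dist_commute intro!: e(2))
    then have 3: "u \<in> {u \<in> topspace Z. s u \<in> ?S}" using u path ext by simp
    have "{u \<in> topspace Z. s u \<in> ?S} \<times> ({0..1} \<inter> ball t (e / 2)) \<subseteq> ?P"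
      using ball_subset_cball[of t "e / 2"] by auto
    then show "\<exists>U W. openin Z U \<and> openin ?I W \<and> u \<in> U \<and> t \<in> W \<and> U \<times> W \<subseteq> ?P"
      using 1 2 3 t e(1) by (intro exI[of _ "{u \<in> topspace Z. s u \<in> ?S}"] exI[of _ "{0..1} \<inter> ball t (e / 2)"]) auto
  qed
qed

section \<open>Coordinates on the join of two simplices\<close>

abbreviation simplex_top :: "nat \<Rightarrow> (nat \<Rightarrow> real) topology"
  where "simplex_top p \<equiv> subtopology (powertop_real UNIV) (standard_simplex p)"

definition join_point :: "nat \<Rightarrow> (nat \<Rightarrow> real) \<Rightarrow> (nat \<Rightarrow> real) \<Rightarrow> real \<Rightarrow> nat \<Rightarrow> real"
  where "join_point p u v t = (\<lambda>i. if i \<le> p then (1 - t) * u i else t * v (i - Suc p))"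

lemma sum_join_split:
  fixes f :: "nat \<Rightarrow> 'b::comm_monoid_add"
  shows "sum f {..Suc (p + q)} = sum f {..p} + (\<Sum>i\<le>q. f (Suc p + i))"
proof -
  have "{..Suc (p + q)} = {..p} \<union> {Suc p..Suc (p + q)}" by auto
  then have "sum f {..Suc (p + q)} = sum f {..p} + sum f {Suc p..Suc (p + q)}"
    by (simp only:) (rule sum.union_disjoint, auto)
  also have "sum f {Suc p..Suc (p + q)} = (\<Sum>i\<le>q. f (Suc p + i))"
    by (rule sum.reindex_bij_witness[of _ "\<lambda>i. Suc p + i" "\<lambda>i. i - Suc p"]) auto
  finally show ?thesis .
qed

lemma standard_simplexI:
  assumes "\<And>i. x i \<ge> 0" "\<And>i. i > p \<Longrightarrow> x i = 0" "sum x {..p} = 1"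
  shows "x \<in> standard_simplex p"
proof -
  have "x i \<le> 1" for i
  proof (cases "i \<le> p")
    case True
    then have "x i \<le> sum x {..p}" using assms(1) by (intro member_le_sum) auto
    then show ?thesis using assms(3) by simp
  qed (use assms(2) in auto)
  then show ?thesis using assms by (auto simp: standard_simplex_def)
qed

lemma standard_simplexD:
  assumes "x \<in> standard_simplex p"
  shows "x i \<ge> 0" "i > p \<Longrightarrow> x i = 0" "sum x {..p} = 1"
  using assms by (auto simp: standard_simplex_def)

lemma join_point_mem:
  assumes "u \<in> standard_simplex p" "v \<in> standard_simplex q" "t \<in> {0..1}"
  shows "join_point p u v t \<in> standard_simplex (Suc (p + q))"
proof (rule standard_simplexI)
  show "join_point p u v t i \<ge> 0" for i
    using assms standard_simplexD(1) by (auto simp: join_point_def)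
  show "join_point p u v t i = 0" if "i > Suc (p + q)" for i
    using that standard_simplexD(2)[OF assms(2), of "i - Suc p"] by (auto simp: join_point_def)
  have "sum (join_point p u v t) {..Suc (p + q)} = (\<Sum>i\<le>p. (1 - t) * u i) + (\<Sum>i\<le>q. t * v i)"
    unfolding sum_join_split by (simp add: join_point_def)
  then show "sum (join_point p u v t) {..Suc (p + q)} = 1"
    using standard_simplexD(3)[OF assms(1)] standard_simplexD(3)[OF assms(2)] by (simp flip: sum_distrib_left)
qed

text \<open>At the ends \<open>t = 1\<close> and \<open>t = 0\<close> one of the two points is lost;
  the vertex \<open>e\<close> then serves as an arbitrary choice for it.\<close>

lemma join_point_surj:
  assumes x: "x \<in> standard_simplex (Suc (p + q))"
  obtains u v t where "u \<in> standard_simplex p" "v \<in> standard_simplex q" "t \<in> {0..1}" "x = join_point p u v t"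
proof -
  define e :: "nat \<Rightarrow> real" where "e = (\<lambda>i. if i = 0 then 1 else 0)"
  have e: "e \<in> standard_simplex n" for n unfolding e_def by simp
  define t where "t = (\<Sum>i\<le>q. x (Suc p + i))"
  have sum: "sum x {..p} = 1 - t" using standard_simplexD(3)[OF x] unfolding sum_join_split t_def by simp
  note x0 = standard_simplexD(1)[OF x]
  have t0: "t \<ge> 0" unfolding t_def by (intro sum_nonneg x0)
  have t1: "t \<le> 1" using sum sum_nonneg[of "{..p}" x] x0 by simp
  define u where "u = (if t = 1 then e else (\<lambda>i. if i \<le> p then x i / (1 - t) else 0))"
  define v where "v = (if t = 0 then e else (\<lambda>i. x (Suc p + i) / t))"
  have u: "u \<in> standard_simplex p"
  proof (cases "t = 1")
    case False
    show ?thesis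
      using False t1 x0 sum by (intro standard_simplexI) (auto simp: u_def simp flip: sum_divide_distrib)
  qed (simp add: u_def e)
  have v: "v \<in> standard_simplex q"
  proof (cases "t = 0")
    case False
    show ?thesis
      using False t0 x0 standard_simplexD(2)[OF x] t_def
      by (intro standard_simplexI) (auto simp: v_def simp flip: sum_divide_distrib)
  qed (simp add: v_def e)
  have "x i = join_point p u v t i" for i
  proof (cases "i \<le> p")
    case True
    have "x i = 0" if "t = 1" using that sum x0 sum_nonneg_0[of "{..p}" x i] True by simp
    then show ?thesis using True by (auto simp: join_point_def u_def)
  next
    case False
    have "x i = 0" if "t = 0"
    proof (cases "i \<le> Suc (p + q)")
      case True
      then show ?thesis using sum_nonneg_0[of "{..q}" "\<lambda>i. x (Suc p + i)" "i - Suc p"] that x0 False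
        by (simp add: t_def)
    next
      case False
      then show ?thesis using standard_simplexD(2)[OF x] by simp
    qed
    then show ?thesis using False by (auto simp: join_point_def v_def)
  qed
  then show ?thesis using that[OF u v] t0 t1 by auto
qed

text \<open>A continuous surjection from a compact to a Hausdorff space. Continuity on the join can
  thus be tested in join coordinates, which settles the ends \<open>t = 0\<close> and
  \<open>t = 1\<close>, where the explicit inverse formula divides by zero.\<close>

lemma join_point_quotient_map:
  "quotient_map (prod_topology (prod_topology (simplex_top p) (simplex_top q)) (top_of_set {0..1}))
     (simplex_top (Suc (p + q))) (\<lambda>((u, v), t). join_point p u v t)"
proof (rule continuous_imp_quotient_map)
  let ?D = "prod_topology (prod_topology (simplex_top p) (simplex_top q)) (top_of_set {0..1::real})"
  have "compact_space (top_of_set {0..1::real})" by (rule compact_space_subtopology) simp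
  then show "compact_space ?D"
    by (simp add: compact_space_prod_topology compact_space_subtopology compactin_standard_simplex)
  show "Hausdorff_space (simplex_top (Suc (p + q)))"
    by (intro Hausdorff_space_subtopology) (simp add: Hausdorff_space_product_topology)
  have proj: "continuous_map (simplex_top n) euclideanreal (\<lambda>x. x i)" for n i
    by (rule continuous_map_from_subtopology) (rule continuous_map_product_projection, simp)
  have cu: "continuous_map ?D euclideanreal (\<lambda>x. fst (fst x) i)" for i
  proof -
    have "continuous_map ?D (simplex_top p) (fst \<circ> fst)"
      by (intro continuous_map_compose[of _ "prod_topology (simplex_top p) (simplex_top q)"] continuous_map_fst)
    from continuous_map_compose[OF this proj] show ?thesis by (simp add: o_def)
  qed
  have cv: "continuous_map ?D euclideanreal (\<lambda>x. snd (fst x) i)" for i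
  proof -
    have "continuous_map ?D (simplex_top q) (snd \<circ> fst)"
      by (intro continuous_map_compose[of _ "prod_topology (simplex_top p) (simplex_top q)"] continuous_map_fst continuous_map_snd)
    from continuous_map_compose[OF this proj] show ?thesis by (simp add: o_def)
  qed
  have ct: "continuous_map ?D euclideanreal snd"
    using continuous_map_snd[of "prod_topology (simplex_top p) (simplex_top q)" "top_of_set {0..1::real}"]
    by (simp add: continuous_map_in_subtopology)
  show "continuous_map ?D (simplex_top (Suc (p + q))) (\<lambda>((u, v), t). join_point p u v t)"
    unfolding continuous_map_in_subtopology continuous_map_componentwise_UNIV
  proof (intro conjI allI)
    show "continuous_map ?D euclideanreal (\<lambda>x. (case x of (x, t) \<Rightarrow> (case x of (u, v) \<Rightarrow> join_point p u v) t) k)" for k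
      unfolding case_prod_unfold join_point_def
      by (cases "k \<le> p") (simp_all add: continuous_map_real_mult continuous_map_diff cu cv ct)
    show "(\<lambda>((u, v), t). join_point p u v t) \<in> topspace ?D \<rightarrow> standard_simplex (Suc (p + q))"
      using join_point_mem by auto
  qed
  show "(\<lambda>((u, v), t). join_point p u v t) ` topspace ?D = topspace (simplex_top (Suc (p + q)))"
  proof (intro equalityI subsetI)
    fix x assume "x \<in> topspace (simplex_top (Suc (p + q)))"
    then have "x \<in> standard_simplex (Suc (p + q))" by simp
    then obtain u v t where "u \<in> standard_simplex p" "v \<in> standard_simplex q" "t \<in> {0..1}" "x = join_point p u v t"
      by (rule join_point_surj)
    then show "x \<in> (\<lambda>((u, v), t). join_point p u v t) ` topspace ?D"
      by (intro image_eqI[of _ _ "((u, v), t)"]) auto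
  qed (use join_point_mem in auto)
qed

text \<open>The map with value \<open>s (\<sigma> u, \<tau> v) t\<close> at the point with join
  coordinates \<open>u\<close>, \<open>v\<close>, \<open>t\<close>. It descends to the join because
  at \<open>t = 0\<close> it forgets \<open>v\<close> and at \<open>t = 1\<close> it forgets
  \<open>u\<close>, the paths starting at \<open>\<sigma> u\<close> and ending at
  \<open>\<tau> v\<close>.\<close>

definition join_simplex ::
    "nat \<Rightarrow> nat \<Rightarrow> ('a \<times> 'a \<Rightarrow> real \<Rightarrow> 'a) \<Rightarrow> 'a simplex \<Rightarrow> 'a simplex \<Rightarrow> (nat \<Rightarrow> real) \<Rightarrow> 'a"
  where "join_simplex p q s \<sigma> \<tau> = restrict (\<lambda>x. let t = \<Sum>i\<le>q. x (Suc p + i) in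
    if t = 0 then \<sigma> x else if t = 1 then \<tau> (\<lambda>i. x (Suc p + i))
    else s (\<sigma> (\<lambda>i. if i \<le> p then x i / (1 - t) else 0), \<tau> (\<lambda>i. x (Suc p + i) / t)) t) (standard_simplex (Suc (p + q)))"

locale section_on =
  fixes X :: "'a topology" and U :: "('a \<times> 'a) set" and s :: "'a \<times> 'a \<Rightarrow> real \<Rightarrow> 'a"
  assumes s_continuous: "continuous_map (subtopology (prod_topology X X) U) (path_space X) s"
    and s_ends: "\<And>x y. (x, y) \<in> U \<Longrightarrow> s (x, y) 0 = x" "\<And>x y. (x, y) \<in> U \<Longrightarrow> s (x, y) 1 = y"
begin

text \<open>Depends on \<open>X\<close> and \<open>U\<close> only, so that pairs inside one set of
  the cover can be discussed before a section on it is fixed.\<close>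

definition small :: "nat \<Rightarrow> nat \<Rightarrow> 'a simplex \<Rightarrow> 'a simplex \<Rightarrow> bool"
  where "small p q \<sigma> \<tau> \<longleftrightarrow> singular_simplex p X \<sigma> \<and> singular_simplex q X \<tau> \<and>
    \<sigma> ` standard_simplex p \<times> \<tau> ` standard_simplex q \<subseteq> U"

lemma join_simplex_join_point:
  assumes "small p q \<sigma> \<tau>" "u \<in> standard_simplex p" "v \<in> standard_simplex q" "t \<in> {0..1}"
  shows "join_simplex p q s \<sigma> \<tau> (join_point p u v t) = s (\<sigma> u, \<tau> v) t"
proof -
  let ?x = "join_point p u v t"
  have U: "(\<sigma> u, \<tau> v) \<in> U" using assms by (auto simp: small_def)
  have t: "(\<Sum>i\<le>q. ?x (Suc p + i)) = t"
    using standard_simplexD(3)[OF assms(3)] by (simp add: join_point_def flip: sum_distrib_left)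
  have x0: "?x = u" if "t = 0"
    using that standard_simplexD(2)[OF assms(2)] by (auto simp: join_point_def fun_eq_iff)
  have x1: "(\<lambda>i. ?x (Suc p + i)) = (\<lambda>i. t * v i)" by (auto simp: join_point_def)
  have x2: "(\<lambda>i. if i \<le> p then ?x i / (1 - t) else 0) = u" if "t \<noteq> 1"
    using that standard_simplexD(2)[OF assms(2)] by (auto simp: join_point_def fun_eq_iff)
  have x3: "(\<lambda>i. ?x (Suc p + i) / t) = v" if "t \<noteq> 0"
    using that by (auto simp: join_point_def fun_eq_iff)
  show ?thesis
    using join_point_mem[OF assms(2-4)] s_ends[OF U] x0 x1 x2 x3
    unfolding join_simplex_def Let_def restrict_def t by auto
qed

lemma join_simplex_singular:
  assumes sm: "small p q \<sigma> \<tau>"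
  shows "singular_simplex (Suc (p + q)) X (join_simplex p q s \<sigma> \<tau>)"
proof -
  let ?D = "prod_topology (prod_topology (simplex_top p) (simplex_top q)) (top_of_set {0..1::real})"
  let ?E = "\<lambda>((u, v), t). s (\<sigma> u, \<tau> v) t"
  have st: "continuous_map (prod_topology (simplex_top p) (simplex_top q)) (subtopology (prod_topology X X) U) (\<lambda>(u, v). (\<sigma> u, \<tau> v))"
    using sm unfolding continuous_map_in_subtopology continuous_map_prod_top small_def singular_simplex_def by auto
  have "continuous_map ?D (prod_topology (subtopology (prod_topology X X) U) (top_of_set {0..1::real}))
      (\<lambda>(w, t). ((\<lambda>(u, v). (\<sigma> u, \<tau> v)) w, id t))"
    unfolding continuous_map_prod_top using st by simp
  from continuous_map_compose[OF this continuous_map_path_evaluation[OF s_continuous]]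
  have E: "continuous_map ?D X ?E" by (simp add: o_def case_prod_unfold)
  have "continuous_map ?D X (join_simplex p q s \<sigma> \<tau> \<circ> (\<lambda>((u, v), t). join_point p u v t))"
    by (rule continuous_map_eq[OF E]) (auto simp: join_simplex_join_point[OF sm])
  then show ?thesis
    unfolding continuous_compose_quotient_map_eq[OF join_point_quotient_map] singular_simplex_def
    by (simp add: join_simplex_def)
qed

lemma join_simplex_eqI:
  assumes "f \<in> extensional (standard_simplex (Suc (p + q)))" "g \<in> extensional (standard_simplex (Suc (p + q)))"
    "\<And>u v t. u \<in> standard_simplex p \<Longrightarrow> v \<in> standard_simplex q \<Longrightarrow> t \<in> {0..1} \<Longrightarrow>
      f (join_point p u v t) = g (join_point p u v t)"
  shows "f = g"
  by (rule extensionalityI[OF assms(1,2)]) (metis join_point_surj assms(3))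

lemma small_faces:
  assumes "small p q \<sigma> \<tau>"
  shows "p = Suc p' \<Longrightarrow> i \<le> p \<Longrightarrow> small p' q (singular_face p i \<sigma>) \<tau>"
    "q = Suc q' \<Longrightarrow> i \<le> q \<Longrightarrow> small p q' \<sigma> (singular_face q i \<tau>)"
proof -
  show "small p' q (singular_face p i \<sigma>) \<tau>" if "p = Suc p'" "i \<le> p"
    using assms singular_simplex_singular_face[of p X \<sigma> i] simplical_face_in_standard_simplex[of p i] that
    by (fastforce simp: small_def singular_face_def)
  show "small p q' \<sigma> (singular_face q i \<tau>)" if "q = Suc q'" "i \<le> q"
    using assms singular_simplex_singular_face[of q X \<tau> i] simplical_face_in_standard_simplex[of q i] that
    by (fastforce simp: small_def singular_face_def)
qed

lemma small_front_back:
  assumes "small p q \<sigma> \<tau>" "p' \<le> p" "q' \<le> q"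
  shows "small p' q' (front_face p' \<sigma>) (front_face q' \<tau>)"
    "small (p - p') (q - q') (back_face p' (p - p') \<sigma>) (back_face q' (q - q') \<tau>)"
proof -
  have f: "front_face r \<rho> ` standard_simplex r \<subseteq> \<rho> ` standard_simplex n" if "r \<le> n"
    for r n and \<rho> :: "(nat \<Rightarrow> real) \<Rightarrow> 'a"
    using standard_simplex_mono[OF that] by (auto simp: front_face_def)
  show "small p' q' (front_face p' \<sigma>) (front_face q' \<tau>)"
    using assms singular_simplex_front_face[of p X \<sigma> p'] singular_simplex_front_face[of q X \<tau> q']
      Sigma_mono[OF f[OF assms(2), of \<sigma>] f[OF assms(3), of \<tau>]]
    unfolding small_def by blast
  have b: "back_face r (n - r) \<rho> ` standard_simplex (n - r) \<subseteq> \<rho> ` standard_simplex n" if "r \<le> n"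
    for r n and \<rho> :: "(nat \<Rightarrow> real) \<Rightarrow> 'a"
    using back_vertex_mem[of _ "n - r" r] that by (auto simp: back_face_def)
  show "small (p - p') (q - q') (back_face p' (p - p') \<sigma>) (back_face q' (q - q') \<tau>)"
    using assms singular_simplex_back_face[of p' "p - p'" X \<sigma>] singular_simplex_back_face[of q' "q - q'" X \<tau>]
      Sigma_mono[OF b[OF assms(2), of \<sigma>] b[OF assms(3), of \<tau>]]
    by (simp add: small_def) (metis subset_trans)
qed

text \<open>On a small pair \<open>bicup\<close> sees only small pairs. Hence a product vanishes on
  small pairs as soon as one factor does, which is the property that replaces products of relative
  classes.\<close>

lemma bicup_cong_small:
  assumes "small p q \<sigma> \<tau>"
    "\<And>p q \<sigma> \<tau>. small p q \<sigma> \<tau> \<Longrightarrow> F p q \<sigma> \<tau> = F' p q \<sigma> \<tau>" "\<And>p q \<sigma> \<tau>. small p q \<sigma> \<tau> \<Longrightarrow> G p q \<sigma> \<tau> = G' p q \<sigma> \<tau>"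
  shows "bicup F G p q \<sigma> \<tau> = bicup F' G' p q \<sigma> \<tau>"
  unfolding bicup_def using small_front_back[OF assms(1)]
  by (intro sum.cong refl arg_cong2[of _ _ _ _ "(*)"] assms(2,3)) auto

text \<open>Omitting one of the first vertices of a join omits it from \<open>\<sigma>\<close>,
  provided that \<open>\<sigma>\<close> keeps a vertex; \<open>join_face_right\<close> is the
  analogue for \<open>\<tau>\<close>. Both are checked in join coordinates.\<close>

lemma join_face_left:
  assumes sm: "small (Suc p) q \<sigma> \<tau>" "i \<le> Suc p"
  shows "singular_face (Suc (Suc p + q)) i (join_simplex (Suc p) q s \<sigma> \<tau>)
    = join_simplex p q s (singular_face (Suc p) i \<sigma>) \<tau>"
proof (rule join_simplex_eqI[of _ p q])
  fix u v and t :: real assume u: "u \<in> standard_simplex p" and v: "v \<in> standard_simplex q" and t: "t \<in> {0..1}"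
  have "simplical_face i (join_point p u v t) = join_point (Suc p) (simplical_face i u) v t"
    using assms(2) by (auto simp: join_point_def simplical_face_def fun_eq_iff)
  moreover have "simplical_face i u \<in> standard_simplex (Suc p)"
    using u assms(2) by (intro simplical_face_in_standard_simplex) auto
  ultimately show "singular_face (Suc (Suc p + q)) i (join_simplex (Suc p) q s \<sigma> \<tau>) (join_point p u v t)
      = join_simplex p q s (singular_face (Suc p) i \<sigma>) \<tau> (join_point p u v t)"
    unfolding join_simplex_join_point[OF small_faces(1)[OF sm(1) refl assms(2)] u v t]
    using join_point_mem[OF u v t] u v t by (simp add: singular_face_def join_simplex_join_point[OF sm(1)])
qed (auto simp: singular_face_def join_simplex_def)

lemma join_face_right:
  assumes sm: "small p (Suc q) \<sigma> \<tau>" "i \<le> Suc q"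
  shows "singular_face (Suc (p + Suc q)) (Suc p + i) (join_simplex p (Suc q) s \<sigma> \<tau>)
    = join_simplex p q s \<sigma> (singular_face (Suc q) i \<tau>)"
proof (rule join_simplex_eqI[of _ p q])
  fix u v and t :: real assume u: "u \<in> standard_simplex p" and v: "v \<in> standard_simplex q" and t: "t \<in> {0..1}"
  have "simplical_face (Suc p + i) (join_point p u v t) = join_point p u (simplical_face i v) t"
  proof
    fix k
    show "simplical_face (Suc p + i) (join_point p u v t) k = join_point p u (simplical_face i v) t k"
      using assms(2) by (auto simp: join_point_def simplical_face_def)
  qed
  moreover have "simplical_face i v \<in> standard_simplex (Suc q)"
    using v assms(2) by (intro simplical_face_in_standard_simplex) auto
  ultimately show "singular_face (Suc (p + Suc q)) (Suc p + i) (join_simplex p (Suc q) s \<sigma> \<tau>) (join_point p u v t)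
      = join_simplex p q s \<sigma> (singular_face (Suc q) i \<tau>) (join_point p u v t)"
    unfolding join_simplex_join_point[OF small_faces(2)[OF sm(1) refl assms(2)] u v t]
    using join_point_mem[OF u v t] u v t by (simp add: singular_face_def join_simplex_join_point[OF sm(1)])
qed (auto simp: singular_face_def join_simplex_def)

text \<open>When \<open>\<sigma>\<close> is a point, removing it leaves the end \<open>t = 1\<close>
  of the join, where every path has arrived in \<open>\<tau>\<close>. This case and its mirror image
  \<open>join_face_last\<close> produce the two boundary terms of the homotopy.\<close>

lemma join_face_first:
  assumes sm: "small 0 q \<sigma> \<tau>"
  shows "singular_face (Suc (0 + q)) 0 (join_simplex 0 q s \<sigma> \<tau>) = \<tau>"
proof (rule extensionalityI[of _ "standard_simplex q"])
  fix x assume x: "x \<in> standard_simplex q"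
  let ?e = "\<lambda>j::nat. if j = 0 then 1 else 0 :: real"
  have e: "?e \<in> standard_simplex 0" by simp
  have "simplical_face 0 x = join_point 0 ?e x 1" by (auto simp: join_point_def simplical_face_def fun_eq_iff)
  moreover have "(\<sigma> ?e, \<tau> x) \<in> U" using sm e x by (auto simp: small_def)
  ultimately show "singular_face (Suc (0 + q)) 0 (join_simplex 0 q s \<sigma> \<tau>) x = \<tau> x"
    using join_simplex_join_point[OF sm e x, of 1] x by (simp add: singular_face_def s_ends)
qed (use sm in \<open>auto simp: singular_face_def small_def singular_simplex_def\<close>)

lemma join_face_last:
  assumes sm: "small p 0 \<sigma> \<tau>"
  shows "singular_face (Suc (p + 0)) (Suc p) (join_simplex p 0 s \<sigma> \<tau>) = \<sigma>"
proof (rule extensionalityI[of _ "standard_simplex p"])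
  fix x assume x: "x \<in> standard_simplex p"
  let ?e = "\<lambda>j::nat. if j = 0 then 1 else 0 :: real"
  have e: "?e \<in> standard_simplex 0" by simp
  have "simplical_face (Suc p) x = join_point p x ?e 0"
    using standard_simplexD(2)[OF x] by (auto simp: join_point_def simplical_face_def fun_eq_iff)
  moreover have "(\<sigma> x, \<tau> ?e) \<in> U" using sm e x by (auto simp: small_def)
  ultimately show "singular_face (Suc (p + 0)) (Suc p) (join_simplex p 0 s \<sigma> \<tau>) x = \<sigma> x"
    using join_simplex_join_point[OF sm x e, of 0] x by (simp add: singular_face_def s_ends)
qed (use sm in \<open>auto simp: singular_face_def small_def singular_simplex_def\<close>)

end

text \<open>The bicochain of \<open>f \<otimes> 1\<close>: the unit cochain is constantly
  \<open>1\<close> in degree \<open>0\<close>, so the second simplex matters only through its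
  degree. Similarly \<open>second_variable\<close> stands for \<open>1 \<otimes> g\<close>.\<close>

definition first_variable :: "(nat \<Rightarrow> 'a simplex \<Rightarrow> 'k::field) \<Rightarrow> ('a, 'k) bicochain"
  where "first_variable f p q \<sigma> \<tau> = (if q = 0 then f p \<sigma> else 0)"

definition second_variable :: "(nat \<Rightarrow> 'a simplex \<Rightarrow> 'k::field) \<Rightarrow> ('a, 'k) bicochain"
  where "second_variable g p q \<sigma> \<tau> = (if p = 0 then g q \<tau> else 0)"

text \<open>In second degree \<open>1\<close> the two faces contribute the same value with opposite
  signs, so the unit cochain is closed.\<close>

lemma bicobd_first_variable: "bicobd (first_variable f) p q \<sigma> \<tau> = first_variable (cobd f) p q \<sigma> \<tau>"
proof -
  have "cobd (\<lambda>q' \<tau>'. first_variable f p q' \<sigma> \<tau>') q \<tau> = 0"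
  proof (cases q)
    case (Suc l)
    then show ?thesis by (cases l) (simp_all add: cobd_Suc first_variable_def)
  qed simp
  moreover have "cobd (\<lambda>p' \<sigma>'. first_variable f p' q \<sigma>' \<tau>) p \<sigma> = first_variable (cobd f) p q \<sigma> \<tau>"
    by (cases "q = 0") (simp_all add: first_variable_def)
  ultimately show ?thesis by (simp add: bicobd_def)
qed

text \<open>Only the cut \<open>p' = p\<close>, \<open>q' = 0\<close> survives, and its sign
  exponent is \<open>0\<close>; this is
  \<open>(f \<otimes> 1)(1 \<otimes> g) = f \<otimes> g\<close>.\<close>

lemma bicup_first_second: "bicup (first_variable f) (second_variable g) p q \<sigma> \<tau> = f p (front_face p \<sigma>) * g q (back_face 0 q \<tau>)"
proof -
  have "bicup (first_variable f) (second_variable g) p q \<sigma> \<tau>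
      = (\<Sum>p'\<le>p. \<Sum>q'\<le>q. if q' = 0 then if p = p' then f p (front_face p \<sigma>) * g q (back_face 0 q \<tau>) else 0 else 0)"
    unfolding bicup_def by (intro sum.cong refl) (auto simp: first_variable_def second_variable_def)
  then show ?thesis by (simp add: sum.delta sum.delta')
qed

lemma bicup_first_first: "bicup (first_variable f) (first_variable g) p q \<sigma> \<tau> = first_variable (cup f g) p q \<sigma> \<tau>"
proof -
  have "bicup (first_variable f) (first_variable g) p q \<sigma> \<tau>
      = (\<Sum>p'\<le>p. \<Sum>q'\<le>q. if q' = 0 then if q = 0 then f p' (front_face p' \<sigma>) * g (p - p') (back_face p' (p - p') \<sigma>) else 0 else 0)"
    unfolding bicup_def by (intro sum.cong refl) (auto simp: first_variable_def)
  then show ?thesis by (simp add: sum.delta sum.delta' first_variable_def cup_def)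
qed

lemma front_face_self: "singular_simplex p X \<sigma> \<Longrightarrow> front_face p \<sigma> = \<sigma>"
  by (simp add: front_face_def singular_simplex_def extensional_restrict)

lemma back_face_self: "singular_simplex q X \<tau> \<Longrightarrow> back_face 0 q \<tau> = \<tau>"
  by (simp add: back_face_def singular_simplex_def extensional_restrict)

context section_on
begin

text \<open>The chain homotopy between the two projections in cochain form; \<open>(-1) ^ p\<close>
  adapts it to the sign in \<open>bicobd\<close>.\<close>

definition join_cochain :: "(nat \<Rightarrow> 'a simplex \<Rightarrow> 'k::field) \<Rightarrow> ('a, 'k) bicochain"
  where "join_cochain b p q \<sigma> \<tau> = (-1) ^ p * b (Suc (p + q)) (join_simplex p q s \<sigma> \<tau>)"

text \<open>A closed \<open>b\<close> evaluated on the boundary of the join gives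
  \<open>A = (-1) ^ p * B\<close>, where \<open>A\<close> collects the faces opposite vertices of
  \<open>\<sigma>\<close> and \<open>B\<close> those opposite vertices of \<open>\<tau>\<close>. For
  positive \<open>p\<close> and \<open>q\<close> these are the two halves of \<open>bicobd\<close>
  and cancel. If \<open>p = 0\<close> or \<open>q = 0\<close>, one half is missing and the remaining
  face is \<open>\<tau>\<close> or \<open>\<sigma>\<close> itself.\<close>

lemma bicobd_join_cochain:
  fixes b :: "nat \<Rightarrow> 'a simplex \<Rightarrow> 'k::field"
  assumes sm: "small p q \<sigma> \<tau>" and b: "\<And>n \<sigma>. singular_simplex n X \<sigma> \<Longrightarrow> cobd b n \<sigma> = 0"
  shows "bicobd (join_cochain b) p q \<sigma> \<tau> = second_variable b p q \<sigma> \<tau> - first_variable b p q \<sigma> \<tau>"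
proof -
  let ?J = "join_simplex p q s \<sigma> \<tau>"
  define A where "A = (\<Sum>i\<le>p. (-1) ^ i * b (p + q) (singular_face (Suc (p + q)) i ?J))"
  define B where "B = (\<Sum>i\<le>q. (-1) ^ i * b (p + q) (singular_face (Suc (p + q)) (Suc p + i) ?J))"
  have "0 = cobd b (Suc (p + q)) ?J" using b join_simplex_singular[OF sm] by simp
  also have "\<dots> = A + (\<Sum>i\<le>q. (-1) ^ (Suc p + i) * b (p + q) (singular_face (Suc (p + q)) (Suc p + i) ?J))"
    unfolding cobd_Suc A_def by (rule sum_join_split)
  also have "(\<Sum>i\<le>q. (-1) ^ (Suc p + i) * b (p + q) (singular_face (Suc (p + q)) (Suc p + i) ?J)) = - ((-1) ^ p * B)"
    by (simp add: B_def sum_distrib_left power_add mult.assoc sum_negf)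
  finally have AB: "A = (-1) ^ p * B" by simp
  have sq: "(-1) ^ p * ((-1) ^ p * x) = x" for x :: 'k
    by (simp flip: mult.assoc power_add mult_2)
  have 1: "cobd (\<lambda>p' \<sigma>'. join_cochain b p' q \<sigma>' \<tau>) p \<sigma> = (if p = 0 then 0 else - ((-1) ^ p * A))"
  proof (cases p)
    case (Suc p')
    have "cobd (\<lambda>p' \<sigma>'. join_cochain b p' q \<sigma>' \<tau>) p \<sigma>
        = (\<Sum>i\<le>p. (-1) ^ i * ((-1) ^ p' * b (p + q) (singular_face (Suc (p + q)) i ?J)))"
      unfolding Suc cobd_Suc join_cochain_def
      by (intro sum.cong refl) (use sm Suc in \<open>auto simp: join_face_left[of p' q \<sigma> \<tau>, unfolded add_Suc]\<close>)
    also have "\<dots> = (-1) ^ p' * A" by (simp add: A_def sum_distrib_left mult.left_commute)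
    finally show ?thesis by (simp add: Suc)
  qed simp
  have 2: "(-1) ^ p * cobd (\<lambda>q' \<tau>'. join_cochain b p q' \<sigma> \<tau>') q \<tau> = (if q = 0 then 0 else B)"
  proof (cases q)
    case (Suc q')
    have "cobd (\<lambda>q' \<tau>'. join_cochain b p q' \<sigma> \<tau>') q \<tau>
        = (\<Sum>i\<le>q. (-1) ^ i * ((-1) ^ p * b (p + q) (singular_face (Suc (p + q)) (Suc p + i) ?J)))"
      unfolding Suc cobd_Suc join_cochain_def
      by (intro sum.cong refl) (use sm Suc join_face_right[of p q' \<sigma> \<tau>] in auto)
    also have "\<dots> = (-1) ^ p * B" by (simp add: B_def sum_distrib_left mult.left_commute)
    finally show ?thesis by (simp add: Suc sq)
  qed simp
  have A0: "A = b q \<tau>" if "p = 0" using that join_face_first[of q \<sigma> \<tau>] sm by (simp add: A_def)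
  have B0: "B = b p \<sigma>" if "q = 0" using that join_face_last[of p \<sigma> \<tau>] sm by (simp add: B_def)
  show ?thesis
    unfolding bicobd_def 1 2 second_variable_def first_variable_def
    using A0 B0 AB by (cases "p = 0"; cases "q = 0") (simp_all add: sq)
qed

text \<open>On pairs of simplices in \<open>U\<close> the two projections to \<open>X\<close> are homotopic, so that
  \<open>a \<otimes> b = (a \<otimes> 1)(1 \<otimes> b)\<close> is cohomologous to \<open>(a \<otimes> 1)(b \<otimes> 1) = (a \<union> b) \<otimes> 1\<close>.\<close>

lemma represented_small:
  fixes t :: "('a, 'k::field) cohom_tensor"
  assumes "represented X X t \<Theta>"
  obtains \<xi> G where "\<xi> \<in> cocycle_families X" "cohomology_class X \<xi> = cup_map X t"
    "\<And>p q \<sigma> \<tau>. small p q \<sigma> \<tau> \<Longrightarrow> \<Theta> p q \<sigma> \<tau> = first_variable \<xi> p q \<sigma> \<tau> + bicobd G p q \<sigma> \<tau>"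
proof -
  let ?H = "H X :: ('k, ('a, 'k) cohom) module"
  interpret b: bilinear ?H ?H ?H "\<lambda>(a, b). a \<otimes>\<^bsub>?H\<^esub> b"
    by (intro bilinear.intro tensor.intro bilinear_axioms.intro cohomology_algebra_vspace cohomology_mult_bilinear)
  from assms have "\<exists>\<xi> G. \<xi> \<in> cocycle_families X \<and> cohomology_class X \<xi> = cup_map X t \<and>
    (\<forall>p q \<sigma> \<tau>. small p q \<sigma> \<tau> \<longrightarrow> \<Theta> p q \<sigma> \<tau> = first_variable \<xi> p q \<sigma> \<tau> + bicobd G p q \<sigma> \<tau>)"
  proof (induction rule: represented.induct)
    case zero
    show ?case
      by (rule exI[of _ "\<lambda>n \<sigma>. 0"], rule exI[of _ "\<lambda>p q \<sigma> \<tau>. 0"])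
        (simp add: cup_map_def first_variable_def bicobd_def flip: cohomology_algebra_zero)
  next
    case (add t \<Theta> \<phi> \<psi>)
    then obtain \<xi> G where IH: "\<xi> \<in> cocycle_families X" "cohomology_class X \<xi> = cup_map X t"
      "\<And>p q \<sigma> \<tau>. small p q \<sigma> \<tau> \<Longrightarrow> \<Theta> p q \<sigma> \<tau> = first_variable \<xi> p q \<sigma> \<tau> + bicobd G p q \<sigma> \<tau>"
      by blast
    let ?\<xi> = "\<lambda>n \<sigma>. \<xi> n \<sigma> + cup_family X \<phi> \<psi> n \<sigma>"
    \<comment> \<open>The coboundary of \<open>?K\<close> is \<open>\<phi> \<otimes> 1\<close> times
      the coboundary of the join cochain, since \<open>\<phi>\<close> is closed;
      \<open>bisign\<close> absorbs the Leibniz sign.\<close>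
    let ?K = "bicup (bisign (first_variable \<phi>)) (join_cochain \<psi>)"
    let ?G = "\<lambda>p q \<sigma> \<tau>. G p q \<sigma> \<tau> + ?K p q \<sigma> \<tau>"
    have "cross \<phi> \<psi> p q \<sigma> \<tau> = first_variable (cup_family X \<phi> \<psi>) p q \<sigma> \<tau> + bicobd ?K p q \<sigma> \<tau>"
      if sm: "small p q \<sigma> \<tau>" for p q \<sigma> \<tau>
    proof -
      have s: "singular_simplex p X \<sigma>" "singular_simplex q X \<tau>" using sm by (auto simp: small_def)
      have z: "bicup (bicobd (bisign (first_variable \<phi>))) (join_cochain \<psi>) p q \<sigma> \<tau> = bicup (\<lambda>p q \<sigma> \<tau>. 0) (join_cochain \<psi>) p q \<sigma> \<tau>"
        by (rule bicup_cong[OF s])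
          (auto simp: bicobd_bisign bisign_def bicobd_first_variable first_variable_def cocycle_familiesD(3)[OF add.hyps(2)])
      have bb: "bisign (bisign (first_variable \<phi>)) = first_variable \<phi>"
        by (intro ext) (simp add: bisign_def flip: mult.assoc power_add mult_2)
      have "cross \<phi> \<psi> p q \<sigma> \<tau> = bicup (first_variable \<phi>) (second_variable \<psi>) p q \<sigma> \<tau>"
        by (simp add: cross_def bicup_first_second front_face_self[OF s(1)] back_face_self[OF s(2)])
      also have "\<dots> = bicup (first_variable \<phi>) (\<lambda>p q \<sigma> \<tau>. first_variable \<psi> p q \<sigma> \<tau> + bicobd (join_cochain \<psi>) p q \<sigma> \<tau>) p q \<sigma> \<tau>"
        by (rule bicup_cong_small[OF sm]) (simp_all add: bicobd_join_cochain cocycle_familiesD(3)[OF add.hyps(3)])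
      also have "\<dots> = first_variable (cup \<phi> \<psi>) p q \<sigma> \<tau> + bicup (first_variable \<phi>) (bicobd (join_cochain \<psi>)) p q \<sigma> \<tau>"
        by (simp add: bicup_add bicup_first_first)
      also have "bicup (first_variable \<phi>) (bicobd (join_cochain \<psi>)) p q \<sigma> \<tau> = bicobd ?K p q \<sigma> \<tau>"
        by (simp add: bicobd_bicup z bb)
      finally show ?thesis using s by (simp add: first_variable_def cup_family_def)
    qed
    then have "\<forall>p q \<sigma> \<tau>. small p q \<sigma> \<tau> \<longrightarrow>
        \<Theta> p q \<sigma> \<tau> + cross \<phi> \<psi> p q \<sigma> \<tau> = first_variable ?\<xi> p q \<sigma> \<tau> + bicobd ?G p q \<sigma> \<tau>"
      by (simp add: IH(3) bicobd_add first_variable_def)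
    moreover have "?\<xi> \<in> cocycle_families X" by (intro add_family IH cup_family_closed add.hyps)
    moreover have "cohomology_class X ?\<xi> = cup_map X (t \<oplus>\<^bsub>tensor_product ?H ?H\<^esub>
        pure_tensor ?H ?H (cohomology_class X \<phi>) (cohomology_class X \<psi>))"
      using IH(1,2) add.hyps represented_closed[OF add.hyps(1)] unfolding cup_map_def
      by (simp add: b.tensor_lift_add b.tensor_lift_pure cohomology_class_mult cohomology_class_add[symmetric] cup_family_closed)
    ultimately show ?case by blast
  next
    case (agree t \<Theta> \<Theta>')
    then obtain \<xi> G where "\<xi> \<in> cocycle_families X" "cohomology_class X \<xi> = cup_map X t"
      "\<And>p q \<sigma> \<tau>. small p q \<sigma> \<tau> \<Longrightarrow> \<Theta> p q \<sigma> \<tau> = first_variable \<xi> p q \<sigma> \<tau> + bicobd G p q \<sigma> \<tau>"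
      by blast
    then show ?case using agree.hyps(2)
      by (intro exI[of _ \<xi>] exI[of _ G]) (simp add: small_def)
  qed
  then show ?thesis using that by blast
qed

text \<open>For \<open>t\<close> in the kernel the cocycle \<open>\<xi>\<close> is a coboundary, so
  on small pairs \<open>\<Theta>\<close> is itself a total coboundary. Its primitive is a bicochain
  defined on all pairs, and subtracting its coboundary everywhere keeps \<open>F\<close> a
  representative over the whole of \<open>X\<close>.\<close>

lemma kernel_represented_vanishing:
  fixes t :: "('a, 'k::field) cohom_tensor"
  assumes t: "t \<in> carrier (HH X X)"
    and ker: "cup_map X t = \<zero>\<^bsub>H X\<^esub>"
  obtains F where "represented_mod X t F" "\<And>p q \<sigma> \<tau>. small p q \<sigma> \<tau> \<Longrightarrow> F p q \<sigma> \<tau> = 0"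
proof -
  obtain \<Theta> where \<Theta>: "represented X X t \<Theta>" using represented_exists[OF t] by blast
  obtain \<xi> G where \<xi>: "\<xi> \<in> cocycle_families X" "cohomology_class X \<xi> = cup_map X t"
    "\<And>p q \<sigma> \<tau>. small p q \<sigma> \<tau> \<Longrightarrow> \<Theta> p q \<sigma> \<tau> = first_variable \<xi> p q \<sigma> \<tau> + bicobd G p q \<sigma> \<tau>"
    using represented_small[OF \<Theta>] by blast
  have "\<forall>n. \<exists>f. \<forall>\<sigma>. singular_simplex n X \<sigma> \<longrightarrow> \<xi> n \<sigma> = cobd f n \<sigma>"
    using cohomology_class_eq_iff[OF \<xi>(1) zero_family] \<xi>(2) ker
    by (simp add: cohomology_algebra_zero coboundaries_iff)
  then obtain f where f: "\<And>n \<sigma>. singular_simplex n X \<sigma> \<Longrightarrow> \<xi> n \<sigma> = cobd (f n) n \<sigma>" by metis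
  \<comment> \<open>Each degree comes with its own primitive \<open>f n\<close>, of which only the
    component in degree \<open>n - 1\<close> is used; these components are assembled into one
    family.\<close>
  define g where "g n = f (Suc n) n" for n
  have g: "\<xi> n \<sigma> = cobd g n \<sigma>" if "singular_simplex n X \<sigma>" for n \<sigma>
    using f[OF that] by (cases n) (simp_all add: cobd_Suc g_def)
  define K where "K = (\<lambda>p q \<sigma> \<tau>. - 1 * (first_variable g p q \<sigma> \<tau> + G p q \<sigma> \<tau>))"
  have K: "bicobd K p q \<sigma> \<tau> = - (bicobd (first_variable g) p q \<sigma> \<tau> + bicobd G p q \<sigma> \<tau>)" for p q \<sigma> \<tau>
    unfolding K_def bicobd_def cobd_mult cobd_add by (simp add: algebra_simps)
  define F where "F p q \<sigma> \<tau> = \<Theta> p q \<sigma> \<tau> + bicobd K p q \<sigma> \<tau>" for p q \<sigma> \<tau>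
  have "represented_mod X t F" unfolding represented_mod_def F_def using \<Theta> by blast
  moreover have "F p q \<sigma> \<tau> = 0" if "small p q \<sigma> \<tau>" for p q \<sigma> \<tau>
    using \<xi>(3)[OF that] g[of p \<sigma>] that unfolding F_def K
    by (simp add: bicobd_first_variable first_variable_def small_def)
  ultimately show ?thesis using that by blast
qed

end

section \<open>Subdivision of cycles\<close>

definition field_chain :: "('s \<Rightarrow>\<^sub>0 int) \<Rightarrow> 's \<Rightarrow>\<^sub>0 'k::field"
  where "field_chain c = Poly_Mapping.map of_int c"

lemma lookup_field_chain: "lookup (field_chain c) s = of_int (lookup c s)"
  by (simp add: field_chain_def Poly_Mapping.map.rep_eq when_def)

lemma keys_field_chain: "keys (field_chain c) \<subseteq> keys c"
  by (auto simp: in_keys_iff lookup_field_chain)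

lemma keval_field_chain: "keval f (field_chain c) = ceval f c"
  unfolding ceval_def keval_superset[OF finite_keys keys_field_chain] by (simp add: lookup_field_chain)

definition iterated_subdivision :: "nat \<Rightarrow> nat \<Rightarrow> 'a simplex \<Rightarrow> 'a chain"
  where "iterated_subdivision n p \<sigma> = (singular_subdivision p ^^ n) (frag_of \<sigma>)"

text \<open>Linear extension over the field of the integral iterated subdivision.\<close>

definition subdivide :: "nat \<Rightarrow> nat \<Rightarrow> ('a simplex \<Rightarrow>\<^sub>0 'k::field) \<Rightarrow> 'a simplex \<Rightarrow>\<^sub>0 'k"
  where "subdivide n p z = poly_extend (\<lambda>\<sigma>. field_chain (iterated_subdivision n p \<sigma>)) z"

lemma keval_subdivide: "keval f (subdivide n p z) = keval (\<lambda>\<sigma>. ceval f (iterated_subdivision n p \<sigma>)) z"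
  by (simp add: subdivide_def keval_poly_extend keval_field_chain)

lemma keys_subdivide:
  assumes "\<rho> \<in> keys (subdivide n p z)"
  shows "\<exists>\<sigma>\<in>keys z. \<rho> \<in> keys (iterated_subdivision n p \<sigma>)"
proof -
  have "\<rho> \<in> (\<Union>\<sigma>\<in>keys z. keys
      (scale (lookup z \<sigma>) (field_chain (iterated_subdivision n p \<sigma>) :: _ \<Rightarrow>\<^sub>0 'b)))"
    using assms unfolding subdivide_def poly_extend_def by (rule subsetD[OF keys_sum])
  then obtain \<sigma> where "\<sigma> \<in> keys z"
    "\<rho> \<in> keys (scale (lookup z \<sigma>) (field_chain (iterated_subdivision n p \<sigma>) :: _ \<Rightarrow>\<^sub>0 'b))"
    by blast
  then show ?thesis using subsetD[OF keys_field_chain subsetD[OF keys_map_times]] by metis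
qed

lemma singular_chain_iterated_subdivision:
  assumes "singular_simplex p Y \<sigma>"
  shows "singular_chain p Y (iterated_subdivision n p \<sigma>)"
  unfolding iterated_subdivision_def
  by (induction n) (use assms in \<open>auto simp: singular_chain_of singular_chain_singular_subdivision\<close>)

text \<open>Needed for the homotopy operator of subdivision, which is known only to respect zero and
  differences.\<close>

lemma ceval_additive:
  assumes "h 0 = (0 :: 't \<Rightarrow>\<^sub>0 int)" "\<And>c d. h (c - d) = h c - h d"
  shows "ceval \<phi> (h c) = ceval (\<lambda>\<rho>. ceval \<phi> (h (frag_of \<rho>))) c"
proof -
  have "keys c \<subseteq> UNIV" by simp
  then show ?thesis
    by (induction c rule: frag_induction) (simp_all add: assms ceval_diff)
qed

text \<open>Iterated subdivision is chain homotopic to the identity by some \<open>h\<close>. Of the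
  two homotopy terms, the boundary of \<open>h \<sigma>\<close> is killed because
  \<open>\<phi>\<close> is closed; the value of \<open>\<phi>\<close> on \<open>h\<close> of the
  boundary is the coboundary of \<open>?g\<close>, which the cycle \<open>z\<close> kills.\<close>

lemma keval_subdivide_cocycle:
  assumes z: "kcycle p Y z" and \<phi>: "\<And>\<sigma>. singular_simplex (Suc p) Y \<sigma> \<Longrightarrow> cobd \<phi> (Suc p) \<sigma> = 0"
  shows "keval (\<phi> p) (subdivide n p z) = keval (\<phi> p) z"
proof -
  obtain h where h: "\<And>p. h p 0 = (0 :: 'a chain)" "\<And>p c1 c2. h p (c1 - c2) = h p c1 - h p c2"
    "\<And>p X c. singular_chain p X c \<Longrightarrow> singular_chain (Suc p) X (h p c)"
    "\<And>p X c. singular_chain p X c \<Longrightarrow>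
      chain_boundary (Suc p) (h p c) + h (p - Suc 0) (chain_boundary p c) = (singular_subdivision p ^^ n) c - c"
    using chain_homotopic_iterated_singular_subdivision[of n] by blast
  let ?g = "\<lambda>m \<rho>. ceval (\<phi> p) (h m (frag_of \<rho>))"
  have "ceval (\<phi> p) (iterated_subdivision n p \<sigma>) = \<phi> p \<sigma> + cobd ?g p \<sigma>" if "\<sigma> \<in> keys z" for \<sigma>
  proof -
    have s: "singular_simplex p Y \<sigma>" using that z by (auto simp: kcycle_def)
    then have sc: "singular_chain p Y (frag_of \<sigma>)" by (simp add: singular_chain_of)
    have "iterated_subdivision n p \<sigma>
        = frag_of \<sigma> + (chain_boundary (Suc p) (h p (frag_of \<sigma>)) + h (p - Suc 0) (chain_boundary p (frag_of \<sigma>)))"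
      unfolding iterated_subdivision_def h(4)[OF sc] by simp
    moreover have "ceval (\<phi> p) (chain_boundary (Suc p) (h p (frag_of \<sigma>))) = 0"
    proof -
      have "ceval (cobd \<phi> (Suc p)) (h p (frag_of \<sigma>)) = ceval (\<lambda>_. 0) (h p (frag_of \<sigma>))"
        by (rule ceval_fun_cong) (use h(3)[OF sc] \<phi> in \<open>auto simp: singular_chain_def\<close>)
      then show ?thesis by (simp add: ceval_cobd) (simp add: ceval_def)
    qed
    moreover have "ceval (\<phi> p) (h (p - Suc 0) (chain_boundary p (frag_of \<sigma>))) = cobd ?g p \<sigma>"
    proof (cases p)
      case 0
      then show ?thesis by (simp add: chain_boundary_def h(1))
    next
      case (Suc l)
      show ?thesis
        using ceval_additive[of "h l" "\<phi> p" "chain_boundary p (frag_of \<sigma>)"] h(1,2)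
        by (simp add: Suc cobd_eq_ceval)
    qed
    ultimately show ?thesis by (simp add: ceval_add)
  qed
  then have "keval (\<phi> p) (subdivide n p z) = keval (\<lambda>\<sigma>. \<phi> p \<sigma> + cobd ?g p \<sigma>) z"
    unfolding keval_subdivide by (intro keval_cong)
  also have "\<dots> = keval (\<phi> p) z" using z by (simp add: keval_fun_add kcycle_def)
  finally show ?thesis .
qed

lemma kcycle_subdivide:
  assumes z: "kcycle p Y z"
  shows "kcycle p Y (subdivide n p z)"
  unfolding kcycle_def
proof (intro conjI allI)
  show "keys (subdivide n p z) \<subseteq> singular_simplex_set p Y"
    using keys_subdivide[of _ n p z] singular_chain_iterated_subdivision[of p Y _ n] z
    by (fastforce simp: kcycle_def singular_chain_def)
  fix f
  have "keval (cobd f p) (subdivide n p z) = keval (cobd f p) z"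
    by (rule keval_subdivide_cocycle[OF z, of "cobd f"]) (rule cobd_cobd)
  then show "keval (cobd f p) (subdivide n p z) = 0" using z by (simp add: kcycle_def)
qed

text \<open>Lets a number of subdivisions that already works be enlarged: different pieces of the
  first cycle ask for different numbers on the second.\<close>

lemma iterated_subdivision_refines:
  assumes s: "singular_simplex p Y \<tau>" and "n \<le> N" and \<rho>: "\<rho> \<in> keys (iterated_subdivision N p \<tau>)"
  shows "\<exists>\<tau>'\<in>keys (iterated_subdivision n p \<tau>). \<rho> ` standard_simplex p \<subseteq> \<tau>' ` standard_simplex p"
proof -
  let ?c = "iterated_subdivision n p \<tau>"
  let ?D = "\<lambda>f. chain_map p f ((simplicial_subdivision p ^^ (N - n)) (frag_of (restrict id (standard_simplex p))))"
  have c: "singular_chain p Y ?c" by (rule singular_chain_iterated_subdivision[OF s])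
  have "iterated_subdivision N p \<tau> = (singular_subdivision p ^^ (N - n)) ?c"
    using \<open>n \<le> N\<close> unfolding iterated_subdivision_def by (simp flip: funpow_add[unfolded o_def fun_eq_iff, rule_format])
  also have "\<dots> = frag_extend ?D ?c" by (rule iterated_singular_subdivision[OF c])
  finally obtain \<tau>' where \<tau>': "\<tau>' \<in> keys ?c" "\<rho> \<in> keys (?D \<tau>')"
    using \<rho> keys_frag_extend[of ?D ?c] by auto
  have "singular_simplex p Y \<tau>'" using c \<tau>'(1) by (auto simp: singular_chain_def)
  \<comment> \<open>Regarding \<open>\<tau>'\<close> as a simplex of its own image forces all pieces
    of its subdivisions to lie in that image.\<close>
  then have s': "singular_simplex p (subtopology Y (\<tau>' ` standard_simplex p)) \<tau>'" by (simp add: singular_simplex_subtopology)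
  have "?D \<tau>' = iterated_subdivision (N - n) p \<tau>'"
    unfolding iterated_subdivision_def
    using iterated_singular_subdivision[of p _ "frag_of \<tau>'" "N - n"] s' by (simp add: singular_chain_of)
  then have "\<rho> ` standard_simplex p \<subseteq> \<tau>' ` standard_simplex p"
    using \<tau>'(2) singular_chain_iterated_subdivision[OF s', of "N - n"] by (auto simp: singular_chain_subtopology)
  then show ?thesis using \<tau>'(1) by blast
qed

lemma finite_uniform_bound:
  fixes P :: "'b \<Rightarrow> nat \<Rightarrow> bool"
  assumes "finite S" "\<And>x. x \<in> S \<Longrightarrow> \<exists>n. \<forall>m\<ge>n. P x m"
  obtains n where "\<And>x m. x \<in> S \<Longrightarrow> n \<le> m \<Longrightarrow> P x m"
proof -
  obtain f where f: "\<And>x m. x \<in> S \<Longrightarrow> f x \<le> m \<Longrightarrow> P x m" using assms(2) by metis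
  show ?thesis
    by (rule that[of "Max (insert 0 (f ` S))"]) (use f assms(1) in auto)
qed

text \<open>At a point \<open>x\<close> of \<open>Y1\<close>, finely subdivided simplices of the
  second family lie in slices of the \<open>U i\<close>. Their images are compact, so the tube lemma
  spreads this to a neighbourhood of \<open>x\<close>. The first family is subdivided subordinate to
  these neighbourhoods, and finitely many resulting pieces allow one common number for the second
  family.\<close>

lemma subdivision_pairs_small:
  assumes U: "\<And>i. i \<in> I \<Longrightarrow> openin (prod_topology Y1 Y2) (U i)" and cover: "topspace Y1 \<times> topspace Y2 \<subseteq> (\<Union>i\<in>I. U i)"
    and S1: "finite S1" "S1 \<subseteq> singular_simplex_set p Y1" and S2: "finite S2" "S2 \<subseteq> singular_simplex_set q Y2"
  obtains m n where "\<And>\<sigma> \<tau> \<sigma>' \<tau>'. \<sigma> \<in> S1 \<Longrightarrow> \<tau> \<in> S2 \<Longrightarrow> \<sigma>' \<in> keys (iterated_subdivision m p \<sigma>) \<Longrightarrow>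
    \<tau>' \<in> keys (iterated_subdivision n q \<tau>) \<Longrightarrow>
    \<exists>i\<in>I. \<sigma>' ` standard_simplex p \<times> \<tau>' ` standard_simplex q \<subseteq> U i"
proof -
  define T where "T n = (\<Union>\<tau>\<in>S2. keys (iterated_subdivision n q \<tau>))" for n
  have finT: "finite (T n)" for n using S2(1) by (simp add: T_def)
  have T_simplex: "singular_simplex q Y2 \<tau>'" if "\<tau>' \<in> T n" for \<tau>' n
    using that S2(2) singular_chain_iterated_subdivision[of q Y2 _ n] by (auto simp: T_def singular_chain_def)
  \<comment> \<open>\<open>f\<close> assigns a member of the cover to every piece of the
    \<open>n\<close>-fold subdivided second family, and \<open>V n f\<close> collects the points
    where this assignment works. The number \<open>n\<close> varies with the point, so it indexes
    the cover too.\<close>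
  define V where "V n f = {x \<in> topspace Y1. \<forall>\<tau>'\<in>T n. {x} \<times> \<tau>' ` standard_simplex q \<subseteq> U (f \<tau>')}" for n f
  define \<C> where "\<C> = {V n f | n f. f ` T n \<subseteq> I}"
  have openV: "openin Y1 (V n f)" if f: "f ` T n \<subseteq> I" for n f
  proof (subst openin_subopen, intro ballI)
    fix x assume x: "x \<in> V n f"
    have "\<exists>W. openin Y1 W \<and> x \<in> W \<and> W \<times> \<tau>' ` standard_simplex q \<subseteq> U (f \<tau>')" if t: "\<tau>' \<in> T n" for \<tau>'
    proof -
      have "compactin Y2 (\<tau>' ` standard_simplex q)"
        using T_simplex[OF t] unfolding singular_simplex_def
        by (intro image_compactin[of "simplex_top q"]) (auto simp: compactin_subtopology compactin_standard_simplex)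
      then obtain W W' where "openin Y1 W" "x \<in> W" "\<tau>' ` standard_simplex q \<subseteq> W'" "W \<times> W' \<subseteq> U (f \<tau>')"
        using tube_lemma_right[OF U[OF subsetD[OF f imageI[OF t]]], of "\<tau>' ` standard_simplex q" x] t x
        by (auto simp: V_def)
      then show ?thesis by blast
    qed
    then obtain W where W: "\<And>\<tau>'. \<tau>' \<in> T n \<Longrightarrow> openin Y1 (W \<tau>') \<and> x \<in> W \<tau>' \<and> W \<tau>' \<times> \<tau>' ` standard_simplex q \<subseteq> U (f \<tau>')"
      by metis
    let ?W = "topspace Y1 \<inter> (\<Inter>\<tau>'\<in>T n. W \<tau>')"
    have "openin Y1 ?W" using W finT by (intro openin_Int_Inter) auto
    moreover have "x \<in> ?W" using W x by (auto simp: V_def)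
    moreover have "?W \<subseteq> V n f" using W unfolding V_def by blast
    ultimately show "\<exists>W. openin Y1 W \<and> x \<in> W \<and> W \<subseteq> V n f" by blast
  qed
  have coverV: "topspace Y1 \<subseteq> \<Union>\<C>"
  proof
    fix x assume x: "x \<in> topspace Y1"
    let ?s = "\<lambda>i. {y \<in> topspace Y2. (x, y) \<in> U i}"
    have slice: "openin Y2 (?s i)" if "i \<in> I" for i
      using openin_continuous_map_preimage[OF _ U[OF that], of Y2 "\<lambda>y. (x, y)"] x by (simp add: continuous_map_pairwise o_def)
    have "\<exists>n. \<forall>m\<ge>n. \<forall>\<tau>'\<in>keys (iterated_subdivision m q \<tau>). \<exists>i\<in>I. \<tau>' ` standard_simplex q \<subseteq> ?s i"
      if \<tau>: "\<tau> \<in> S2" for \<tau>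
    proof -
      obtain n where n: "\<And>m f. n \<le> m \<Longrightarrow> f \<in> keys ((singular_subdivision q ^^ m) (frag_of \<tau>)) \<Longrightarrow>
          \<exists>V\<in>?s ` I. f \<in> standard_simplex q \<rightarrow> V"
      proof (rule sufficient_iterated_singular_subdivision_exists[of "?s ` I" Y2 q "frag_of \<tau>"])
        show "topspace Y2 \<subseteq> \<Union> (?s ` I)" using cover x by blast
        show "singular_chain q Y2 (frag_of \<tau>)" using \<tau> S2(2) by (auto simp: singular_chain_of)
      qed (use slice in auto)
      then show ?thesis unfolding iterated_subdivision_def image_subset_iff_funcset by blast
    qed
    then obtain n where n: "\<And>\<tau> m. \<tau> \<in> S2 \<Longrightarrow> n \<le> m \<Longrightarrow>
        \<forall>\<tau>'\<in>keys (iterated_subdivision m q \<tau>). \<exists>i\<in>I. \<tau>' ` standard_simplex q \<subseteq> ?s i"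
      using finite_uniform_bound[OF S2(1), of "\<lambda>\<tau> m. \<forall>\<tau>'\<in>keys (iterated_subdivision m q \<tau>). \<exists>i\<in>I. \<tau>' ` standard_simplex q \<subseteq> ?s i"]
      by blast
    then have "\<forall>\<tau>'\<in>T n. \<exists>i\<in>I. \<tau>' ` standard_simplex q \<subseteq> ?s i" by (auto simp: T_def)
    then obtain f where "\<And>\<tau>'. \<tau>' \<in> T n \<Longrightarrow> f \<tau>' \<in> I \<and> \<tau>' ` standard_simplex q \<subseteq> ?s (f \<tau>')" by metis
    then have "x \<in> V n f" "V n f \<in> \<C>" using x unfolding V_def \<C>_def by blast+
    then show "x \<in> \<Union>\<C>" by blast
  qed
  have "\<exists>n. \<forall>m\<ge>n. \<forall>\<sigma>'\<in>keys (iterated_subdivision m p \<sigma>). \<exists>V\<in>\<C>. \<sigma>' ` standard_simplex p \<subseteq> V"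
    if \<sigma>: "\<sigma> \<in> S1" for \<sigma>
  proof -
    obtain n where "\<And>m f. n \<le> m \<Longrightarrow> f \<in> keys ((singular_subdivision p ^^ m) (frag_of \<sigma>)) \<Longrightarrow>
        \<exists>V\<in>\<C>. f \<in> standard_simplex p \<rightarrow> V"
    proof (rule sufficient_iterated_singular_subdivision_exists[of \<C> Y1 p "frag_of \<sigma>"])
      show "singular_chain p Y1 (frag_of \<sigma>)" using \<sigma> S1(2) by (auto simp: singular_chain_of)
    qed (use coverV openV in \<open>auto simp: \<C>_def\<close>)
    then show ?thesis unfolding iterated_subdivision_def image_subset_iff_funcset by blast
  qed
  then obtain m where m: "\<And>\<sigma> m'. \<sigma> \<in> S1 \<Longrightarrow> m \<le> m' \<Longrightarrow>
      \<forall>\<sigma>'\<in>keys (iterated_subdivision m' p \<sigma>). \<exists>V\<in>\<C>. \<sigma>' ` standard_simplex p \<subseteq> V"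
    using finite_uniform_bound[OF S1(1), of "\<lambda>\<sigma> m. \<forall>\<sigma>'\<in>keys (iterated_subdivision m p \<sigma>). \<exists>V\<in>\<C>. \<sigma>' ` standard_simplex p \<subseteq> V"]
    by blast
  define S where "S = (\<Union>\<sigma>\<in>S1. keys (iterated_subdivision m p \<sigma>))"
  have "finite S" using S1(1) by (simp add: S_def)
  moreover have "\<exists>k. \<forall>n\<ge>k. \<forall>\<tau>'\<in>T n. \<exists>i\<in>I. \<sigma>' ` standard_simplex p \<times> \<tau>' ` standard_simplex q \<subseteq> U i"
    if \<sigma>': "\<sigma>' \<in> S" for \<sigma>'
  proof -
    obtain \<sigma> where "\<sigma> \<in> S1" "\<sigma>' \<in> keys (iterated_subdivision m p \<sigma>)"
      using \<sigma>' unfolding S_def by blast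
    then obtain W where "W \<in> \<C>" "\<sigma>' ` standard_simplex p \<subseteq> W" using m[OF _ order_refl] by blast
    then obtain k f where kf: "f ` T k \<subseteq> I" "\<sigma>' ` standard_simplex p \<subseteq> V k f"
      unfolding \<C>_def by blast
    \<comment> \<open>The assignment for \<open>k\<close> subdivisions serves finer ones: a finer
      piece \<open>\<tau>''\<close> inherits the member chosen for a piece \<open>\<tau>'\<close>
      containing its image.\<close>
    have "\<exists>i\<in>I. \<sigma>' ` standard_simplex p \<times> \<tau>'' ` standard_simplex q \<subseteq> U i" if k: "k \<le> n" "\<tau>'' \<in> T n" for n \<tau>''
    proof -
      obtain \<tau> where \<tau>: "\<tau> \<in> S2" "\<tau>'' \<in> keys (iterated_subdivision n q \<tau>)"
        using k(2) unfolding T_def by blast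
      then have "singular_simplex q Y2 \<tau>" using S2(2) by blast
      from iterated_subdivision_refines[OF this k(1) \<tau>(2)]
      obtain \<tau>' where \<tau>': "\<tau>' \<in> T k" "\<tau>'' ` standard_simplex q \<subseteq> \<tau>' ` standard_simplex q"
        using \<tau>(1) unfolding T_def by blast
      have "\<sigma>' ` standard_simplex p \<times> \<tau>' ` standard_simplex q \<subseteq> U (f \<tau>')"
        using kf(2) \<tau>'(1) unfolding V_def by blast
      with Sigma_mono[OF order_refl \<tau>'(2)]
      have "\<sigma>' ` standard_simplex p \<times> \<tau>'' ` standard_simplex q \<subseteq> U (f \<tau>')" by (rule order_trans)
      moreover have "f \<tau>' \<in> I" using kf(1) \<tau>'(1) by blast
      ultimately show ?thesis by blast
    qed
    then show ?thesis by blast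
  qed
  ultimately obtain n where n: "\<And>\<sigma>' n'. \<sigma>' \<in> S \<Longrightarrow> n \<le> n' \<Longrightarrow>
      \<forall>\<tau>'\<in>T n'. \<exists>i\<in>I. \<sigma>' ` standard_simplex p \<times> \<tau>' ` standard_simplex q \<subseteq> U i"
    using finite_uniform_bound[of S "\<lambda>\<sigma>' n. \<forall>\<tau>'\<in>T n. \<exists>i\<in>I. \<sigma>' ` standard_simplex p \<times> \<tau>' ` standard_simplex q \<subseteq> U i"]
    by blast
  show thesis
    by (rule that[of m n]) (use n[OF _ order_refl] in \<open>unfold S_def T_def, blast\<close>)
qed

section \<open>Evaluation of bicochains on pairs of cycles\<close>

lemma keval_swap: "keval (\<lambda>\<sigma>. keval (\<lambda>\<tau>. f \<sigma> \<tau>) w) z = keval (\<lambda>\<tau>. keval (\<lambda>\<sigma>. f \<sigma> \<tau>) z) w"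
  unfolding keval_def sum_distrib_left
  by (subst sum.swap) (simp add: mult.left_commute)

lemma cobd_keval: "cobd (\<lambda>p \<sigma>. keval (\<lambda>\<tau>. f p \<sigma> \<tau>) w) n \<sigma> = keval (\<lambda>\<tau>. cobd (\<lambda>p \<sigma>. f p \<sigma> \<tau>) n \<sigma>) w"
  by (cases n) (simp_all only: cobd_0 keval_fun_zero cobd_Suc keval_fun_sum keval_fun_mult)

text \<open>One variable at a time. Paired with a cycle in the other variable, a closed bicochain
  becomes a closed cochain: its partial coboundary is, up to sign, the other partial coboundary,
  which the cycle kills.\<close>

lemma keval_pair_subdivide:
  fixes F :: "('a, 'k::field) bicochain"
  assumes z: "kcycle p Y1 z" and w: "kcycle q Y2 w"
    and F: "\<And>p q \<sigma> \<tau>. singular_simplex p Y1 \<sigma> \<Longrightarrow> singular_simplex q Y2 \<tau> \<Longrightarrow> bicobd F p q \<sigma> \<tau> = 0"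
  shows "keval (\<lambda>\<sigma>. keval (F p q \<sigma>) (subdivide n q w)) (subdivide m p z) = keval (\<lambda>\<sigma>. keval (F p q \<sigma>) w) z"
proof -
  have 1: "keval (\<lambda>\<sigma>. keval (F p q \<sigma>) w) (subdivide m p z) = keval (\<lambda>\<sigma>. keval (F p q \<sigma>) w) z"
  proof (rule keval_subdivide_cocycle[OF z, of "\<lambda>p \<sigma>. keval (\<lambda>\<tau>. F p q \<sigma> \<tau>) w"])
    fix \<sigma> assume s: "singular_simplex (Suc p) Y1 \<sigma>"
    have "cobd (\<lambda>p \<sigma>. F p q \<sigma> \<tau>) (Suc p) \<sigma> = (-1) ^ p * cobd (\<lambda>q' \<tau>'. F (Suc p) q' \<sigma> \<tau>') q \<tau>"
      if "\<tau> \<in> keys w" for \<tau>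
      using F[OF s, of q \<tau>] that w by (auto simp: bicobd_def kcycle_def)
    then have "keval (\<lambda>\<tau>. cobd (\<lambda>p \<sigma>. F p q \<sigma> \<tau>) (Suc p) \<sigma>) w
        = keval (\<lambda>\<tau>. (-1) ^ p * cobd (\<lambda>q' \<tau>'. F (Suc p) q' \<sigma> \<tau>') q \<tau>) w"
      by (rule keval_cong)
    also have "\<dots> = 0" using w by (simp add: keval_fun_mult kcycle_def)
    finally show "cobd (\<lambda>p \<sigma>. keval (\<lambda>\<tau>. F p q \<sigma> \<tau>) w) (Suc p) \<sigma> = 0" unfolding cobd_keval .
  qed
  define z' where "z' = subdivide m p z"
  have z': "kcycle p Y1 z'" unfolding z'_def by (rule kcycle_subdivide[OF z])
  have 2: "keval (\<lambda>\<tau>. keval (\<lambda>\<sigma>. F p q \<sigma> \<tau>) z') (subdivide n q w) = keval (\<lambda>\<tau>. keval (\<lambda>\<sigma>. F p q \<sigma> \<tau>) z') w"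
  proof (rule keval_subdivide_cocycle[OF w, of "\<lambda>q \<tau>. keval (\<lambda>\<sigma>. F p q \<sigma> \<tau>) z'"])
    fix \<tau> assume s: "singular_simplex (Suc q) Y2 \<tau>"
    have "(-1) ^ p * cobd (\<lambda>q \<tau>. F p q \<sigma> \<tau>) (Suc q) \<tau> = - cobd (\<lambda>p' \<sigma>'. F p' (Suc q) \<sigma>' \<tau>) p \<sigma>"
      if "\<sigma> \<in> keys z'" for \<sigma>
      using F[OF _ s, of p \<sigma>] that z' by (auto simp: bicobd_def kcycle_def eq_neg_iff_add_eq_0 add.commute)
    then have "keval (\<lambda>\<sigma>. (-1) ^ p * cobd (\<lambda>q \<tau>. F p q \<sigma> \<tau>) (Suc q) \<tau>) z'
        = keval (\<lambda>\<sigma>. - 1 * cobd (\<lambda>p' \<sigma>'. F p' (Suc q) \<sigma>' \<tau>) p \<sigma>) z'"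
      by (intro keval_cong) simp
    also have "\<dots> = 0" using z' unfolding keval_fun_mult by (simp add: kcycle_def)
    finally show "cobd (\<lambda>q \<tau>. keval (\<lambda>\<sigma>. F p q \<sigma> \<tau>) z') (Suc q) \<tau> = 0"
      unfolding cobd_keval keval_fun_mult by simp
  qed
  show ?thesis
    using 1 2 unfolding z'_def[symmetric] by (simp add: keval_swap[of "F p q"])
qed

lemma keval_pair_bicobd:
  assumes z: "kcycle p Y1 z" and w: "kcycle q Y2 w"
  shows "keval (\<lambda>\<sigma>. keval (bicobd G p q \<sigma>) w) z = 0"
proof -
  have "keval (\<lambda>\<sigma>. keval (bicobd G p q \<sigma>) w) z
      = keval (\<lambda>\<sigma>. keval (\<lambda>\<tau>. cobd (\<lambda>p' \<sigma>'. G p' q \<sigma>' \<tau>) p \<sigma>) w) z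
        + keval (\<lambda>\<sigma>. (-1) ^ p * keval (\<lambda>\<tau>. cobd (\<lambda>q' \<tau>'. G p q' \<sigma> \<tau>') q \<tau>) w) z"
    by (simp add: bicobd_def[abs_def] keval_fun_add keval_fun_mult)
  also have "\<dots> = 0"
    using z w by (simp add: keval_swap[of "\<lambda>\<sigma> \<tau>. cobd (\<lambda>p' \<sigma>'. G p' q \<sigma>' \<tau>) p \<sigma>"] kcycle_def)
  finally show ?thesis .
qed

text \<open>The target of a section is enlarged from \<open>path_space_on X A\<close> to
  \<open>path_space X\<close>, since the joins are formed in \<open>X\<close>.\<close>

lemma TC_le_enatE:
  assumes "TC X A \<le> enat j"
  obtains k U where "k \<le> j" "(\<Union>i\<in>{1..k}. U i) = A"
    "\<And>i. i \<in> {1..k} \<Longrightarrow> openin (subtopology (prod_topology X X) A) (U i)"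
    "\<And>i. i \<in> {1..k} \<Longrightarrow> \<exists>s. section_on X (U i) s"
proof -
  \<comment> \<open>A strict bound on the infimum yields an actual member of the set, that is, a
    cover by \<open>k < Suc j\<close> sets.\<close>
  have "TC X A < enat (Suc j)" using assms by (rule order.strict_trans1) simp
  then obtain k U where k: "k < Suc j" "(\<Union>i\<in>{1..k}. U i) = A"
    and U: "\<And>i. i \<in> {1..k} \<Longrightarrow> openin (subtopology (prod_topology X X) A) (U i) \<and>
        (\<exists>s. continuous_map (subtopology (prod_topology X X) (U i)) (path_space_on X A) s \<and>
             (\<forall>(x, y)\<in>U i. s (x, y) 0 = x \<and> s (x, y) 1 = y))"
    unfolding TC_def Inf_less_iff by auto
  have "\<exists>s. section_on X (U i) s" if i: "i \<in> {1..k}" for i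
  proof -
    obtain s where "continuous_map (subtopology (prod_topology X X) (U i)) (path_space_on X A) s"
      "\<forall>(x, y)\<in>U i. s (x, y) 0 = x \<and> s (x, y) 1 = y"
      using U[OF i] by blast
    then have "section_on X (U i) s"
      by (intro section_on.intro) (auto simp: path_space_on_def continuous_map_in_subtopology)
    then show ?thesis by blast
  qed
  then show ?thesis using that[of k U] k U by auto
qed

theorem theorem2p11:
  fixes X :: "'a topology" and Y1 Y2 :: "'a set"
    and j :: nat and \<alpha> :: "nat \<Rightarrow> ('a, 'k::field) cohom_tensor"
  assumes "Y1 \<subseteq> topspace X" and "Y2 \<subseteq> topspace X"
    and "\<And>i. i \<in> {1..j} \<Longrightarrow>
      \<alpha> i \<in> a_kernel (cohom_tensor_algebra X) (cohomology_algebra X) (cup_map X)"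
    and "tensor_map (cohomology_algebra (subtopology X Y1)) (cohomology_algebra (subtopology X Y2))
           (cohom_pullback (subtopology X Y1) id) (cohom_pullback (subtopology X Y2) id)
           (foldr (mult (cohom_tensor_algebra X)) (map \<alpha> [1..<Suc j]) \<one>\<^bsub>cohom_tensor_algebra X\<^esub>)
         \<noteq> \<zero>\<^bsub>tensor_product (cohomology_algebra (subtopology X Y1))
                            (cohomology_algebra (subtopology X Y2))\<^esub>"
  shows "TC X (Y1 \<times> Y2) > enat j"
proof (rule ccontr)
  let ?Y1 = "subtopology X Y1" and ?Y2 = "subtopology X Y2"
  assume "\<not> enat j < TC X (Y1 \<times> Y2)"
  then have "TC X (Y1 \<times> Y2) \<le> enat j" by simp
  then obtain k U where k: "k \<le> j" and cover: "(\<Union>i\<in>{1..k}. U i) = Y1 \<times> Y2"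
    and openU: "\<And>i. i \<in> {1..k} \<Longrightarrow> openin (subtopology (prod_topology X X) (Y1 \<times> Y2)) (U i)"
    and sec: "\<And>i. i \<in> {1..k} \<Longrightarrow> \<exists>s. section_on X (U i) s"
    by (rule TC_le_enatE) blast
  \<comment> \<open>There may be fewer sets than factors. The first \<open>k\<close> factors get
    representatives vanishing on their own \<open>U i\<close>; for the others any representative
    will do.\<close>
  have "\<exists>F. represented_mod X (\<alpha> i) F \<and>
      (i \<le> k \<longrightarrow> (\<forall>p q \<sigma> \<tau>. section_on.small X (U i) p q \<sigma> \<tau> \<longrightarrow> F p q \<sigma> \<tau> = 0))" if i: "i \<in> {1..j}" for i
  proof -
    have a: "\<alpha> i \<in> carrier (HH X X)"
      "cup_map X (\<alpha> i) = \<zero>\<^bsub>H X\<^esub>"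
      using assms(3)[OF i] by (auto simp: a_kernel_def' cohom_tensor_algebra_simps)
    show ?thesis
    proof (cases "i \<le> k")
      case True
      then obtain s where "section_on X (U i) s" using sec i by auto
      then interpret section_on X "U i" s .
      obtain F where "represented_mod X (\<alpha> i) F" "\<And>p q \<sigma> \<tau>. small p q \<sigma> \<tau> \<Longrightarrow> F p q \<sigma> \<tau> = 0"
        using kernel_represented_vanishing[OF a] by blast
      then show ?thesis by blast
    next
      case False
      obtain \<Theta> where \<Theta>: "represented X X (\<alpha> i) \<Theta>" using represented_exists[OF a(1)] by blast
      have "represented_mod X (\<alpha> i) \<Theta>"
        unfolding represented_mod_def
        by (rule exI[of _ \<Theta>], rule exI[of _ "\<lambda>p q \<sigma> \<tau>. 0"]) (simp add: \<Theta> bicobd_def)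
      then show ?thesis using False by blast
    qed
  qed
  then have "\<exists>F. \<forall>i\<in>{1..j}. represented_mod X (\<alpha> i) (F i) \<and>
      (i \<le> k \<longrightarrow> (\<forall>p q \<sigma> \<tau>. section_on.small X (U i) p q \<sigma> \<tau> \<longrightarrow> F i p q \<sigma> \<tau> = 0))"
    by (intro bchoice ballI)
  then obtain F where F': "\<forall>i\<in>{1..j}. represented_mod X (\<alpha> i) (F i) \<and>
      (i \<le> k \<longrightarrow> (\<forall>p q \<sigma> \<tau>. section_on.small X (U i) p q \<sigma> \<tau> \<longrightarrow> F i p q \<sigma> \<tau> = 0))" ..
  have F: "represented_mod X (\<alpha> i) (F i)" if "i \<in> {1..j}" for i
    using F' that by blast
  have F_small: "F i p q \<sigma> \<tau> = 0" if "i \<in> {1..k}" "section_on.small X (U i) p q \<sigma> \<tau>" for i p q \<sigma> \<tau>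
    using F' that k by auto
  let ?one = "cross (unit_family X) (unit_family X) :: ('a, 'k) bicochain"
  define P where "P = foldr bicup (map F [1..<Suc j]) ?one"
  define t where "t = foldr (mult (cohom_tensor_algebra X)) (map \<alpha> [1..<Suc j]) \<one>\<^bsub>cohom_tensor_algebra X\<^esub>"
  have one: "represented_mod X \<one>\<^bsub>cohom_tensor_algebra X\<^esub> ?one"
    unfolding represented_mod_def
    by (rule exI[of _ ?one], rule exI[of _ "\<lambda>p q \<sigma> \<tau>. 0"]) (simp add: represented_one bicobd_def)
  have mult: "represented_mod X (foldr (mult (cohom_tensor_algebra X)) (map \<alpha> is) \<one>\<^bsub>cohom_tensor_algebra X\<^esub>)
      (foldr bicup (map F is) ?one)" if "set is \<subseteq> {1..j}" for "is"
    using that by (induction "is") (auto intro!: represented_mod_mult F simp: one)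
  have P: "represented_mod X t P" unfolding P_def t_def by (rule mult) auto
  \<comment> \<open>One factor that vanishes on the small pairs of \<open>U i\<close> makes the
    whole product vanish there, wherever it stands in the list.\<close>
  have "foldr bicup (map F is) ?one p q \<sigma> \<tau> = 0"
    if "i \<in> {1..k}" "i \<in> set is" "section_on.small X (U i) p q \<sigma> \<tau>" for i "is" p q \<sigma> \<tau>
    using that
  proof (induction "is" arbitrary: p q \<sigma> \<tau>)
    case (Cons l ls)
    obtain s where "section_on X (U i) s" using sec Cons.prems(1) by auto
    then interpret section_on X "U i" s .
    show ?case
    proof (cases "i = l")
      case True
      have "bicup (F l) (foldr bicup (map F ls) ?one) p q \<sigma> \<tau>
          = bicup (\<lambda>p q \<sigma> \<tau>. 0) (foldr bicup (map F ls) ?one) p q \<sigma> \<tau>"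
        by (rule bicup_cong_small[OF Cons.prems(3)]) (use F_small Cons.prems(1) True in auto)
      then show ?thesis by simp
    next
      case False
      have "bicup (F l) (foldr bicup (map F ls) ?one) p q \<sigma> \<tau> = bicup (F l) (\<lambda>p q \<sigma> \<tau>. 0) p q \<sigma> \<tau>"
        by (rule bicup_cong_small[OF Cons.prems(3)]) (use Cons.IH Cons.prems False in auto)
      then show ?thesis by simp
    qed
  qed simp
  \<comment> \<open>Since \<open>k \<le> j\<close>, every set of the cover has its factor in the
    product.\<close>
  then have P_small: "P p q \<sigma> \<tau> = 0" if "i \<in> {1..k}" "section_on.small X (U i) p q \<sigma> \<tau>" for i p q \<sigma> \<tau>
    unfolding P_def using that k by (simp del: upt_Suc)
  obtain \<Theta> G where \<Theta>: "represented X X t \<Theta>"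
    "\<And>p q \<sigma> \<tau>. singular_simplex p X \<sigma> \<Longrightarrow> singular_simplex q X \<tau> \<Longrightarrow> P p q \<sigma> \<tau> = \<Theta> p q \<sigma> \<tau> + bicobd G p q \<sigma> \<tau>"
    using P unfolding represented_mod_def by blast
  have "tensor_map (H ?Y1) (H ?Y2) (cohom_pullback ?Y1 id) (cohom_pullback ?Y2 id) t
      = \<zero>\<^bsub>HH ?Y1 ?Y2\<^esub>"
  proof (rule represented_zero_if_zero_on_cycles[OF represented_pullback[OF \<Theta>(1)]])
    fix p q and z w :: "'a simplex \<Rightarrow>\<^sub>0 'k"
    assume z: "kcycle p ?Y1 z" and w: "kcycle q ?Y2 w"
    have zs: "keys z \<subseteq> singular_simplex_set p ?Y1" and ws: "keys w \<subseteq> singular_simplex_set q ?Y2"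
      using z w by (auto simp: kcycle_def)
    have openU': "openin (prod_topology ?Y1 ?Y2) (U i)" if "i \<in> {1..k}" for i
      using openU[OF that] by (simp add: subtopology_Times)
    have cover': "topspace ?Y1 \<times> topspace ?Y2 \<subseteq> (\<Union>i\<in>{1..k}. U i)" unfolding cover by auto
    obtain m n where mn: "\<And>\<sigma> \<tau> \<sigma>' \<tau>'. \<sigma> \<in> keys z \<Longrightarrow> \<tau> \<in> keys w \<Longrightarrow>
        \<sigma>' \<in> keys (iterated_subdivision m p \<sigma>) \<Longrightarrow> \<tau>' \<in> keys (iterated_subdivision n q \<tau>) \<Longrightarrow>
        \<exists>i\<in>{1..k}. \<sigma>' ` standard_simplex p \<times> \<tau>' ` standard_simplex q \<subseteq> U i"
      using subdivision_pairs_small[where U = U, OF openU' cover' finite_keys zs finite_keys ws] by blast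
    have zero: "P p q \<sigma>' \<tau>' = 0"
      if keys: "\<sigma>' \<in> keys (subdivide m p z)" "\<tau>' \<in> keys (subdivide n q w)" for \<sigma>' \<tau>'
    proof -
      obtain \<sigma> where \<sigma>: "\<sigma> \<in> keys z" "\<sigma>' \<in> keys (iterated_subdivision m p \<sigma>)"
        using keys_subdivide[OF keys(1)] by blast
      obtain \<tau> where \<tau>: "\<tau> \<in> keys w" "\<tau>' \<in> keys (iterated_subdivision n q \<tau>)"
        using keys_subdivide[OF keys(2)] by blast
      obtain i where i: "i \<in> {1..k}" "\<sigma>' ` standard_simplex p \<times> \<tau>' ` standard_simplex q \<subseteq> U i"
        using mn[OF \<sigma>(1) \<tau>(1) \<sigma>(2) \<tau>(2)] by blast
      obtain s where "section_on X (U i) s" using sec[OF i(1)] by blast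
      then interpret section_on X "U i" s .
      have "singular_simplex p ?Y1 \<sigma>'" "singular_simplex q ?Y2 \<tau>'"
        using kcycle_subdivide[OF z, of m] kcycle_subdivide[OF w, of n] keys by (auto simp: kcycle_def)
      then have "small p q \<sigma>' \<tau>'" using i(2) by (simp add: small_def singular_simplex_subtopology)
      then show ?thesis by (rule P_small[OF i(1)])
    qed
    \<comment> \<open>On the pair of cycles, \<open>\<Theta>\<close> and \<open>P\<close> agree
      because a total coboundary evaluates to zero. \<open>P\<close> is closed, so its value
      survives subdivision, and after subdivision every pair that occurs lies in some
      \<open>U i\<close>.\<close>
    have "keval (\<lambda>\<sigma>. keval (\<Theta> p q \<sigma>) w) z + keval (\<lambda>\<sigma>. keval (bicobd G p q \<sigma>) w) z = keval (\<lambda>\<sigma>. keval (P p q \<sigma>) w) z"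
      unfolding keval_fun_add[symmetric]
      by (intro keval_cong) (use zs ws \<Theta>(2) in \<open>auto simp: singular_simplex_subtopology subset_iff\<close>)
    also have "\<dots> = keval (\<lambda>\<sigma>. keval (P p q \<sigma>) (subdivide n q w)) (subdivide m p z)"
      by (rule keval_pair_subdivide[OF z w, symmetric])
        (use represented_mod_cocycle[OF P] in \<open>auto simp: singular_simplex_subtopology\<close>)
    also have "\<dots> = keval (\<lambda>\<sigma>. 0) (subdivide m p z)"
    proof (rule keval_cong)
      fix \<sigma> assume "\<sigma> \<in> keys (subdivide m p z)"
      then have "keval (P p q \<sigma>) (subdivide n q w) = keval (\<lambda>\<tau>. 0) (subdivide n q w)"
        by (intro keval_cong zero)
      then show "keval (P p q \<sigma>) (subdivide n q w) = 0" by simp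
    qed
    finally show "keval (\<lambda>\<sigma>. keval (\<Theta> p q \<sigma>) w) z = 0"
      using keval_pair_bicobd[OF z w, of G] by simp
  qed
  then show False using assms(4) unfolding t_def by simp
qed

end
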